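(* Let $k$ be a fixed positive integer, let $\Pi_1,\dots,\Pi_k$ be fixed graph properties, let $D_k$ be a $k\times k$ degree constraint matrix in which every entry $D_k[i,j]$ is a finite or co-finite subset of $\mathbb{N}$, and let $\mathsf{R}\in\{\textsc{Ext},\textsc{Min},\textsc{Max}\}$. Suppose that for each $i\in\{1,\dots,k\}$, $\Pi_i$ or $\overline{\Pi_i}$ is the class of all graphs or the class of all cluster graphs. Then there is a polynomial-time algorithm that, given a graph $G$ and a branch decomposition of $G$ of mim-width at most $1$, solves $\mathsf{R}$-$(\Pi_1,\dots,\Pi_k)$-\textsc{Partition With $D_k$}; the same holds for the variant in which some prescribed parts among $V_1,\dots,V_k$ are additionally required to induce connected subgraphs.
   Context: $\overline{\Pi}=\{\overline{G}:G\in\Pi\}$ where $\overline{G}$ is the complement. A cluster graph is one whose components are complete. $\mathbb{N}$ denotes the natural numbers including $0$. A degree constraint matrix $D_k$ is a $k\times k$ matrix whose entries are subsets of $\mathbb{N}$. $\mathsf{R}$-$(\Pi_1,\dots,\Pi_k)$-\textsc{Partition With $D_k$}: given $G$, find a partition $(V_1,\dots,V_k)$ of $V(G)$ (parts may be empty) such that $G[V_i]\in\Pi_i$ for every $i$; $|N_G(v)\cap V_j|\in D_k[i,j]$ for all $i,j$ and every $v\in V_i$; and $|V_1|$ is minimized if $\mathsf{R}=\textsc{Min}$, maximized if $\mathsf{R}=\textsc{Max}$, unconstrained if $\mathsf{R}=\textsc{Ext}$ (or report that no such partition exists). For $A\subseteq V(G)$, $\mathrm{mim}_G(A)$ is the maximum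 size of an induced matching among the edges between $A$ and $V(G)\setminus A$. A branch decomposition $(T,L)$ of $G$: $T$ a tree with internal nodes of degree $3$ and $|V(G)|$ leaves, $L$ a bijection from $V(G)$ to leaves; each tree edge $e$ gives a bipartition $(A^e_1,A^e_2)$; its mim-width is $\max_e\mathrm{mim}_G(A^e_1)$. *)

theory Defs
  imports
    "Graph_Theory.Graph_Theory"
    "HOL-Library.Disjoint_Sets"
    "HOL-Computational_Algebra.Polynomial"
begin

section \<open>Graphs\<close>

text \<open>Finite simple undirected graphs are the symmetric loop-free pair digraphs of the locale
  \<open>pair_graph\<close>: an edge is represented by its two orientations.\<close>

type_synonym graph_class = "nat pair_pre_digraph set"

definition nbhd :: "'a pair_pre_digraph \<Rightarrow> 'a \<Rightarrow> 'a set" where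
  "nbhd G v = {u. (v, u) \<in> parcs G}"

definition induced :: "'a pair_pre_digraph \<Rightarrow> 'a set \<Rightarrow> 'a pair_pre_digraph" where
  "induced G S = \<lparr> pverts = S, parcs = {e \<in> parcs G. fst e \<in> S \<and> snd e \<in> S} \<rparr>"

lemma with_proj_induced: "with_proj (induced G S) = with_proj G \<restriction> S"
  by (simp add: induced_def induce_subgraph_def with_proj_def)

definition complement :: "'a pair_pre_digraph \<Rightarrow> 'a pair_pre_digraph" where
  "complement G = \<lparr> pverts = pverts G,
     parcs = {(u, v). u \<in> pverts G \<and> v \<in> pverts G \<and> u \<noteq> v \<and> (u, v) \<notin> parcs G} \<rparr>"

definition all_graphs :: graph_class where
  "all_graphs = {G. pair_graph G}"

text \<open>In a symmetric digraph the strongly connected components, whose vertex sets form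
  \<open>sccs_verts\<close>, are the connected components.\<close>

definition cluster_graphs :: graph_class where
  "cluster_graphs = {G. pair_graph G \<and>
     (\<forall>C \<in> pre_digraph.sccs_verts (with_proj G).
        \<forall>u \<in> C. \<forall>v \<in> C. u \<noteq> v \<longrightarrow> (u, v) \<in> parcs G)}"

definition graph_property :: "graph_class \<Rightarrow> bool" where
  "graph_property P \<longleftrightarrow> P \<subseteq> all_graphs \<and>
     (\<forall>G \<in> P. \<forall>H \<in> all_graphs. digraph_iso (with_proj G) (with_proj H) \<longrightarrow> H \<in> P)"

definition co_class :: "graph_class \<Rightarrow> graph_class" where
  "co_class P = complement ` P"

text \<open>Parts of a partition may be empty, and an empty part counts as connected; the library
  predicate excludes the graph without vertices.\<close>

definition induces_connected :: "'a pair_pre_digraph \<Rightarrow> 'a set \<Rightarrow> bool" where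
  "induces_connected G S \<longleftrightarrow>
     S = {} \<or> Digraph_Component.connected (with_proj (induced G S))"


section \<open>Mim-width\<close>

text \<open>A cut edge is oriented from \<open>A\<close> to its complement, so each is represented once.
  The matching is induced in the bipartite graph of the cut: edges inside \<open>A\<close> or
  inside the complement are ignored.\<close>

definition induced_cut_matching ::
    "'a pair_pre_digraph \<Rightarrow> 'a set \<Rightarrow> ('a \<times> 'a) set \<Rightarrow> bool" where
  "induced_cut_matching G A M \<longleftrightarrow>
     M \<subseteq> {(a, b) \<in> parcs G. a \<in> A \<and> b \<in> pverts G - A} \<and>
     (\<forall>(a, b) \<in> M. \<forall>(c, d) \<in> M. (a, b) \<noteq> (c, d) \<longrightarrow>
        a \<noteq> c \<and> b \<noteq> d \<and> (a, d) \<notin> parcs G \<and> (c, b) \<notin> parcs G)"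

definition mim :: "'a pair_pre_digraph \<Rightarrow> 'a set \<Rightarrow> nat" where
  "mim G A = Max (card ` {M. induced_cut_matching G A M})"

text \<open>The library predicate \<open>tree\<close> is of no use for symmetric digraphs, because it
  counts going back and forth along one edge as a cycle.\<close>

definition undirected_tree :: "'a pair_pre_digraph \<Rightarrow> bool" where
  "undirected_tree T \<longleftrightarrow> pair_graph T \<and> Digraph_Component.connected (with_proj T) \<and>
     (\<nexists>p. pre_digraph.cycle (with_proj T) p \<and> length p \<ge> 3)"

text \<open>A leaf has degree at most 1, so the one-vertex tree has one leaf and decomposes the
  one-vertex graph.\<close>

definition leaves :: "'a pair_pre_digraph \<Rightarrow> 'a set" where
  "leaves T = {x \<in> pverts T. card (nbhd T x) \<le> 1}"

definition branch_decomposition ::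
    "'a pair_pre_digraph \<Rightarrow> 'b pair_pre_digraph \<Rightarrow> ('a \<Rightarrow> 'b) \<Rightarrow> bool" where
  "branch_decomposition G T L \<longleftrightarrow> undirected_tree T \<and>
     (\<forall>x \<in> pverts T - leaves T. card (nbhd T x) = 3) \<and>
     bij_betw L (pverts G) (leaves T)"

definition remove_edge :: "'a pair_pre_digraph \<Rightarrow> 'a \<times> 'a \<Rightarrow> 'a pair_pre_digraph" where
  "remove_edge T e = \<lparr> pverts = pverts T, parcs = parcs T - {e, prod.swap e} \<rparr>"

text \<open>The vertices of \<open>G\<close> mapped to the component of \<open>T - e\<close> that contains the first
  end of \<open>e\<close>. The reversed orientation of \<open>e\<close> gives the other side.\<close>

definition side ::
    "'a pair_pre_digraph \<Rightarrow> 'b pair_pre_digraph \<Rightarrow> ('a \<Rightarrow> 'b) \<Rightarrow> 'b \<times> 'b \<Rightarrow> 'a set" where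
  "side G T L e = {v \<in> pverts G. fst e \<rightarrow>\<^sup>*\<^bsub>with_proj (remove_edge T e)\<^esub> L v}"

text \<open>The inserted 0 matters only for a tree without edges.\<close>

definition mim_width ::
    "'a pair_pre_digraph \<Rightarrow> 'b pair_pre_digraph \<Rightarrow> ('a \<Rightarrow> 'b) \<Rightarrow> nat" where
  "mim_width G T L = Max (insert 0 ((\<lambda>e. mim G (side G T L e)) ` parcs T))"


section \<open>Partition problems\<close>

text \<open>Parts are indexed by \<open>1, \<dots>, k\<close>; values at other indices are irrelevant.\<close>

definition is_partition :: "nat \<Rightarrow> 'a pair_pre_digraph \<Rightarrow> (nat \<Rightarrow> 'a set) \<Rightarrow> bool" where
  "is_partition k G V \<longleftrightarrow>
     disjoint_family_on V {1..k} \<and> (\<Union>i \<in> {1..k}. V i) = pverts G"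

definition feasible ::
    "nat \<Rightarrow> (nat \<Rightarrow> graph_class) \<Rightarrow> (nat \<Rightarrow> nat \<Rightarrow> nat set) \<Rightarrow> nat pair_pre_digraph
      \<Rightarrow> (nat \<Rightarrow> nat set) \<Rightarrow> bool" where
  "feasible k P D G V \<longleftrightarrow> is_partition k G V \<and>
     (\<forall>i \<in> {1..k}. induced G (V i) \<in> P i) \<and>
     (\<forall>i \<in> {1..k}. \<forall>j \<in> {1..k}. \<forall>v \<in> V i. card (nbhd G v \<inter> V j) \<in> D i j)"

definition connected_feasible ::
    "nat \<Rightarrow> (nat \<Rightarrow> graph_class) \<Rightarrow> (nat \<Rightarrow> nat \<Rightarrow> nat set) \<Rightarrow> nat set
      \<Rightarrow> nat pair_pre_digraph \<Rightarrow> (nat \<Rightarrow> nat set) \<Rightarrow> bool" where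
  "connected_feasible k P D C G V \<longleftrightarrow>
     feasible k P D G V \<and> (\<forall>i \<in> C. induces_connected G (V i))"

datatype objective = ObjExt | ObjMin | ObjMax

fun optimal :: "objective \<Rightarrow> ((nat \<Rightarrow> nat set) \<Rightarrow> bool) \<Rightarrow> (nat \<Rightarrow> nat set) \<Rightarrow> bool" where
  "optimal ObjExt F V \<longleftrightarrow> F V"
| "optimal ObjMin F V \<longleftrightarrow> F V \<and> (\<forall>W. F W \<longrightarrow> card (V 1) \<le> card (W 1))"
| "optimal ObjMax F V \<longleftrightarrow> F V \<and> (\<forall>W. F W \<longrightarrow> card (W 1) \<le> card (V 1))"


section \<open>Polynomial time\<close>

text \<open>Algorithms are programs of a first-order, call-by-value Lisp without mutation: data are
  binary trees, the basic operations are construction, projection and test for the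
  atom, and a program is a list of mutually recursive function definitions. Every evaluation step
  costs one unit. A step creates at most one cell and otherwise moves a bounded
  number of pointers, so with shared subtrees evaluation is simulated with polynomial overhead by
  a Turing machine, and conversely; hence polynomial time here is
  polynomial time in the usual sense for answers of polynomial size (Jones, Computability
  and Complexity from a Programming Perspective, 1997).\<close>

datatype sexp = Atom | Pair sexp sexp

datatype expr =
    Var nat
  | ENil
  | ECons expr expr
  | EFst expr
  | ESnd expr
  | EIf expr expr expr
  | ELet expr expr
  | ECall nat "expr list"

type_synonym program = "expr list"

fun sfst :: "sexp \<Rightarrow> sexp" where
  "sfst Atom = Atom"
| "sfst (Pair a b) = a"

fun ssnd :: "sexp \<Rightarrow> sexp" where
  "ssnd Atom = Atom"
| "ssnd (Pair a b) = b"

text \<open>\<open>eval p env e v t\<close>: in the environment \<open>env\<close> (variables are positions in it,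
  \<open>ELet\<close> binds position 0), \<open>e\<close> evaluates to \<open>v\<close> in \<open>t\<close> steps.
  \<open>EIf\<close> takes its third argument exactly if the condition evaluates to \<open>Atom\<close>.\<close>

inductive eval :: "program \<Rightarrow> sexp list \<Rightarrow> expr \<Rightarrow> sexp \<Rightarrow> nat \<Rightarrow> bool"
  and evals :: "program \<Rightarrow> sexp list \<Rightarrow> expr list \<Rightarrow> sexp list \<Rightarrow> nat \<Rightarrow> bool"
  for p :: program where
  eval_Var: "i < length env \<Longrightarrow> eval p env (Var i) (env ! i) 1"
| eval_Nil: "eval p env ENil Atom 1"
| eval_Cons: "eval p env a u s \<Longrightarrow> eval p env b v t
    \<Longrightarrow> eval p env (ECons a b) (Pair u v) (s + t + 1)"
| eval_Fst: "eval p env a u s \<Longrightarrow> eval p env (EFst a) (sfst u) (s + 1)"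
| eval_Snd: "eval p env a u s \<Longrightarrow> eval p env (ESnd a) (ssnd u) (s + 1)"
| eval_If_then: "eval p env c u r \<Longrightarrow> u \<noteq> Atom \<Longrightarrow> eval p env a v s
    \<Longrightarrow> eval p env (EIf c a b) v (r + s + 1)"
| eval_If_else: "eval p env c Atom r \<Longrightarrow> eval p env b v s
    \<Longrightarrow> eval p env (EIf c a b) v (r + s + 1)"
| eval_Let: "eval p env a u s \<Longrightarrow> eval p (u # env) b v t
    \<Longrightarrow> eval p env (ELet a b) v (s + t + 1)"
| eval_Call: "evals p env as us s \<Longrightarrow> f < length p \<Longrightarrow> eval p us (p ! f) v t
    \<Longrightarrow> eval p env (ECall f as) v (s + t + 1)"
| evals_Nil: "evals p env [] [] 0"
| evals_Cons: "eval p env a u s \<Longrightarrow> evals p env as us t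
    \<Longrightarrow> evals p env (a # as) (u # us) (s + t)"

inductive_cases eval_VarE: "eval p env (Var i) v t"
inductive_cases eval_NilE: "eval p env ENil v t"
inductive_cases eval_ConsE: "eval p env (ECons a b) v t"
inductive_cases eval_FstE: "eval p env (EFst a) v t"
inductive_cases eval_SndE: "eval p env (ESnd a) v t"
inductive_cases eval_IfE: "eval p env (EIf c a b) v t"
inductive_cases eval_LetE: "eval p env (ELet a b) v t"
inductive_cases eval_CallE: "eval p env (ECall f as) v t"
inductive_cases evals_NilE: "evals p env [] vs t"
inductive_cases evals_ConsE: "evals p env (a # as) vs t"

lemma eval_deterministic:
  shows "eval p env e v t \<Longrightarrow> eval p env e v' t' \<Longrightarrow> v' = v \<and> t' = t"
    and "evals p env es vs t \<Longrightarrow> evals p env es vs' t' \<Longrightarrow> vs' = vs \<and> t' = t"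
proof (induction arbitrary: v' t' and vs' t' rule: eval_evals.inducts)
  case eval_Var then show ?case by (auto elim: eval_VarE)
next
  case eval_Nil then show ?case by (auto elim: eval_NilE)
next
  case eval_Cons
  from eval_Cons.prems show ?case by (auto elim!: eval_ConsE dest!: eval_Cons.IH(2,4))
next
  case eval_Fst
  from eval_Fst.prems show ?case by (auto elim!: eval_FstE dest!: eval_Fst.IH(2))
next
  case eval_Snd
  from eval_Snd.prems show ?case by (auto elim!: eval_SndE dest!: eval_Snd.IH(2))
next
  case eval_If_then
  from eval_If_then.prems eval_If_then.hyps show ?case by (auto elim!: eval_IfE dest!: eval_If_then.IH(2,4))
next
  case eval_If_else
  from eval_If_else.prems show ?case by (auto elim!: eval_IfE dest!: eval_If_else.IH(2,4))
next
  case eval_Let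
  from eval_Let.prems show ?case by (auto elim!: eval_LetE dest!: eval_Let.IH(2,4))
next
  case eval_Call
  from eval_Call.prems show ?case by (auto elim!: eval_CallE dest!: eval_Call.IH(2,5))
next
  case evals_Nil then show ?case by (auto elim: evals_NilE)
next
  case evals_Cons
  from evals_Cons.prems show ?case by (auto elim!: evals_ConsE dest!: evals_Cons.IH(2,4))
qed

definition runs :: "program \<Rightarrow> sexp \<Rightarrow> sexp \<Rightarrow> nat \<Rightarrow> bool" where
  "runs p x y t \<longleftrightarrow> eval p [x] (ECall 0 [Var 0]) y t"

text \<open>Instances \<open>x \<in> I\<close> are given by encodings; \<open>ok x y\<close> says that \<open>y\<close> is a correct
  answer for \<open>x\<close>. Nothing is required of inputs that encode no instance.\<close>

definition poly_time_solvable ::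
    "'i set \<Rightarrow> ('i \<Rightarrow> sexp) \<Rightarrow> ('i \<Rightarrow> sexp \<Rightarrow> bool) \<Rightarrow> bool" where
  "poly_time_solvable I enc ok \<longleftrightarrow>
     (\<exists>(p :: program) (q :: nat poly). \<forall>x \<in> I. \<exists>y t.
        runs p (enc x) y t \<and> t \<le> poly q (size (enc x)) \<and> ok x y)"


section \<open>Encodings\<close>

text \<open>Numbers are unary; all numbers that occur are bounded by the number of vertices or
  by \<open>k\<close>. Graphs on \<open>{..<n}\<close> are given by their adjacency matrices.\<close>

fun enc_nat :: "nat \<Rightarrow> sexp" where
  "enc_nat 0 = Atom"
| "enc_nat (Suc n) = Pair Atom (enc_nat n)"

fun enc_bool :: "bool \<Rightarrow> sexp" where
  "enc_bool False = Atom"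
| "enc_bool True = Pair Atom Atom"

fun enc_list :: "('a \<Rightarrow> sexp) \<Rightarrow> 'a list \<Rightarrow> sexp" where
  "enc_list f [] = Atom"
| "enc_list f (x # xs) = Pair (f x) (enc_list f xs)"

fun enc_option :: "('a \<Rightarrow> sexp) \<Rightarrow> 'a option \<Rightarrow> sexp" where
  "enc_option f None = Atom"
| "enc_option f (Some x) = Pair Atom (f x)"

definition adj_matrix :: "nat pair_pre_digraph \<Rightarrow> bool list list" where
  "adj_matrix G = (let n = card (pverts G) in
     map (\<lambda>i. map (\<lambda>j. (i, j) \<in> parcs G) [0..<n]) [0..<n])"

definition enc_graph :: "nat pair_pre_digraph \<Rightarrow> sexp" where
  "enc_graph G = enc_list (enc_list enc_bool) (adj_matrix G)"

type_synonym decomposed_graph =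
  "nat pair_pre_digraph \<times> nat pair_pre_digraph \<times> (nat \<Rightarrow> nat)"

fun enc_instance :: "decomposed_graph \<Rightarrow> sexp" where
  "enc_instance (G, T, L) =
     Pair (enc_graph G)
       (Pair (enc_graph T) (enc_list enc_nat (map L [0..<card (pverts G)])))"

definition instances :: "nat \<Rightarrow> decomposed_graph set" where
  "instances w = {(G, T, L). pair_graph G \<and>
     (\<exists>n. pverts G = {..<n}) \<and> (\<exists>m. pverts T = {..<m}) \<and>
     branch_decomposition G T L \<and> mim_width G T L \<le> w}"

text \<open>A partition is output as the list that gives, for each vertex, the index of its part.\<close>

definition parts_of :: "nat list \<Rightarrow> nat \<Rightarrow> nat set" where
  "parts_of c i = {v. v < length c \<and> c ! v = i}"

fun correct_answer ::
    "objective \<Rightarrow> (nat pair_pre_digraph \<Rightarrow> (nat \<Rightarrow> nat set) \<Rightarrow> bool)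
      \<Rightarrow> decomposed_graph \<Rightarrow> sexp \<Rightarrow> bool" where
  "correct_answer R F (G, T, L) y \<longleftrightarrow>
     (y = enc_option (enc_list enc_nat) None \<and> (\<nexists>V. F G V)) \<or>
     (\<exists>c. y = enc_option (enc_list enc_nat) (Some c) \<and>
        length c = card (pverts G) \<and> optimal R (F G) (parts_of c))"

end

theory Submission
  imports Defs
begin

text \<open>A cut of mim-width at most 1 has nested neighbourhoods. Let a feasible partition split along
  such a cut into a part \<open>X\<close> on the side \<open>A\<close> and a part \<open>Y\<close> on the other side. Boundedly many
  vertices of \<open>Y\<close>, a partial colouring \<open>Z\<close>, represent \<open>Y\<close> in the constraints on \<open>A\<close>: of each
  class the \<open>d\<close> vertices with the largest neighbourhoods in \<open>A\<close>, where \<open>d\<close> is a number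
  beyond which the degree constraints are constant, and three vertices that determine the only clique
  of the class that can cross the cut. Dually a small \<open>W\<close> represents \<open>X\<close> in the degree constraints on
  the other side. Every \<open>X'\<close> on \<open>A\<close> that passes the tests with \<open>Z\<close> and \<open>W\<close> can replace \<open>X\<close>. Hence
  dynamic programming over the edges of the tree has to keep only one best partial colouring for
  each of the polynomially many pairs \<open>(Z, W)\<close>. Since the bipartite complement of an induced matching
  of size two is again one, complements of cluster graphs are handled in the same way.

  For the running time, the functions computable in polynomial time are shown to be closed under
  composition and under right folds with polynomially bounded intermediate results, and the
  algorithm is a term built from these.\<close>

section \<open>Polynomial bounds\<close>

text \<open>Connectivity is the constraint that is not visibly local. When \<open>X\<close> is
  tested, each class of the far side acts as a single vertex, because only its vertex with the
  largest neighbourhood in \<open>A\<close> matters. Conversely, far vertices attached to the old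
  \<open>X\<close> must stay attached to its replacement; the comparison with \<open>W\<close>
  guarantees this, since truncation at \<open>d \<ge> 1\<close> still separates degree 0 from
  positive degree.

  The budget per class is therefore \<open>d\<close> vertices for degrees, one for connectivity, and
  three each for clusters and for complements of clusters. Hence \<open>d + 7\<close>, and the tests
  are all partial colourings with at most \<open>k * (d + 7)\<close> coloured vertices, a polynomial
  number for fixed \<open>k\<close> and \<open>d\<close>.

  The tree is not rooted. The table has an entry for each directed tree edge, and all entries are
  recomputed simultaneously, once per tree vertex; an entry is complete as soon as the number of
  rounds reaches the number of tree vertices in its branch. Joining multiplies lengths, but each
  reduction returns at most one colouring per pair of tests, so the tables never outgrow a fixed
  polynomial.\<close>

lemma poly_nat_mono: "(x::nat) \<le> y \<Longrightarrow> poly q x \<le> poly q y"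
  by (induction q) (auto intro!: add_mono mult_mono)

text \<open>The type \<open>'e\<close> of arguments is arbitrary and \<open>s\<close> measures their
  size, so one notion serves for numbers, graphs and tuples. Polynomials over \<open>nat\<close> are
  monotone, which gives closure under composition.\<close>

definition poly_bounded :: "('e \<Rightarrow> nat) \<Rightarrow> ('e \<Rightarrow> nat) \<Rightarrow> bool" where
  "poly_bounded s f \<longleftrightarrow> (\<exists>q. \<forall>x. f x \<le> poly q (s x))"

lemma poly_bounded_const: "poly_bounded s (\<lambda>x. c)"
  unfolding poly_bounded_def by (rule exI[of _ "[:c:]"]) simp

lemma poly_bounded_self: "poly_bounded s s"
  unfolding poly_bounded_def by (rule exI[of _ "[:0, 1:]"]) simp

lemma poly_bounded_le: "poly_bounded s g \<Longrightarrow> (\<And>x. f x \<le> g x) \<Longrightarrow> poly_bounded s f"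
  unfolding poly_bounded_def by (meson order_trans)

lemma poly_bounded_add:
  "poly_bounded s f \<Longrightarrow> poly_bounded s g \<Longrightarrow> poly_bounded s (\<lambda>x. f x + g x)"
  unfolding poly_bounded_def
proof (elim exE)
  fix q r assume "\<forall>x. f x \<le> poly q (s x)" "\<forall>x. g x \<le> poly r (s x)"
  then show "\<exists>q. \<forall>x. f x + g x \<le> poly q (s x)"
    by (intro exI[of _ "q + r"]) (simp add: add_mono)
qed

lemma poly_bounded_mult:
  "poly_bounded s f \<Longrightarrow> poly_bounded s g \<Longrightarrow> poly_bounded s (\<lambda>x. f x * g x)"
  unfolding poly_bounded_def
proof (elim exE)
  fix q r assume "\<forall>x. f x \<le> poly q (s x)" "\<forall>x. g x \<le> poly r (s x)"
  then show "\<exists>q. \<forall>x. f x * g x \<le> poly q (s x)"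
    by (intro exI[of _ "q * r"]) (simp add: mult_mono)
qed

lemma poly_bounded_poly:
  "poly_bounded s f \<Longrightarrow> poly_bounded s (\<lambda>x. poly r (f x))"
  unfolding poly_bounded_def
proof (elim exE)
  fix q assume "\<forall>x. f x \<le> poly q (s x)"
  then show "\<exists>q. \<forall>x. poly r (f x) \<le> poly q (s x)"
    by (intro exI[of _ "pcompose r q"]) (simp add: poly_pcompose poly_nat_mono)
qed

lemma poly_bounded_compose:
  "poly_bounded r g \<Longrightarrow> poly_bounded s (\<lambda>x. r (h x)) \<Longrightarrow> poly_bounded s (\<lambda>x. g (h x))"
  unfolding poly_bounded_def[of r g]
  by (elim exE) (rule poly_bounded_le[OF poly_bounded_poly], auto)

lemmas poly_bounded_arith = poly_bounded_const poly_bounded_self poly_bounded_add poly_bounded_mult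

section \<open>Linking programs\<close>

text \<open>Functions are called by their position in the program. A program placed behind another
  one must therefore have its calls renumbered, while the front program stays valid as it
  is.\<close>

fun shift :: "nat \<Rightarrow> expr \<Rightarrow> expr" where
  "shift n (Var i) = Var i"
| "shift n ENil = ENil"
| "shift n (ECons a b) = ECons (shift n a) (shift n b)"
| "shift n (EFst a) = EFst (shift n a)"
| "shift n (ESnd a) = ESnd (shift n a)"
| "shift n (EIf a b c) = EIf (shift n a) (shift n b) (shift n c)"
| "shift n (ELet a b) = ELet (shift n a) (shift n b)"
| "shift n (ECall f as) = ECall (n + f) (map (shift n) as)"

lemmas eval_intros = eval_evals.intros[unfolded One_nat_def add_Suc_right add_0_right]

lemma eval_append:
  "eval p env e v t \<Longrightarrow> eval (p @ p') env e v t"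
  "evals p env es vs t \<Longrightarrow> evals (p @ p') env es vs t"
proof (induction rule: eval_evals.inducts)
  case (eval_Call env as us s f v t)
  then show ?case by (intro eval_evals.eval_Call) (auto simp: nth_append)
qed (auto intro: eval_intros)

lemma eval_shift:
  "eval p env e v t \<Longrightarrow> eval (p' @ map (shift (length p')) p) env (shift (length p') e) v t"
  "evals p env es vs t \<Longrightarrow> evals (p' @ map (shift (length p')) p) env (map (shift (length p')) es) vs t"
proof (induction rule: eval_evals.inducts)
  case (eval_Call env as us s f v t)
  then show ?case unfolding shift.simps
    by (intro eval_evals.eval_Call) (auto simp: nth_append)
qed (auto intro: eval_intros)

lemma evals_Vars:
  "(\<And>i. i \<in> set is \<Longrightarrow> i < length env) \<Longrightarrow>
    evals p env (map Var is) (map ((!) env) is) (length is)"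
proof (induction "is")
  case (Cons i "is")
  then have "evals p env (Var i # map Var is) (env ! i # map ((!) env) is) (1 + length is)"
    by (intro eval_evals.evals_Cons eval_evals.eval_Var) auto
  then show ?case by simp
qed (simp add: evals_Nil)

section \<open>Functions computable in polynomial time\<close>

text \<open>A context \<open>vs\<close> describes the variables of an expression as functions of an
  abstract argument \<open>x\<close>. Programs with several typed arguments thus need no tuple
  encoding, and size is summed over all variables.\<close>

definition env_size :: "('e \<Rightarrow> sexp) list \<Rightarrow> 'e \<Rightarrow> nat" where
  "env_size vs x = (\<Sum>v\<leftarrow>vs. size (v x))"

definition env :: "('e \<Rightarrow> sexp) list \<Rightarrow> 'e \<Rightarrow> sexp list" where
  "env vs x = map (\<lambda>v. v x) vs"

definition computes :: "program \<Rightarrow> ('e \<Rightarrow> sexp) list \<Rightarrow> expr \<Rightarrow> ('e \<Rightarrow> sexp) \<Rightarrow> bool" where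
  "computes p vs e F \<longleftrightarrow>
     (\<exists>T. poly_bounded (env_size vs) T \<and> (\<forall>x. \<exists>t \<le> T x. eval p (env vs x) e (F x) t))"

text \<open>Values are trees while evaluation shares subtrees, so the size of a value is not bounded
  by the number of steps and needs a bound of its own.\<close>

definition polyt :: "('e \<Rightarrow> sexp) list \<Rightarrow> ('e \<Rightarrow> sexp) \<Rightarrow> bool" where
  "polyt vs F \<longleftrightarrow> poly_bounded (env_size vs) (\<lambda>x. size (F x)) \<and> (\<exists>p e. computes p vs e F)"

lemma polyt_size: "polyt vs F \<Longrightarrow> poly_bounded (env_size vs) (\<lambda>x. size (F x))"
  by (simp add: polyt_def)

lemma computes_append: "computes p vs e F \<Longrightarrow> computes (p @ p') vs e F"
  unfolding computes_def by (meson eval_append(1))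

text \<open>Renumbering allows the program for \<open>F\<close> to be put behind any given
  \<open>p\<close>. The functions of \<open>p\<close> keep their positions, so expressions compiled
  earlier can be reused in the combined program.\<close>

lemma polyt_link:
  assumes "polyt vs F"
  obtains p' e where "computes (p @ p') vs e F"
  using assms unfolding polyt_def computes_def by (meson eval_shift(1))

lemma polyt_var: "v \<in> set vs \<Longrightarrow> polyt vs v"
proof -
  assume v: "v \<in> set vs"
  then obtain i where i: "i < length vs" "v = vs ! i" by (metis in_set_conv_nth)
  have "size (v x) \<le> env_size vs x" for x
    unfolding env_size_def using v by (intro member_le_sum_list) auto
  then have 1: "poly_bounded (env_size vs) (\<lambda>x. size (v x))"
    by (rule poly_bounded_le[OF poly_bounded_self])
  have "eval [] (env vs x) (Var i) (v x) 1" for x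
    using eval_Var[of i "env vs x" "[]"] i by (simp add: env_def)
  then have "computes [] vs (Var i) v"
    unfolding computes_def by (intro exI[of _ "\<lambda>_. 1"]) (auto intro: poly_bounded_const)
  with 1 show ?thesis unfolding polyt_def by blast
qed

lemma polyt_args:
  assumes "\<And>w. w \<in> set ws \<Longrightarrow> polyt vs (\<lambda>x. w (h x))"
  shows "poly_bounded (env_size vs) (\<lambda>x. env_size ws (h x)) \<and>
    (\<exists>p es T. poly_bounded (env_size vs) T \<and>
       (\<forall>x. \<exists>t \<le> T x. evals p (env vs x) es (env ws (h x)) t))"
  using assms
proof (induction ws)
  case Nil
  then show ?case
    by (auto simp: env_def env_size_def
        intro!: poly_bounded_const exI[of _ "[]"] exI[of _ "\<lambda>_. 0"] evals_Nil)
next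
  case (Cons w ws)
  then obtain p es T where
    s: "poly_bounded (env_size vs) (\<lambda>x. env_size ws (h x))"
    and T: "poly_bounded (env_size vs) T"
      "\<And>x. \<exists>t \<le> T x. evals p (env vs x) es (env ws (h x)) t" by auto
  have w: "polyt vs (\<lambda>x. w (h x))" using Cons.prems by simp
  obtain p' e where e: "computes (p @ p') vs e (\<lambda>x. w (h x))" using polyt_link[OF w] by blast
  then obtain T' where T': "poly_bounded (env_size vs) T'"
      "\<And>x. \<exists>t \<le> T' x. eval (p @ p') (env vs x) e (w (h x)) t"
    unfolding computes_def by blast
  have "\<exists>t \<le> T' x + T x. evals (p @ p') (env vs x) (e # es) (env (w # ws) (h x)) t" for x
  proof -
    obtain t1 where t1: "t1 \<le> T x" "evals p (env vs x) es (env ws (h x)) t1" using T by blast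
    obtain t2 where t2: "t2 \<le> T' x" "eval (p @ p') (env vs x) e (w (h x)) t2" using T' by blast
    from evals_Cons[OF t2(2) eval_append(2)[OF t1(2)]] t1 t2 show ?thesis
      by (intro exI[of _ "t2 + t1"]) (auto simp: env_def)
  qed
  moreover have "poly_bounded (env_size vs) (\<lambda>x. env_size (w # ws) (h x))"
    using poly_bounded_add[OF polyt_size[OF w] s]
    unfolding env_size_def[of "w # ws"] by (simp add: env_size_def[of ws])
  ultimately show ?case
    using poly_bounded_add[OF T'(1) T(1)] by blast
qed

text \<open>The body \<open>e\<close> becomes a new function at the end of the linked program and is
  called on the computed arguments. The map \<open>h\<close> turns an outer argument into an inner
  one; changes of context such as weakening are special cases.\<close>

lemma polyt_comp:
  assumes F: "polyt ws F" and h: "list_all (\<lambda>w. polyt vs (\<lambda>x. w (h x))) ws"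
  shows "polyt vs (\<lambda>x. F (h x))"
proof -
  from polyt_args[of ws vs h] h[unfolded list_all_iff] obtain p es T where
    s: "poly_bounded (env_size vs) (\<lambda>x. env_size ws (h x))"
    and T: "poly_bounded (env_size vs) T"
      "\<And>x. \<exists>t \<le> T x. evals p (env vs x) es (env ws (h x)) t" by blast
  obtain p' e where "computes (p @ p') ws e F" using polyt_link[OF F] by blast
  then obtain T' where T': "poly_bounded (env_size ws) T'"
      "\<And>x. \<exists>t \<le> T' x. eval (p @ p') (env ws x) e (F x) t"
    unfolding computes_def by blast
  let ?P = "(p @ p') @ [e]" and ?f = "length (p @ p')"
  have "\<exists>t \<le> T x + T' (h x) + 1. eval ?P (env vs x) (ECall ?f es) (F (h x)) t" for x
  proof -
    obtain t1 where t1: "t1 \<le> T x" "evals p (env vs x) es (env ws (h x)) t1" using T by blast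
    obtain t2 where t2: "t2 \<le> T' (h x)" "eval (p @ p') (env ws (h x)) e (F (h x)) t2"
      using T' by blast
    have "eval ?P (env vs x) (ECall ?f es) (F (h x)) (t1 + t2 + 1)"
      by (rule eval_Call[where us = "env ws (h x)"])
        (use eval_append(2)[OF t1(2), of "p' @ [e]"] eval_append(1)[OF t2(2), of "[e]"] in auto)
    then show ?thesis using t1 t2 by (meson add_le_mono order_refl)
  qed
  moreover have "poly_bounded (env_size vs) (\<lambda>x. T x + T' (h x) + 1)"
    by (intro poly_bounded_arith T poly_bounded_compose[OF T'(1) s])
  ultimately have "computes ?P vs (ECall ?f es) (\<lambda>x. F (h x))"
    unfolding computes_def by blast
  moreover have "poly_bounded (env_size vs) (\<lambda>x. size (F (h x)))"
    by (rule poly_bounded_compose[OF polyt_size[OF F] s])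
  ultimately show ?thesis unfolding polyt_def by blast
qed

section \<open>Basic operations of the language\<close>

lemma polyt_single:
  assumes "\<And>x. eval [] (env vs x) e (F x) c" "poly_bounded (env_size vs) (\<lambda>x. size (F x))"
  shows "polyt vs F"
  unfolding polyt_def computes_def using assms
  by (intro conjI exI[of _ "[]"] exI[of _ e] exI[of _ "\<lambda>_. c"]) (auto intro: poly_bounded_const)

lemma polyt_Atom: "polyt vs (\<lambda>x. Atom)"
  by (rule polyt_single[OF eval_Nil]) (rule poly_bounded_const)

text \<open>The operation is verified once, on pairs in the context \<open>[fst, snd]\<close>, and
  then composed with the map \<open>x\<close> to \<open>(F x, G x)\<close>. The other basic
  operations follow the same pattern.\<close>

lemma polyt_Pair:
  assumes "polyt vs F" "polyt vs G"
  shows "polyt vs (\<lambda>x. Pair (F x) (G x))"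
proof -
  have "polyt [fst, snd] (\<lambda>y. Pair (fst y) (snd y))"
  proof (rule polyt_single)
    show "eval [] (env [fst, snd] y) (ECons (Var 0) (Var 1)) (Pair (fst y) (snd y)) (1 + 1 + 1)"
      for y :: "sexp \<times> sexp"
      using eval_Var[of 0 "env [fst, snd] y"] eval_Var[of 1 "env [fst, snd] y"]
      by (intro eval_Cons) (auto simp: env_def)
    show "poly_bounded (env_size [fst, snd]) (\<lambda>y. size (Pair (fst y) (snd y)))"
      by (rule poly_bounded_le[OF poly_bounded_add[OF poly_bounded_self poly_bounded_const[of _ 1]]])
        (simp add: env_size_def)
  qed
  from polyt_comp[OF this, of vs "\<lambda>x. (F x, G x)"] assms show ?thesis by simp
qed

lemma size_sfst: "size (sfst a) \<le> size a"
  and size_ssnd: "size (ssnd a) \<le> size a"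
  by (cases a; simp)+

lemma polyt_sfst: "polyt vs F \<Longrightarrow> polyt vs (\<lambda>x. sfst (F x))"
proof -
  assume F: "polyt vs F"
  have "polyt [id] sfst"
  proof (rule polyt_single)
    show "eval [] (env [id] y) (EFst (Var 0)) (sfst y) (1 + 1)" for y
      using eval_Var[of 0 "env [id] y"] by (intro eval_Fst) (auto simp: env_def)
    show "poly_bounded (env_size [id]) (\<lambda>y. size (sfst y))"
      by (rule poly_bounded_le[OF poly_bounded_self]) (simp add: env_size_def size_sfst)
  qed
  from polyt_comp[OF this, of vs F] F show ?thesis by simp
qed

lemma polyt_ssnd: "polyt vs F \<Longrightarrow> polyt vs (\<lambda>x. ssnd (F x))"
proof -
  assume F: "polyt vs F"
  have "polyt [id] ssnd"
  proof (rule polyt_single)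
    show "eval [] (env [id] y) (ESnd (Var 0)) (ssnd y) (1 + 1)" for y
      using eval_Var[of 0 "env [id] y"] by (intro eval_Snd) (auto simp: env_def)
    show "poly_bounded (env_size [id]) (\<lambda>y. size (ssnd y))"
      by (rule poly_bounded_le[OF poly_bounded_self]) (simp add: env_size_def size_ssnd)
  qed
  from polyt_comp[OF this, of vs F] F show ?thesis by simp
qed

text \<open>Both branches are evaluated, which is harmless because all functions are total.\<close>

lemma polyt_if_Atom:
  assumes "polyt vs C" "polyt vs F" "polyt vs G"
  shows "polyt vs (\<lambda>x. if C x = Atom then F x else G x)"
proof -
  let ?vs = "[fst, fst \<circ> snd, snd \<circ> snd]"
  let ?F = "\<lambda>y. if fst y = Atom then fst (snd y) else snd (snd y)"
  have "polyt ?vs ?F"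
  proof (rule polyt_single)
    fix y :: "sexp \<times> sexp \<times> sexp"
    obtain a b c where y: "y = (a, b, c)" by (cases y)
    show "eval [] (env ?vs y) (EIf (Var 0) (Var 2) (Var 1)) (?F y) (1 + 1 + 1)"
      using eval_Var[of 0 "env ?vs y"] eval_Var[of 1 "env ?vs y"] eval_Var[of 2 "env ?vs y"]
      by (cases "a = Atom") (intro eval_If_then eval_If_else; auto simp: env_def y eval_If_then eval_If_else)+
  next
    show "poly_bounded (env_size ?vs) (\<lambda>y. size (?F y))"
      by (rule poly_bounded_le[OF poly_bounded_self]) (simp add: env_size_def)
  qed
  from polyt_comp[OF this, of vs "\<lambda>x. (C x, F x, G x)"] assms show ?thesis by (simp cong: if_cong)
qed

lemma polyt_const: "polyt vs (\<lambda>x. c)"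
  by (induction c) (auto intro: polyt_Atom polyt_Pair)

text \<open>The argument grows to a pair whose second component is the new variable. In the list of
  variables the new one comes first, matching the convention that \<open>ELet\<close> binds position
  0.\<close>

abbreviation "add_var w vs \<equiv> (\<lambda>y. w (snd y)) # map (\<lambda>v y. v (fst y)) vs"

text \<open>The recursion scheme from which all later list functions and iterations are derived. The
  size bound is demanded only for folds over suffixes of the actual list \<open>L x\<close>: these
  are exactly the accumulators that occur, so invariants of the concrete computation may be used to
  prove it.\<close>

lemma polyt_foldr:
  assumes L: "polyt vs (\<lambda>x. enc_list ea (L x))" and Z: "polyt vs (\<lambda>x. ec (Z x))"
    and B: "polyt (add_var ec (add_var ea vs)) (\<lambda>y. ec (B (fst (fst y)) (snd (fst y)) (snd y)))"
    and S: "poly_bounded (env_size vs) S"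
      "\<And>x l' l. L x = l' @ l \<Longrightarrow> size (ec (foldr (B x) l (Z x))) \<le> S x"
  shows "polyt vs (\<lambda>x. ec (foldr (B x) (L x) (Z x)))"
proof -
  let ?ws = "add_var ec (add_var ea vs)"
  let ?m = "length vs"
  from L obtain p eL where eL: "computes p vs eL (\<lambda>x. enc_list ea (L x))"
    by (auto simp: polyt_def)
  obtain p' eZ where eZ: "computes (p @ p') vs eZ (\<lambda>x. ec (Z x))" using polyt_link[OF Z] by blast
  obtain p'' eB where eB: "computes ((p @ p') @ p'') ?ws eB
      (\<lambda>y. ec (B (fst (fst y)) (snd (fst y)) (snd y)))"
    using polyt_link[OF B] by blast
  define N where "N = length (p @ p' @ p'')"
  \<comment> \<open>Position 0 holds the list, the context follows. After the two bindings, position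
    0 is the head, 1 the result for the tail, 2 the list, and the context starts at 3; the body
    expects the result, then the head, then the context.\<close>
  define rc where "rc = EIf (Var 0)
      (ELet (ECall (N + 2) (ESnd (Var 0) # map Var [1..<Suc ?m]))
        (ELet (EFst (Var 1)) (ECall (N + 1) (map Var (1 # 0 # [3..<3 + ?m])))))
      (ECall N (map Var [1..<Suc ?m]))"
  define P where "P = (p @ p' @ p'') @ [eZ, eB, rc]"
  have PN: "P ! N = eZ" "P ! (N + 1) = eB" "P ! (N + 2) = rc" "length P = N + 3"
    unfolding P_def N_def by (auto simp: nth_append)
  obtain TL where TL: "poly_bounded (env_size vs) TL"
    "\<And>x. \<exists>t \<le> TL x. eval P (env vs x) eL (enc_list ea (L x)) t"
    using computes_append[OF eL, of "p' @ p'' @ [eZ, eB, rc]"]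
    unfolding computes_def P_def by auto
  obtain TZ where TZ: "poly_bounded (env_size vs) TZ"
    "\<And>x. \<exists>t \<le> TZ x. eval P (env vs x) eZ (ec (Z x)) t"
    using computes_append[OF eZ, of "p'' @ [eZ, eB, rc]"]
    unfolding computes_def P_def by auto
  obtain TB where TB: "poly_bounded (env_size ?ws) TB"
    "\<And>y. \<exists>t \<le> TB y. eval P (env ?ws y) eB (ec (B (fst (fst y)) (snd (fst y)) (snd y))) t"
    using computes_append[OF eB, of "[eZ, eB, rc]"]
    unfolding computes_def P_def by auto
  from TB(1) obtain qB where qB: "\<And>y. TB y \<le> poly qB (env_size ?ws y)"
    unfolding poly_bounded_def by blast
  \<comment> \<open>\<open>M x\<close> bounds one evaluation of the body, whose inputs are an
    accumulator, a list element and the context. \<open>K x\<close> bounds a whole round;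
    \<open>3 * ?m + 20\<close> generously pays for passing the context and for the constant
    overhead.\<close>
  define M where "M x = poly qB (S x + size (enc_list ea (L x)) + env_size vs x)" for x
  define K where "K x = M x + TZ x + 3 * ?m + 20" for x
  have ws_env: "env ?ws ((x, a), c) = ec c # ea a # env vs x" for x a c
    by (simp add: env_def o_def)
  have ws_size: "env_size ?ws ((x, a), c) = size (ec c) + size (ea a) + env_size vs x" for x a c
    by (simp add: env_size_def o_def)
  have size_elem: "size (enc_list ea (a # l)) \<le> size (enc_list ea (l' @ a # l))" for a l l'
    by (induction l') auto
  have rec: "\<exists>t \<le> (length l + 1) * K x. eval P (enc_list ea l # env vs x) rc (ec (foldr (B x) l (Z x))) t"
    if "L x = l' @ l" for x l' l
    using that
  proof (induction l arbitrary: l')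
    case Nil
    let ?env = "Atom # env vs x"
    have m: "length (env vs x) = ?m" by (simp add: env_def)
    obtain t where t: "t \<le> TZ x" "eval P (env vs x) eZ (ec (Z x)) t" using TZ by blast
    have vars: "evals P ?env (map Var [1..<Suc ?m]) (env vs x) ?m"
    proof -
      have "map ((!) ?env) [1..<Suc ?m] = env vs x"
        using m by (intro nth_equalityI) (auto simp del: upt_Suc)
      moreover have "evals P ?env (map Var [1..<Suc ?m]) (map ((!) ?env) [1..<Suc ?m]) (length [1..<Suc ?m])"
        using m by (intro evals_Vars) (auto simp del: upt_Suc)
      ultimately show ?thesis by (simp del: upt_Suc)
    qed
    have "eval P ?env (Var 0) Atom 1" using eval_Var[of 0 ?env P] by simp
    then have "eval P ?env rc (ec (Z x)) (1 + (?m + t + 1) + 1)"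
      unfolding rc_def
      by (intro eval_If_else eval_Call[OF vars]) (use t PN in auto)
    moreover have "1 + (?m + t + 1) + 1 \<le> (length [] + 1) * K x" using t by (simp add: K_def)
    ultimately show ?case by (metis enc_list.simps(1) foldr.simps(1) id_apply)
  next
    case (Cons a l)
    let ?e = "Pair (ea a) (enc_list ea l)" and ?env = "Pair (ea a) (enc_list ea l) # env vs x"
    let ?r = "foldr (B x) l (Z x)"
    have m: "length (env vs x) = ?m" by (simp add: env_def)
    from Cons.IH[of "l' @ [a]"] Cons.prems obtain t1 where
      t1: "t1 \<le> (length l + 1) * K x" "eval P (enc_list ea l # env vs x) rc (ec ?r) t1" by auto
    obtain t2 where t2: "t2 \<le> TB ((x, a), ?r)"
      "eval P (env ?ws ((x, a), ?r)) eB (ec (B x a ?r)) t2"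
      using TB(2)[of "((x, a), ?r)"] by auto
    have sz: "size (ec ?r) \<le> S x" using S(2)[of x "l' @ [a]" l] Cons.prems by simp
    have "size (ea a) \<le> size (enc_list ea (L x))"
      using size_elem[of a l l'] Cons.prems by simp
    with sz have "env_size ?ws ((x, a), ?r) \<le> S x + size (enc_list ea (L x)) + env_size vs x"
      unfolding ws_size by simp
    then have "TB ((x, a), ?r) \<le> M x"
      unfolding M_def by (intro order_trans[OF qB] poly_nat_mono)
    with t2 have t2M: "t2 \<le> M x" by simp
    have vars: "evals P ?env (map Var [1..<Suc ?m]) (env vs x) ?m"
    proof -
      have "map ((!) ?env) [1..<Suc ?m] = env vs x"
        using m by (intro nth_equalityI) (auto simp del: upt_Suc)
      moreover have "evals P ?env (map Var [1..<Suc ?m]) (map ((!) ?env) [1..<Suc ?m]) (length [1..<Suc ?m])"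
        using m by (intro evals_Vars) (auto simp del: upt_Suc)
      ultimately show ?thesis by (simp del: upt_Suc)
    qed
    have v0: "eval P ?env (Var 0) ?e 1" using eval_Var[of 0 ?env P] by simp
    have s0: "eval P ?env (ESnd (Var 0)) (enc_list ea l) (1 + 1)" using eval_Snd[OF v0] by simp
    have c1: "eval P ?env (ECall (N + 2) (ESnd (Var 0) # map Var [1..<Suc ?m])) (ec ?r) ((1 + 1 + ?m) + t1 + 1)"
      by (rule eval_Call[OF evals_Cons[OF s0 vars]]) (use PN t1 in auto)
    let ?env2 = "ec ?r # ?env" and ?env3 = "ea a # ec ?r # ?env"
    have f1: "eval P ?env2 (EFst (Var 1)) (ea a) (1 + 1)"
      using eval_Fst[OF eval_Var[of 1 ?env2 P]] by simp
    have vars3: "evals P ?env3 (map Var (1 # 0 # [3..<3 + ?m])) (ec ?r # ea a # env vs x) (?m + 2)"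
    proof -
      have "map ((!) ?env3) [3..<3 + ?m] = env vs x"
        using m by (intro nth_equalityI) (auto simp: nth_Cons split: nat.splits)
      then have "map ((!) ?env3) (1 # 0 # [3..<3 + ?m]) = ec ?r # ea a # env vs x"
        by simp
      moreover have "evals P ?env3 (map Var (1 # 0 # [3..<3 + ?m]))
          (map ((!) ?env3) (1 # 0 # [3..<3 + ?m])) (length (1 # 0 # [3..<3 + ?m]))"
        by (rule evals_Vars) (use m in auto)
      ultimately show ?thesis by simp
    qed
    have c2: "eval P ?env3 (ECall (N + 1) (map Var (1 # 0 # [3..<3 + ?m]))) (ec (B x a ?r)) ((?m + 2) + t2 + 1)"
      by (rule eval_Call[OF vars3]) (use PN t2(2)[unfolded ws_env] in auto)
    have "eval P ?env rc (ec (B x a ?r))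
        (1 + (((1 + 1 + ?m) + t1 + 1) + ((1 + 1) + ((?m + 2) + t2 + 1) + 1) + 1) + 1)"
      unfolding rc_def by (rule eval_If_then[OF v0]) (use eval_Let[OF c1 eval_Let[OF f1 c2]] in auto)
    moreover have "1 + (((1 + 1 + ?m) + t1 + 1) + ((1 + 1) + ((?m + 2) + t2 + 1) + 1) + 1) + 1
        \<le> (length (a # l) + 1) * K x"
      using t1 t2M by (simp add: K_def)
    ultimately show ?case by (metis enc_list.simps(2) foldr.simps(2) o_apply)
  qed
  have len: "length l \<le> size (enc_list ea l)" for l by (induction l) auto
  have "\<exists>t \<le> (TL x + ?m) + ((size (enc_list ea (L x)) + 1) * K x) + 1.
      eval P (env vs x) (ECall (N + 2) (eL # map Var [0..<?m])) (ec (foldr (B x) (L x) (Z x))) t" for x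
  proof -
    obtain t1 where t1: "t1 \<le> TL x" "eval P (env vs x) eL (enc_list ea (L x)) t1" using TL by blast
    obtain t2 where t2: "t2 \<le> (length (L x) + 1) * K x"
      "eval P (enc_list ea (L x) # env vs x) rc (ec (foldr (B x) (L x) (Z x))) t2"
      using rec[of x "[]" "L x"] by auto
    have m: "length (env vs x) = ?m" by (simp add: env_def)
    have "evals P (env vs x) (map Var [0..<?m]) (env vs x) ?m"
      using evals_Vars[of "[0..<length (env vs x)]" "env vs x" P] unfolding map_nth
      by (simp add: m)
    from evals_Cons[OF t1(2) this]
    have "eval P (env vs x) (ECall (N + 2) (eL # map Var [0..<?m])) (ec (foldr (B x) (L x) (Z x)))
        ((t1 + ?m) + t2 + 1)"
      by (rule eval_Call) (use PN t2 in auto)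
    moreover have "(length (L x) + 1) * K x \<le> (size (enc_list ea (L x)) + 1) * K x"
      using len by (intro mult_right_mono) auto
    ultimately show ?thesis using t1 t2 by (meson add_le_mono order_refl order_trans)
  qed
  moreover have "poly_bounded (env_size vs)
      (\<lambda>x. (TL x + ?m) + ((size (enc_list ea (L x)) + 1) * K x) + 1)"
    unfolding K_def M_def
    by (intro poly_bounded_add poly_bounded_mult poly_bounded_poly poly_bounded_const
        poly_bounded_self TL TZ S polyt_size[OF L])
  ultimately have "computes P vs (ECall (N + 2) (eL # map Var [0..<?m])) (\<lambda>x. ec (foldr (B x) (L x) (Z x)))"
    unfolding computes_def by blast
  moreover have "poly_bounded (env_size vs) (\<lambda>x. size (ec (foldr (B x) (L x) (Z x))))"
    by (rule poly_bounded_le[OF S(1)]) (rule S(2)[of _ "[]"], simp)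
  ultimately show ?thesis unfolding polyt_def by blast
qed


lemma polyt_weaken:
  assumes "polyt vs F"
  shows "polyt (add_var w vs) (\<lambda>y. F (fst y))"
  using assms by (rule polyt_comp) (auto simp: list_all_iff intro!: polyt_var)

lemma enc_bool_Atom: "enc_bool b = Atom \<longleftrightarrow> \<not> b"
  by (cases b) auto

lemma enc_nat_Atom: "enc_nat n = Atom \<longleftrightarrow> n = 0"
  by (cases n) auto

lemma enc_list_Atom: "enc_list ea l = Atom \<longleftrightarrow> l = []"
  by (cases l) auto

lemma size_enc_nat [simp]: "size (enc_nat n) = n"
  by (induction n) auto

lemma size_enc_append [simp]:
  "size (enc_list ea (l @ l')) = size (enc_list ea l) + size (enc_list ea l')"
  by (induction l) auto

lemma size_enc_elem: "a \<in> set l \<Longrightarrow> size (ea a) < size (enc_list ea l)"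
  by (induction l) auto

lemma length_le_size_enc: "length l \<le> size (enc_list ea l)"
  by (induction l) auto

lemma size_enc_list_le:
  "(\<And>a. a \<in> set l \<Longrightarrow> size (ea a) \<le> b) \<Longrightarrow> size (enc_list ea l) \<le> length l * (b + 1)"
proof (induction l)
  case (Cons a l)
  then have "size (ea a) \<le> b" "size (enc_list ea l) \<le> length l * (b + 1)" by auto
  then show ?case by simp
qed simp

lemma size_enc_filter: "size (enc_list ea (filter P l)) \<le> size (enc_list ea l)"
  by (induction l) auto

lemma polyt_if:
  assumes "polyt vs (\<lambda>x. enc_bool (C x))" "polyt vs (\<lambda>x. e (F x))" "polyt vs (\<lambda>x. e (G x))"
  shows "polyt vs (\<lambda>x. e (if C x then F x else G x))"
proof -
  have "(\<lambda>x. e (if C x then F x else G x)) =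
      (\<lambda>x. if enc_bool (C x) = Atom then e (G x) else e (F x))"
    by (auto simp: enc_bool_Atom fun_eq_iff)
  with polyt_if_Atom[OF assms(1,3,2)] show ?thesis by simp
qed

lemma polyt_not: "polyt vs (\<lambda>x. enc_bool (P x)) \<Longrightarrow> polyt vs (\<lambda>x. enc_bool (\<not> P x))"
  using polyt_if[of vs P enc_bool "\<lambda>_. False" "\<lambda>_. True"]
  by (simp add: polyt_const if_bool_eq_conj)

lemma polyt_conj:
  "polyt vs (\<lambda>x. enc_bool (P x)) \<Longrightarrow> polyt vs (\<lambda>x. enc_bool (Q x)) \<Longrightarrow>
    polyt vs (\<lambda>x. enc_bool (P x \<and> Q x))"
  using polyt_if[of vs P enc_bool Q "\<lambda>_. False"] by (simp add: polyt_const if_bool_eq_conj conj_commute cong: conj_cong)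

lemma polyt_disj:
  "polyt vs (\<lambda>x. enc_bool (P x)) \<Longrightarrow> polyt vs (\<lambda>x. enc_bool (Q x)) \<Longrightarrow>
    polyt vs (\<lambda>x. enc_bool (P x \<or> Q x))"
  using polyt_not[OF polyt_conj[OF polyt_not[of vs P] polyt_not[of vs Q]]] by simp

lemma polyt_imp:
  "polyt vs (\<lambda>x. enc_bool (P x)) \<Longrightarrow> polyt vs (\<lambda>x. enc_bool (Q x)) \<Longrightarrow>
    polyt vs (\<lambda>x. enc_bool (P x \<longrightarrow> Q x))"
  unfolding imp_conv_disj by (rule polyt_disj[OF polyt_not])

lemma polyt_finite_Ball:
  assumes "finite S" "\<And>c. c \<in> S \<Longrightarrow> polyt vs (\<lambda>x. enc_bool (P x c))"
  shows "polyt vs (\<lambda>x. enc_bool (\<forall>c\<in>S. P x c))"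
  using assms by (induction S) (auto intro: polyt_conj polyt_const)

lemma polyt_finite_Bex:
  assumes "finite S" "\<And>c. c \<in> S \<Longrightarrow> polyt vs (\<lambda>x. enc_bool (P x c))"
  shows "polyt vs (\<lambda>x. enc_bool (\<exists>c\<in>S. P x c))"
  using assms by (induction S) (auto intro: polyt_disj polyt_const)

lemma polyt_Cons:
  "polyt vs (\<lambda>x. ea (A x)) \<Longrightarrow> polyt vs (\<lambda>x. enc_list ea (L x)) \<Longrightarrow>
    polyt vs (\<lambda>x. enc_list ea (A x # L x))"
  by (simp add: polyt_Pair)

lemma polyt_tl: "polyt vs (\<lambda>x. enc_list ea (L x)) \<Longrightarrow> polyt vs (\<lambda>x. enc_list ea (tl (L x)))"
proof -
  assume "polyt vs (\<lambda>x. enc_list ea (L x))"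
  moreover have "enc_list ea (tl l) = ssnd (enc_list ea l)" for l by (cases l) auto
  ultimately show ?thesis using polyt_ssnd by simp
qed

lemma polyt_null: "polyt vs (\<lambda>x. enc_list ea (L x)) \<Longrightarrow> polyt vs (\<lambda>x. enc_bool (L x = []))"
  using polyt_if_Atom[of vs "\<lambda>x. enc_list ea (L x)" "\<lambda>x. enc_bool True" "\<lambda>x. enc_bool False"]
  by (simp add: polyt_const enc_list_Atom if_distrib[of enc_bool, symmetric] if_bool_eq_conj del: enc_bool.simps cong: if_cong)

text \<open>Heads and, later, indexing carry a default value, because a function shown to be
  computable must have its prescribed value on every argument, also on lists that are too
  short.\<close>

definition hdd :: "'a \<Rightarrow> 'a list \<Rightarrow> 'a" where
  "hdd d l = (if l = [] then d else hd l)"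

lemma polyt_hdd: "polyt vs (\<lambda>x. enc_list ea (L x)) \<Longrightarrow> polyt vs (\<lambda>x. ea (hdd d (L x)))"
proof -
  assume L: "polyt vs (\<lambda>x. enc_list ea (L x))"
  have "ea (hdd d l) = (if enc_list ea l = Atom then ea d else sfst (enc_list ea l))" for l
    by (cases l) (auto simp: hdd_def)
  with polyt_if_Atom[OF L polyt_const polyt_sfst[OF L]] show ?thesis by simp
qed

lemma polyt_append:
  assumes "polyt vs (\<lambda>x. enc_list ea (L x))" "polyt vs (\<lambda>x. enc_list ea (M x))"
  shows "polyt vs (\<lambda>x. enc_list ea (L x @ M x))"
proof -
  have eq: "foldr (\<lambda>a l. a # l) l m = l @ m" for l m :: "'b list" by (induction l) auto
  have "polyt vs (\<lambda>x. enc_list ea (foldr (\<lambda>a l. a # l) (L x) (M x)))"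
  proof (rule polyt_foldr[where ea = ea and ec = "enc_list ea" and B = "\<lambda>x a l. a # l", OF assms])
    show "poly_bounded (env_size vs) (\<lambda>x. size (enc_list ea (L x)) + size (enc_list ea (M x)))"
      by (intro poly_bounded_add polyt_size assms)
    show "L x = l' @ l \<Longrightarrow> size (enc_list ea (foldr (\<lambda>a l. a # l) l (M x)))
        \<le> size (enc_list ea (L x)) + size (enc_list ea (M x))" for x l l'
      by (simp add: eq)
  qed (intro polyt_Cons polyt_var; simp)
  then show ?thesis by (simp add: eq)
qed

lemma polyt_map:
  assumes L: "polyt vs (\<lambda>x. enc_list ea (L x))"
    and F: "polyt (add_var ea vs) (\<lambda>y. eb (F (fst y) (snd y)))"
  shows "polyt vs (\<lambda>x. enc_list eb (map (F x) (L x)))"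
proof -
  have eq: "map f l = foldr (\<lambda>a acc. f a # acc) l []" for f :: "'b \<Rightarrow> 'c" and l
    by (induction l) auto
  obtain q where q: "\<And>y. size (eb (F (fst y) (snd y))) \<le> poly q (env_size (add_var ea vs) y)"
    using polyt_size[OF F] unfolding poly_bounded_def by blast
  \<comment> \<open>The accumulators are images of suffixes. There are at most \<open>?s x\<close>
    of them, and each has size at most \<open>poly q\<close> of the sizes of list and context
    together.\<close>
  let ?s = "\<lambda>x. size (enc_list ea (L x))"
  let ?S = "\<lambda>x. ?s x * (poly q (?s x + env_size vs x) + 1)"
  have "polyt vs (\<lambda>x. enc_list eb (foldr (\<lambda>a acc. F x a # acc) (L x) []))"
  proof (rule polyt_foldr[where ea = ea and ec = "enc_list eb" and Z = "\<lambda>x. []"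
        and B = "\<lambda>x a acc. F x a # acc", OF L polyt_const])
    show "polyt (add_var (enc_list eb) (add_var ea vs))
        (\<lambda>y. enc_list eb (F (fst (fst y)) (snd (fst y)) # snd y))"
      by (intro polyt_Cons polyt_weaken F polyt_var) simp
    show "poly_bounded (env_size vs) ?S"
      by (intro poly_bounded_mult poly_bounded_add poly_bounded_poly poly_bounded_const
          poly_bounded_self polyt_size L)
    fix x l' l assume l: "L x = l' @ l"
    have "size (eb (F x a)) \<le> poly q (?s x + env_size vs x)" if "a \<in> set l" for a
    proof -
      have "size (ea a) \<le> ?s x" using that l by (intro less_imp_le size_enc_elem) auto
      then have "env_size (add_var ea vs) (x, a) \<le> ?s x + env_size vs x"
        by (simp add: env_size_def o_def)
      from order_trans[OF q poly_nat_mono[OF this]] show ?thesis by simp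
    qed
    then have "size (enc_list eb (map (F x) l)) \<le> length (map (F x) l) * (poly q (?s x + env_size vs x) + 1)"
      by (intro size_enc_list_le) auto
    also have "\<dots> \<le> ?S x"
      using length_le_size_enc[of "L x" ea] l by (intro mult_right_mono) auto
    finally show "size (enc_list eb (foldr (\<lambda>a acc. F x a # acc) l [])) \<le> ?S x"
      by (simp only: eq)
  qed
  then show ?thesis by (simp add: eq)
qed

lemma polyt_filter:
  assumes L: "polyt vs (\<lambda>x. enc_list ea (L x))"
    and P: "polyt (add_var ea vs) (\<lambda>y. enc_bool (P (fst y) (snd y)))"
  shows "polyt vs (\<lambda>x. enc_list ea (filter (P x) (L x)))"
proof -
  have eq: "filter f l = foldr (\<lambda>a acc. if f a then a # acc else acc) l []" for f :: "'b \<Rightarrow> bool" and l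
    by (induction l) auto
  have "polyt vs (\<lambda>x. enc_list ea (foldr (\<lambda>a acc. if P x a then a # acc else acc) (L x) []))"
  proof (rule polyt_foldr[where ea = ea and ec = "enc_list ea" and Z = "\<lambda>x. []"
        and B = "\<lambda>x a acc. if P x a then a # acc else acc", OF L polyt_const])
    show "polyt (add_var (enc_list ea) (add_var ea vs))
        (\<lambda>y. enc_list ea (if P (fst (fst y)) (snd (fst y)) then snd (fst y) # snd y else snd y))"
      by (rule polyt_if[where e = "enc_list ea"], rule polyt_weaken[OF P]; (intro polyt_Cons)?; rule polyt_var; simp)
    show "poly_bounded (env_size vs) (\<lambda>x. size (enc_list ea (L x)))" by (rule polyt_size[OF L])
    fix x l' l assume "L x = l' @ l"
    then show "size (enc_list ea (foldr (\<lambda>a acc. if P x a then a # acc else acc) l []))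
        \<le> size (enc_list ea (L x))"
      using size_enc_filter[of ea "P x" l] by (simp add: eq)
  qed
  then show ?thesis by (simp add: eq)
qed

lemma polyt_concat:
  assumes L: "polyt vs (\<lambda>x. enc_list (enc_list ea) (L x))"
  shows "polyt vs (\<lambda>x. enc_list ea (concat (L x)))"
proof -
  have size: "size (enc_list ea (concat l)) \<le> size (enc_list (enc_list ea) l)" for l
    by (induction l) auto
  have "polyt vs (\<lambda>x. enc_list ea (foldr (\<lambda>a acc. a @ acc) (L x) []))"
  proof (rule polyt_foldr[where ea = "enc_list ea" and ec = "enc_list ea" and Z = "\<lambda>x. []"
        and B = "\<lambda>x a acc. a @ acc", OF L polyt_const])
    show "polyt (add_var (enc_list ea) (add_var (enc_list ea) vs))
        (\<lambda>y. enc_list ea (snd (fst y) @ snd y))"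
      by (intro polyt_append polyt_var) auto
    show "poly_bounded (env_size vs) (\<lambda>x. size (enc_list (enc_list ea) (L x)))"
      by (rule polyt_size[OF L])
    fix x l' l assume "L x = l' @ l"
    then show "size (enc_list ea (foldr (\<lambda>a acc. a @ acc) l []))
        \<le> size (enc_list (enc_list ea) (L x))"
      using size[of l] by (simp flip: concat_conv_foldr)
  qed
  then show ?thesis by (simp add: concat_conv_foldr)
qed

lemma polyt_Ball:
  assumes L: "polyt vs (\<lambda>x. enc_list ea (L x))"
    and P: "polyt (add_var ea vs) (\<lambda>y. enc_bool (P (fst y) (snd y)))"
  shows "polyt vs (\<lambda>x. enc_bool (\<forall>a\<in>set (L x). P x a))"
proof -
  have "polyt vs (\<lambda>x. enc_bool (filter (\<lambda>a. \<not> P x a) (L x) = []))"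
    by (rule polyt_null[OF polyt_filter[where P = "\<lambda>x a. \<not> P x a", OF L polyt_not[OF P]]])
  then show ?thesis by (simp add: filter_empty_conv)
qed

lemma polyt_Bex:
  assumes L: "polyt vs (\<lambda>x. enc_list ea (L x))"
    and P: "polyt (add_var ea vs) (\<lambda>y. enc_bool (P (fst y) (snd y)))"
  shows "polyt vs (\<lambda>x. enc_bool (\<exists>a\<in>set (L x). P x a))"
  using polyt_not[OF polyt_Ball[where P = "\<lambda>x a. \<not> P x a", OF L polyt_not[OF P]]] by simp

section \<open>Arithmetic\<close>

lemma polyt_Suc: "polyt vs (\<lambda>x. enc_nat (N x)) \<Longrightarrow> polyt vs (\<lambda>x. enc_nat (Suc (N x)))"
  by (simp add: polyt_Pair polyt_const)

lemma polyt_length: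
  assumes L: "polyt vs (\<lambda>x. enc_list ea (L x))"
  shows "polyt vs (\<lambda>x. enc_nat (length (L x)))"
proof -
  have eq: "foldr (\<lambda>a. Suc) l 0 = length l" for l :: "'b list" by (induction l) auto
  have "polyt vs (\<lambda>x. enc_nat (foldr (\<lambda>a. Suc) (L x) 0))"
  proof (rule polyt_foldr[where ea = ea and ec = enc_nat and Z = "\<lambda>x. 0"
        and B = "\<lambda>x a. Suc", OF L polyt_const])
    show "polyt (add_var enc_nat (add_var ea vs)) (\<lambda>y. enc_nat (Suc (snd y)))"
      by (intro polyt_Suc polyt_var) simp
    show "poly_bounded (env_size vs) (\<lambda>x. size (enc_list ea (L x)))" by (rule polyt_size[OF L])
    fix x l' l assume "L x = l' @ l"
    then show "size (enc_nat (foldr (\<lambda>a. Suc) l 0)) \<le> size (enc_list ea (L x))"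
      using length_le_size_enc[of l ea] by (simp add: eq)
  qed
  then show ?thesis by (simp add: eq)
qed

text \<open>A unary number is the same tree as a list of that many atoms, so iteration is a fold
  over a list of units.\<close>

lemma polyt_funpow:
  assumes N: "polyt vs (\<lambda>x. enc_nat (N x))" and Z: "polyt vs (\<lambda>x. e (Z x))"
    and F: "polyt (add_var e vs) (\<lambda>y. e (F (fst y) (snd y)))"
    and S: "poly_bounded (env_size vs) S" "\<And>x i. i \<le> N x \<Longrightarrow> size (e ((F x ^^ i) (Z x))) \<le> S x"
  shows "polyt vs (\<lambda>x. e ((F x ^^ N x) (Z x)))"
proof -
  let ?u = "\<lambda>u :: unit. Atom"
  have enc: "enc_nat n = enc_list ?u (replicate n ())" for n by (induction n) auto
  have eq: "foldr (\<lambda>u. f) l z = (f ^^ length l) z" for f :: "'b \<Rightarrow> 'b" and l :: "unit list" and z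
    by (induction l) auto
  have "polyt vs (\<lambda>x. e (foldr (\<lambda>u. F x) (replicate (N x) ()) (Z x)))"
  proof (rule polyt_foldr[where ea = ?u and ec = e and Z = Z and B = "\<lambda>x u. F x", OF _ Z])
    show "polyt vs (\<lambda>x. enc_list ?u (replicate (N x) ()))" using N by (simp add: enc)
    show "polyt (add_var e (add_var ?u vs)) (\<lambda>y. e (F (fst (fst y)) (snd y)))"
    proof -
      have "list_all (\<lambda>w. polyt (add_var e (add_var ?u vs)) (\<lambda>y. w (fst (fst y), snd y))) (add_var e vs)"
        by (auto simp: list_all_iff intro!: polyt_var)
      from polyt_comp[OF F this] show ?thesis by simp
    qed
    show "poly_bounded (env_size vs) S" by fact
    fix x l' l assume "replicate (N x) () = l' @ l"
    then have "length l \<le> N x" by (metis le_add2 length_append length_replicate)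
    then show "size (e (foldr (\<lambda>u. F x) l (Z x))) \<le> S x" using S(2) by (simp add: eq)
  qed
  then show ?thesis by (simp add: eq)
qed

lemma polyt_diff:
  assumes "polyt vs (\<lambda>x. enc_nat (M x))" "polyt vs (\<lambda>x. enc_nat (N x))"
  shows "polyt vs (\<lambda>x. enc_nat (M x - N x))"
proof -
  have eq: "((\<lambda>m. m - 1) ^^ n) m = m - n" for m n :: nat by (induction n) auto
  have pred: "enc_nat (m - 1) = ssnd (enc_nat m)" for m by (cases m) auto
  have "polyt vs (\<lambda>x. enc_nat (((\<lambda>m. m - 1) ^^ N x) (M x)))"
  proof (rule polyt_funpow[where e = enc_nat and F = "\<lambda>x m. m - 1", OF assms(2,1)])
    show "polyt (add_var enc_nat vs) (\<lambda>y. enc_nat (snd y - 1))"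
      unfolding pred by (intro polyt_ssnd polyt_var) simp
    show "poly_bounded (env_size vs) M" using polyt_size[OF assms(1)] by simp
  qed (simp add: eq[simplified])
  then show ?thesis by (simp add: eq[simplified])
qed

lemma polyt_le:
  assumes "polyt vs (\<lambda>x. enc_nat (M x))" "polyt vs (\<lambda>x. enc_nat (N x))"
  shows "polyt vs (\<lambda>x. enc_bool (M x \<le> N x))"
  using polyt_if_Atom[OF polyt_diff[OF assms], of "\<lambda>x. enc_bool True" "\<lambda>x. enc_bool False"]
  by (simp add: polyt_const enc_nat_Atom if_distrib[of enc_bool, symmetric] if_bool_eq_conj del: enc_bool.simps cong: if_cong)

lemma polyt_less:
  assumes "polyt vs (\<lambda>x. enc_nat (M x))" "polyt vs (\<lambda>x. enc_nat (N x))"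
  shows "polyt vs (\<lambda>x. enc_bool (M x < N x))"
  using polyt_le[OF polyt_Suc[OF assms(1)] assms(2)] by (simp add: Suc_le_eq)

lemma polyt_eq:
  assumes "polyt vs (\<lambda>x. enc_nat (M x))" "polyt vs (\<lambda>x. enc_nat (N x))"
  shows "polyt vs (\<lambda>x. enc_bool (M x = N x))"
  unfolding order_eq_iff[of "M _"] by (intro polyt_conj polyt_le assms)

text \<open>The elements of the finite set among \<open>S\<close> and \<open>- S\<close> are
  hard-wired into the program as a disjunction of equality tests.\<close>

lemma polyt_member:
  assumes N: "polyt vs (\<lambda>x. enc_nat (N x))" and S: "finite S \<or> finite (- S)"
  shows "polyt vs (\<lambda>x. enc_bool (N x \<in> S))"
proof -
  have fin: "polyt vs (\<lambda>x. enc_bool (N x \<in> A))" if "finite A" for A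
  proof -
    have "polyt vs (\<lambda>x. enc_bool (\<exists>c\<in>A. N x = c))"
      by (intro polyt_finite_Bex that polyt_eq N polyt_const)
    then show ?thesis by simp
  qed
  from S show ?thesis
  proof
    assume "finite (- S)"
    from polyt_not[OF fin[OF this]] show ?thesis by simp
  qed (rule fin)
qed

lemma polyt_upt:
  assumes N: "polyt vs (\<lambda>x. enc_nat (N x))"
  shows "polyt vs (\<lambda>x. enc_list enc_nat [0..<N x])"
proof -
  let ?f = "\<lambda>l. 0 # map Suc l"
  have eq: "(?f ^^ n) [] = [0..<n]" for n
    by (induction n) (auto simp: map_Suc_upt upt_conv_Cons simp del: upt_Suc)
  have "polyt vs (\<lambda>x. enc_list enc_nat ((?f ^^ N x) []))"
  proof (rule polyt_funpow[where e = "enc_list enc_nat" and Z = "\<lambda>x. []" and F = "\<lambda>x. ?f", OF N polyt_const])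
    show "polyt (add_var (enc_list enc_nat) vs) (\<lambda>y. enc_list enc_nat (0 # map Suc (snd y)))"
      by (intro polyt_Cons polyt_const polyt_map polyt_Suc polyt_var) auto
    show "poly_bounded (env_size vs) (\<lambda>x. N x * (N x + 1))"
      using polyt_size[OF N] by (intro poly_bounded_mult poly_bounded_add poly_bounded_const) simp_all
    fix x i assume i: "i \<le> N x"
    have "size (enc_list enc_nat [0..<i]) \<le> length [0..<i] * (N x + 1)"
      using i by (intro size_enc_list_le) auto
    also have "\<dots> \<le> N x * (N x + 1)" using i by (intro mult_right_mono) auto
    finally show "size (enc_list enc_nat ((?f ^^ i) [])) \<le> N x * (N x + 1)" by (simp only: eq)
  qed
  then show ?thesis by (simp only: eq)
qed

lemma polyt_drop:
  assumes L: "polyt vs (\<lambda>x. enc_list ea (L x))" and N: "polyt vs (\<lambda>x. enc_nat (N x))"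
  shows "polyt vs (\<lambda>x. enc_list ea (drop (N x) (L x)))"
proof -
  have eq: "(tl ^^ n) l = drop n l" for n and l :: "'b list"
    by (induction n) (auto simp: drop_Suc tl_drop)
  have size: "size (enc_list ea (drop i l)) \<le> size (enc_list ea l)" for i l
    using size_enc_append[of ea "take i l" "drop i l"] by simp
  have "polyt vs (\<lambda>x. enc_list ea ((tl ^^ N x) (L x)))"
  proof (rule polyt_funpow[where e = "enc_list ea" and F = "\<lambda>x. tl", OF N L])
    show "polyt (add_var (enc_list ea) vs) (\<lambda>y. enc_list ea (tl (snd y)))"
      by (intro polyt_tl polyt_var) simp
    show "poly_bounded (env_size vs) (\<lambda>x. size (enc_list ea (L x)))" by (rule polyt_size[OF L])
  qed (simp add: eq size)
  then show ?thesis by (simp add: eq)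
qed

definition nthd :: "'a \<Rightarrow> 'a list \<Rightarrow> nat \<Rightarrow> 'a" where
  "nthd d l i = (if i < length l then l ! i else d)"

lemma polyt_nthd:
  assumes "polyt vs (\<lambda>x. enc_list ea (L x))" "polyt vs (\<lambda>x. enc_nat (N x))"
  shows "polyt vs (\<lambda>x. ea (nthd d (L x) (N x)))"
proof -
  have "nthd d l i = hdd d (drop i l)" for l i by (auto simp: nthd_def hdd_def hd_drop_conv_nth)
  then show ?thesis using polyt_hdd[OF polyt_drop[OF assms]] by simp
qed

text \<open>A run starts with function 0, so the expression is placed in front of its program, and
  both are shifted by one. The extra 2 in the bound pays for the argument and the initial
  call.\<close>

lemma polyt_runs:
  assumes "polyt [i] F"
  shows "\<exists>p q. \<forall>x. \<exists>t. runs p (i x) (F x) t \<and> t \<le> poly q (size (i x))"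
proof -
  obtain p e T where T: "poly_bounded (env_size [i]) T"
    and e: "\<And>x. \<exists>t \<le> T x. eval p (env [i] x) e (F x) t"
    using assms unfolding polyt_def computes_def by blast
  obtain q where q: "\<And>x. T x + 2 \<le> poly q (env_size [i] x)"
    using poly_bounded_add[OF T poly_bounded_const[of _ 2]] unfolding poly_bounded_def by blast
  let ?P = "[shift 1 e] @ map (shift 1) p"
  have "\<exists>t. runs ?P (i x) (F x) t \<and> t \<le> poly q (size (i x))" for x
  proof -
    obtain t where t: "t \<le> T x" "eval p (env [i] x) e (F x) t" using e by blast
    have "eval ?P [i x] (?P ! 0) (F x) t"
      using eval_shift(1)[OF t(2), of "[shift 1 e]"] by (simp add: env_def)
    moreover have "evals ?P [i x] [Var 0] [i x] 1"
      using evals_Vars[of "[0]" "[i x]" ?P] by simp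
    ultimately have "runs ?P (i x) (F x) (1 + t + 1)"
      unfolding runs_def by (intro eval_Call) auto
    moreover have "1 + t + 1 \<le> poly q (size (i x))"
      using t(1) q[of x] by (simp add: env_size_def)
    ultimately show ?thesis by blast
  qed
  then show ?thesis by blast
qed

section \<open>The algorithm\<close>

definition adj :: "bool list list \<Rightarrow> nat \<Rightarrow> nat \<Rightarrow> bool" where
  "adj g u v = nthd False (nthd [] g u) v"

text \<open>The flag switches to adjacency in the complement graph, so that cluster graphs and their
  complements share one test and one proof.\<close>

definition coadj :: "bool \<Rightarrow> bool list list \<Rightarrow> nat \<Rightarrow> nat \<Rightarrow> bool" where
  "coadj b g u v = (if b then adj g u v else u \<noteq> v \<and> \<not> adj g u v)"

text \<open>A partial colouring is a list of colours; 0 stands for a vertex that is not coloured.\<close>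

definition cls :: "bool list list \<Rightarrow> nat list \<Rightarrow> nat \<Rightarrow> nat list" where
  "cls g X i = filter (\<lambda>v. nthd 0 X v = i) [0..<length g]"

definition put :: "bool list list \<Rightarrow> nat list \<Rightarrow> nat \<Rightarrow> nat \<Rightarrow> nat list" where
  "put g X v i = map (\<lambda>u. if u = v then i else nthd 0 X u) [0..<length g]"

definition overlay :: "bool list list \<Rightarrow> nat list \<Rightarrow> nat list \<Rightarrow> nat list" where
  "overlay g X Z = map (\<lambda>v. if nthd 0 X v = 0 then nthd 0 Z v else nthd 0 X v) [0..<length g]"

definition deg :: "bool list list \<Rightarrow> nat list \<Rightarrow> nat \<Rightarrow> nat \<Rightarrow> nat" where
  "deg g Y v j = length (filter (adj g v) (cls g Y j))"

text \<open>Cluster graphs are the graphs without an induced path on three vertices. In this form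
  the property inspects triples only and is hereditary.\<close>

definition cluster_ok :: "bool \<Rightarrow> bool list list \<Rightarrow> nat list \<Rightarrow> nat \<Rightarrow> bool" where
  "cluster_ok b g Y i \<longleftrightarrow> (\<forall>u\<in>set (cls g Y i). \<forall>v\<in>set (cls g Y i). \<forall>w\<in>set (cls g Y i).
     coadj b g u v \<and> coadj b g v w \<and> u \<noteq> w \<longrightarrow> coadj b g u w)"

text \<open>When a partial colouring is tested, the uncoloured vertices stand for the other side of a
  cut, which is contracted: hence all pairs of them are linked.\<close>

definition link :: "bool list list \<Rightarrow> nat list \<Rightarrow> nat \<Rightarrow> nat \<Rightarrow> bool" where
  "link g X u v \<longleftrightarrow> adj g u v \<or> nthd 0 X u = 0 \<and> nthd 0 X v = 0"

definition grow :: "bool list list \<Rightarrow> nat list \<Rightarrow> nat list \<Rightarrow> nat \<Rightarrow> nat list \<Rightarrow> nat list" where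
  "grow g X Y i S = filter (\<lambda>v. \<exists>u\<in>set S. u = v \<or> link g X u v) (cls g Y i)"

text \<open>The number of rounds bounds the number of linked pairs, and a reachable vertex is
  reached in at most as many steps as there are pairs in the relation.\<close>

definition conn_ok :: "bool list list \<Rightarrow> nat list \<Rightarrow> nat list \<Rightarrow> nat \<Rightarrow> bool" where
  "conn_ok g X Y i \<longleftrightarrow> (\<forall>u\<in>set (cls g Y i). \<forall>v\<in>set (cls g Y i).
     \<exists>w\<in>set ((grow g X Y i ^^ (length g * length g)) [u]). w = v)"

text \<open>All ways to colour the graph vertex that sits at the tree vertex \<open>x\<close>; the
  list is empty if \<open>x\<close> carries no graph vertex.\<close>

definition starts_of :: "nat \<Rightarrow> bool list list \<Rightarrow> nat list \<Rightarrow> nat \<Rightarrow> nat list list" where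
  "starts_of k g l x = concat (map (\<lambda>v. map (put g [] v) [1..<Suc k])
     (filter (\<lambda>v. nthd 0 l v = x) [0..<length g]))"

definition joins :: "bool list list \<Rightarrow> nat list list \<Rightarrow> nat list list \<Rightarrow> nat list list" where
  "joins g S S' = concat (map (\<lambda>X. map (overlay g X) S') S)"

text \<open>The bound \<open>m\<close> on the number of coloured vertices is a constant of the
  algorithm, not an input: the recursion is unrolled when the program is built. The length is
  \<open>(1 + n * k) ^ m\<close> for \<open>n = length g\<close>, polynomial in \<open>n\<close> for
  fixed \<open>m\<close>.\<close>

primrec small :: "nat \<Rightarrow> bool list list \<Rightarrow> nat \<Rightarrow> nat list list" where
  "small k g 0 = [map (\<lambda>v. 0) [0..<length g]]"
| "small k g (Suc m) = small k g m @
     concat (map (\<lambda>X. concat (map (\<lambda>v. map (put g X v) [1..<Suc k]) [0..<length g])) (small k g m))"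

definition firsts :: "'a list \<Rightarrow> 'a list" where
  "firsts l = (if l = [] then [] else [hd l])"

definition entry :: "nat list list list list \<Rightarrow> nat \<Rightarrow> nat \<Rightarrow> nat list list" where
  "entry T x y = nthd [] (nthd [] T x) y"

text \<open>All parameters are constants that may be built into the program. \<open>CL\<close>,
  \<open>CO\<close> and \<open>C\<close> collect the parts that must induce cluster graphs,
  complements of cluster graphs, and connected graphs; by \<open>D_min\<close>, only degrees
  truncated at \<open>d\<close> matter.\<close>

locale partition_problem =
  fixes k :: nat and D :: "nat \<Rightarrow> nat \<Rightarrow> nat set" and CL CO C :: "nat set"
    and d :: nat and R :: objective
  assumes k: "k \<ge> 1" and d: "d \<ge> 1"
    and fin: "CL \<subseteq> {1..k}" "CO \<subseteq> {1..k}" "C \<subseteq> {1..k}"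
    and D: "\<And>i j. i \<in> {1..k} \<Longrightarrow> j \<in> {1..k} \<Longrightarrow> finite (D i j) \<or> finite (- D i j)"
    and D_min: "\<And>i j a b. i \<in> {1..k} \<Longrightarrow> j \<in> {1..k} \<Longrightarrow> min d a = min d b \<Longrightarrow> a \<in> D i j \<longleftrightarrow> b \<in> D i j"
begin

abbreviation "starts \<equiv> starts_of k"

definition deg_ok :: "bool list list \<Rightarrow> nat list \<Rightarrow> nat list \<Rightarrow> bool" where
  "deg_ok g X Y \<longleftrightarrow> (\<forall>v\<in>set [0..<length g]. \<forall>i\<in>{1..k}. nthd 0 X v = i \<longrightarrow>
     (\<forall>j\<in>{1..k}. deg g Y v j \<in> D i j))"

text \<open>\<open>X\<close> determines the near side and \<open>Y\<close> adds representatives of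
  the far side. Degrees are counted in \<open>Y\<close> but required only at vertices coloured by
  \<open>X\<close>, because the representatives do not have their true degrees. For a total
  colouring, \<open>phi g X X\<close> is the full set of constraints.\<close>

definition phi :: "bool list list \<Rightarrow> nat list \<Rightarrow> nat list \<Rightarrow> bool" where
  "phi g X Y \<longleftrightarrow> deg_ok g X Y \<and> (\<forall>i\<in>CL. cluster_ok True g Y i) \<and>
     (\<forall>i\<in>CO. cluster_ok False g Y i) \<and> (\<forall>i\<in>C. conn_ok g X Y i)"

text \<open>This is what the far side can see of \<open>X\<close>: for each uncoloured vertex, the
  truncated number of neighbours in every class. \<open>W\<close> serves as a small name for this
  information.\<close>

definition in_ok :: "bool list list \<Rightarrow> nat list \<Rightarrow> nat list \<Rightarrow> bool" where
  "in_ok g X W \<longleftrightarrow> (\<forall>v\<in>set [0..<length g]. nthd 0 X v = 0 \<longrightarrow>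
     (\<forall>j\<in>{1..k}. min d (deg g X v j) = min d (deg g W v j)))"

definition feas :: "bool list list \<Rightarrow> nat list \<Rightarrow> bool" where
  "feas g X \<longleftrightarrow> (\<forall>v\<in>set [0..<length g]. nthd 0 X v \<in> {1..k}) \<and> phi g X X"

definition no_worse :: "bool list list \<Rightarrow> nat list \<Rightarrow> nat list \<Rightarrow> bool" where
  "no_worse g X X' \<longleftrightarrow> (R = ObjMin \<longrightarrow> length (cls g X 1) \<le> length (cls g X' 1)) \<and>
     (R = ObjMax \<longrightarrow> length (cls g X' 1) \<le> length (cls g X 1))"

definition best :: "bool list list \<Rightarrow> nat list list \<Rightarrow> nat list list" where
  "best g S = firsts (filter (\<lambda>X. \<forall>X'\<in>set S. no_worse g X X') S)"

abbreviation "tests g \<equiv> small k g (k * (d + 7))"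

definition reduce :: "bool list list \<Rightarrow> nat list list \<Rightarrow> nat list list" where
  "reduce g S = concat (map (\<lambda>Z. concat (map (\<lambda>W.
     best g (filter (\<lambda>X. phi g X (overlay g X Z) \<and> in_ok g X W) S)) (tests g))) (tests g))"

text \<open>Candidates for the branch at \<open>x\<close> after removal of the edge to
  \<open>y\<close>. A leaf contributes the colourings of its own vertex, an inner vertex the joins
  over its two other neighbours; \<open>a < b\<close> takes each pair once.\<close>

definition cands :: "bool list list \<Rightarrow> bool list list \<Rightarrow> nat list \<Rightarrow> nat list list list list \<Rightarrow>
    nat \<Rightarrow> nat \<Rightarrow> nat list list" where
  "cands g t l T x y = starts g l x @ concat (map (\<lambda>a. concat (map (\<lambda>b.
     joins g (entry T a x) (entry T b x))
       (filter (\<lambda>b. adj t x b \<and> b \<noteq> y \<and> a < b) [0..<length t])))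
     (filter (\<lambda>a. adj t x a \<and> a \<noteq> y) [0..<length t]))"

definition step :: "bool list list \<Rightarrow> bool list list \<Rightarrow> nat list \<Rightarrow> nat list list list list \<Rightarrow>
    nat list list list list" where
  "step g t l T = map (\<lambda>x. map (\<lambda>y. reduce g (cands g t l T x y)) [0..<length t]) [0..<length t]"

text \<open>Any single tree edge splits the whole graph, so joining its two entries gives colourings
  of all vertices. The first summand is there for the tree without edges; partial colourings are
  removed later, since \<open>feas\<close> demands a colour everywhere.\<close>

definition final :: "bool list list \<Rightarrow> bool list list \<Rightarrow> nat list \<Rightarrow> nat list list list list \<Rightarrow>
    nat list list" where
  "final g t l T = concat (map (starts g l) [0..<length t]) @
     concat (map (\<lambda>x. concat (map (\<lambda>y. joins g (entry T x y) (entry T y x))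
       (filter (adj t x) [0..<length t]))) [0..<length t])"

definition answer :: "bool list list \<Rightarrow> bool list list \<Rightarrow> nat list \<Rightarrow> nat list list" where
  "answer g t l = best g (filter (feas g) (final g t l ((step g t l ^^ length t) [])))"

end

section \<open>The algorithm runs in polynomial time\<close>

abbreviation "enc_col \<equiv> enc_list enc_nat"
abbreviation "enc_cols \<equiv> enc_list enc_col"
abbreviation "enc_mat \<equiv> enc_list (enc_list enc_bool)"
abbreviation "enc_tab \<equiv> enc_list (enc_list enc_cols)"

lemma polyt_var0: "polyt (add_var e vs) (\<lambda>y. e (snd y))"
  by (rule polyt_var) simp

lemmas polyt_var1 = polyt_weaken[OF polyt_var0]
lemmas polyt_var2 = polyt_weaken[OF polyt_var1]

lemmas polyt_vars =
  polyt_var0[where e = enc_nat] polyt_var0[where e = enc_col]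
  polyt_var1[where e = enc_nat] polyt_var1[where e = enc_col]
  polyt_var2[where e = enc_nat] polyt_var2[where e = enc_col]

lemma polyt_mult:
  assumes "polyt vs (\<lambda>x. enc_nat (M x))" "polyt vs (\<lambda>x. enc_nat (N x))"
  shows "polyt vs (\<lambda>x. enc_nat (M x * N x))"
proof -
  have eq: "M x * N x = length (concat (map (\<lambda>i. [0..<N x]) [0..<M x]))" for x
    by (simp add: length_concat o_def sum_list_triv)
  show ?thesis unfolding eq
    by (intro polyt_length[where ea = enc_nat] polyt_concat polyt_map[where ea = enc_nat]
        polyt_upt assms polyt_weaken[OF assms(2)[THEN polyt_upt]])
qed

lemma polyt_min:
  assumes "polyt vs (\<lambda>x. enc_nat (M x))" "polyt vs (\<lambda>x. enc_nat (N x))"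
  shows "polyt vs (\<lambda>x. enc_nat (min (M x) (N x)))"
  unfolding min_def by (intro polyt_if[where e = enc_nat] polyt_le assms)

lemma polyt_firsts:
  assumes "polyt vs (\<lambda>x. enc_list ea (L x))"
  shows "polyt vs (\<lambda>x. enc_list ea (firsts (L x)))"
proof -
  have eq: "firsts (L x) = (if L x = [] then [] else [hdd undefined (L x)])" for x
    by (simp add: firsts_def hdd_def)
  show ?thesis unfolding eq
    by (rule polyt_if[where e = "enc_list ea"], rule polyt_null[OF assms], rule polyt_const,
        rule polyt_Cons, rule polyt_hdd[OF assms], rule polyt_const)
qed

lemma polyt_adj:
  assumes "polyt vs (\<lambda>x. enc_mat (G x))" "polyt vs (\<lambda>x. enc_nat (U x))" "polyt vs (\<lambda>x. enc_nat (V x))"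
  shows "polyt vs (\<lambda>x. enc_bool (adj (G x) (U x) (V x)))"
  unfolding adj_def
  by (intro polyt_nthd[where ea = enc_bool] polyt_nthd[where ea = "enc_list enc_bool"] assms)

lemmas polyt_logic = polyt_const polyt_conj polyt_disj polyt_not polyt_imp
  polyt_less polyt_le polyt_eq polyt_nthd[where ea = enc_nat]

lemma polyt_coadj:
  assumes "polyt vs (\<lambda>x. enc_mat (G x))" "polyt vs (\<lambda>x. enc_nat (U x))" "polyt vs (\<lambda>x. enc_nat (V x))"
  shows "polyt vs (\<lambda>x. enc_bool (coadj b (G x) (U x) (V x)))"
  unfolding coadj_def
  by (intro polyt_if[where e = enc_bool] polyt_logic polyt_adj assms)

lemma polyt_verts:
  "polyt vs (\<lambda>x. enc_mat (G x)) \<Longrightarrow> polyt vs (\<lambda>x. enc_col [0..<length (G x)])"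
  by (intro polyt_upt polyt_length[where ea = "enc_list enc_bool"])

lemma polyt_cls:
  assumes "polyt vs (\<lambda>x. enc_mat (G x))" "polyt vs (\<lambda>x. enc_col (X x))" "polyt vs (\<lambda>x. enc_nat (I x))"
  shows "polyt vs (\<lambda>x. enc_col (cls (G x) (X x) (I x)))"
  unfolding cls_def
  by (intro polyt_filter polyt_verts polyt_logic polyt_vars assms assms[THEN polyt_weaken])

lemma polyt_put:
  assumes "polyt vs (\<lambda>x. enc_mat (G x))" "polyt vs (\<lambda>x. enc_col (X x))"
    "polyt vs (\<lambda>x. enc_nat (V x))" "polyt vs (\<lambda>x. enc_nat (I x))"
  shows "polyt vs (\<lambda>x. enc_col (put (G x) (X x) (V x) (I x)))"
  unfolding put_def
  by (intro polyt_map[where ea = enc_nat] polyt_if[where e = enc_nat] polyt_verts polyt_logic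
      polyt_vars assms assms[THEN polyt_weaken])

lemma polyt_overlay:
  assumes "polyt vs (\<lambda>x. enc_mat (G x))" "polyt vs (\<lambda>x. enc_col (X x))" "polyt vs (\<lambda>x. enc_col (Z x))"
  shows "polyt vs (\<lambda>x. enc_col (overlay (G x) (X x) (Z x)))"
  unfolding overlay_def
  by (intro polyt_map[where ea = enc_nat] polyt_if[where e = enc_nat] polyt_verts polyt_logic
      polyt_vars assms assms[THEN polyt_weaken])

lemma polyt_deg:
  assumes "polyt vs (\<lambda>x. enc_mat (G x))" "polyt vs (\<lambda>x. enc_col (X x))"
    "polyt vs (\<lambda>x. enc_nat (V x))" "polyt vs (\<lambda>x. enc_nat (I x))"
  shows "polyt vs (\<lambda>x. enc_nat (deg (G x) (X x) (V x) (I x)))"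
  unfolding deg_def
  by (intro polyt_length[where ea = enc_nat] polyt_filter polyt_adj polyt_cls
      polyt_vars assms assms[THEN polyt_weaken])

lemma polyt_cluster_ok:
  assumes "polyt vs (\<lambda>x. enc_mat (G x))" "polyt vs (\<lambda>x. enc_col (Y x))" "polyt vs (\<lambda>x. enc_nat (I x))"
  shows "polyt vs (\<lambda>x. enc_bool (cluster_ok b (G x) (Y x) (I x)))"
proof -
  note w1 = assms[THEN polyt_weaken]
  note w2 = w1[THEN polyt_weaken]
  note w3 = w2[THEN polyt_weaken]
  show ?thesis unfolding cluster_ok_def
    by (intro polyt_Ball[where ea = enc_nat] polyt_cls polyt_logic polyt_coadj polyt_vars assms w1 w2 w3)
qed

lemma polyt_link_rel:
  assumes "polyt vs (\<lambda>x. enc_mat (G x))" "polyt vs (\<lambda>x. enc_col (X x))"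
    "polyt vs (\<lambda>x. enc_nat (U x))" "polyt vs (\<lambda>x. enc_nat (V x))"
  shows "polyt vs (\<lambda>x. enc_bool (link (G x) (X x) (U x) (V x)))"
  unfolding link_def by (intro polyt_logic polyt_adj assms)

lemma polyt_grow:
  assumes "polyt vs (\<lambda>x. enc_mat (G x))" "polyt vs (\<lambda>x. enc_col (X x))"
    "polyt vs (\<lambda>x. enc_col (Y x))" "polyt vs (\<lambda>x. enc_nat (I x))" "polyt vs (\<lambda>x. enc_col (S x))"
  shows "polyt vs (\<lambda>x. enc_col (grow (G x) (X x) (Y x) (I x) (S x)))"
proof -
  note w1 = assms[THEN polyt_weaken]
  note w2 = w1[THEN polyt_weaken]
  show ?thesis unfolding grow_def
    by (intro polyt_filter polyt_Bex[where ea = enc_nat] polyt_cls polyt_logic polyt_link_rel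
        polyt_vars assms w1 w2)
qed

lemma polyt_conn_ok:
  assumes "polyt vs (\<lambda>x. enc_mat (G x))" "polyt vs (\<lambda>x. enc_col (X x))"
    "polyt vs (\<lambda>x. enc_col (Y x))" "polyt vs (\<lambda>x. enc_nat (I x))"
  shows "polyt vs (\<lambda>x. enc_bool (conn_ok (G x) (X x) (Y x) (I x)))"
proof -
  note w1 = assms[THEN polyt_weaken]
  note w2 = w1[THEN polyt_weaken]
  note w3 = w2[THEN polyt_weaken]
  let ?vs = "add_var enc_nat (add_var enc_nat vs)"
  let ?f = "\<lambda>y. grow (G (fst (fst y))) (X (fst (fst y))) (Y (fst (fst y))) (I (fst (fst y)))"
  have iter: "polyt ?vs (\<lambda>y. enc_col ((?f y ^^ (length (G (fst (fst y))) * length (G (fst (fst y)))))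
      [snd (fst y)]))"
  proof (rule polyt_funpow[where e = enc_col and F = ?f])
    show "polyt ?vs (\<lambda>y. enc_nat (length (G (fst (fst y))) * length (G (fst (fst y)))))"
      by (intro polyt_mult polyt_length[where ea = "enc_list enc_bool"] w2)
    show start: "polyt ?vs (\<lambda>y. enc_col [snd (fst y)])"
      by (intro polyt_Cons polyt_vars polyt_const)
    show "polyt (add_var enc_col ?vs) (\<lambda>y. enc_col (?f (fst y) (snd y)))"
      by (intro polyt_grow polyt_vars w3)
    let ?cls = "\<lambda>y. cls (G (fst (fst y))) (Y (fst (fst y))) (I (fst (fst y)))"
    have c: "polyt ?vs (\<lambda>y. enc_col (?cls y))" by (intro polyt_cls w2)
    \<comment> \<open>Before the first round the set is a singleton, afterwards it is a filtered
      copy of the class; the sum of both sizes bounds every iterate.\<close>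
    show "poly_bounded (env_size ?vs) (\<lambda>y. size (enc_col [snd (fst y)]) + size (enc_col (?cls y)))"
      by (intro poly_bounded_add polyt_size[OF start] polyt_size[OF c])
    show "size (enc_col ((?f y ^^ i) [snd (fst y)]))
        \<le> size (enc_col [snd (fst y)]) + size (enc_col (?cls y))" for y i
    proof (cases i)
      case (Suc j)
      have "size (enc_col (?f y S)) \<le> size (enc_col (?cls y))" for S
        unfolding grow_def by (rule size_enc_filter)
      then show ?thesis unfolding Suc funpow.simps o_apply by (rule trans_le_add2)
    qed simp
  qed
  show ?thesis unfolding conn_ok_def
    by (intro polyt_Ball[where ea = enc_nat] polyt_Bex[where ea = enc_nat] polyt_cls polyt_logic
        polyt_vars assms w1 w2 iter)
qed

lemma polyt_starts:
  assumes "polyt vs (\<lambda>x. enc_mat (G x))" "polyt vs (\<lambda>x. enc_col (L x))" "polyt vs (\<lambda>x. enc_nat (U x))"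
  shows "polyt vs (\<lambda>x. enc_cols (starts_of k (G x) (L x) (U x)))"
proof -
  note w1 = assms[THEN polyt_weaken]
  note w2 = w1[THEN polyt_weaken]
  show ?thesis unfolding starts_of_def
    by (intro polyt_concat polyt_map[where ea = enc_nat] polyt_filter polyt_verts polyt_logic polyt_put
        polyt_vars assms w1 w2)
qed

lemma polyt_joins:
  assumes "polyt vs (\<lambda>x. enc_mat (G x))" "polyt vs (\<lambda>x. enc_cols (S x))" "polyt vs (\<lambda>x. enc_cols (S' x))"
  shows "polyt vs (\<lambda>x. enc_cols (joins (G x) (S x) (S' x)))"
proof -
  note w1 = assms[THEN polyt_weaken]
  note w2 = w1[THEN polyt_weaken]
  show ?thesis unfolding joins_def
    by (intro polyt_concat polyt_map[where ea = enc_col] polyt_overlay polyt_vars assms w1 w2)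
qed

lemma polyt_small:
  assumes "polyt vs (\<lambda>x. enc_mat (G x))"
  shows "polyt vs (\<lambda>x. enc_cols (small k (G x) m))"
proof (induction m)
  case 0
  show ?case unfolding small.simps
    by (intro polyt_Cons polyt_map[where ea = enc_nat] polyt_verts polyt_const assms)
next
  case (Suc m)
  note w1 = assms[THEN polyt_weaken]
  note w2 = w1[THEN polyt_weaken]
  note w3 = w2[THEN polyt_weaken]
  show ?case unfolding small.simps
    by (intro polyt_append Suc polyt_concat polyt_map[where ea = enc_col] polyt_map[where ea = enc_nat]
        polyt_verts polyt_const polyt_put polyt_vars assms w1 w2 w3)
qed

lemma polyt_entry:
  assumes "polyt vs (\<lambda>x. enc_tab (T x))" "polyt vs (\<lambda>x. enc_nat (U x))" "polyt vs (\<lambda>x. enc_nat (V x))"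
  shows "polyt vs (\<lambda>x. enc_cols (entry (T x) (U x) (V x)))"
  unfolding entry_def
  by (intro polyt_nthd[where ea = enc_cols] polyt_nthd[where ea = "enc_list enc_cols"] assms)

context partition_problem
begin

lemma finite_params [simp]: "finite CL" "finite CO" "finite C"
  using fin finite_subset by blast+

lemma polyt_deg_ok:
  assumes "polyt vs (\<lambda>x. enc_mat (G x))" "polyt vs (\<lambda>x. enc_col (X x))" "polyt vs (\<lambda>x. enc_col (Y x))"
  shows "polyt vs (\<lambda>x. enc_bool (deg_ok (G x) (X x) (Y x)))"
proof -
  note w1 = assms[THEN polyt_weaken]
  show ?thesis unfolding deg_ok_def
    by (intro polyt_Ball[where ea = enc_nat] polyt_finite_Ball finite_atLeastAtMost polyt_verts
        polyt_logic polyt_member[OF polyt_deg D] polyt_vars assms w1)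
qed

lemma polyt_phi:
  assumes "polyt vs (\<lambda>x. enc_mat (G x))" "polyt vs (\<lambda>x. enc_col (X x))" "polyt vs (\<lambda>x. enc_col (Y x))"
  shows "polyt vs (\<lambda>x. enc_bool (phi (G x) (X x) (Y x)))"
  unfolding phi_def
  by (intro polyt_conj polyt_finite_Ball finite_params polyt_const polyt_deg_ok polyt_cluster_ok
      polyt_conn_ok assms)

lemma polyt_in_ok:
  assumes "polyt vs (\<lambda>x. enc_mat (G x))" "polyt vs (\<lambda>x. enc_col (X x))" "polyt vs (\<lambda>x. enc_col (W x))"
  shows "polyt vs (\<lambda>x. enc_bool (in_ok (G x) (X x) (W x)))"
proof -
  note w1 = assms[THEN polyt_weaken]
  show ?thesis unfolding in_ok_def
    by (intro polyt_Ball[where ea = enc_nat] polyt_finite_Ball finite_atLeastAtMost polyt_verts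
        polyt_logic polyt_min polyt_deg polyt_vars assms w1)
qed

lemma polyt_feas:
  assumes "polyt vs (\<lambda>x. enc_mat (G x))" "polyt vs (\<lambda>x. enc_col (X x))"
  shows "polyt vs (\<lambda>x. enc_bool (feas (G x) (X x)))"
proof -
  note w1 = assms[THEN polyt_weaken]
  have "finite {1..k} \<or> finite (- {1..k})" by simp
  then show ?thesis unfolding feas_def
    by (intro polyt_conj polyt_phi polyt_Ball[where ea = enc_nat] polyt_verts polyt_member
        polyt_nthd[where ea = enc_nat] polyt_vars assms w1)
qed

lemma polyt_no_worse:
  assumes "polyt vs (\<lambda>x. enc_mat (G x))" "polyt vs (\<lambda>x. enc_col (X x))" "polyt vs (\<lambda>x. enc_col (X' x))"
  shows "polyt vs (\<lambda>x. enc_bool (no_worse (G x) (X x) (X' x)))"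
  unfolding no_worse_def
  by (intro polyt_logic polyt_length[where ea = enc_nat] polyt_cls assms)

lemma polyt_best:
  assumes "polyt vs (\<lambda>x. enc_mat (G x))" "polyt vs (\<lambda>x. enc_cols (S x))"
  shows "polyt vs (\<lambda>x. enc_cols (best (G x) (S x)))"
proof -
  note w1 = assms[THEN polyt_weaken]
  note w2 = w1[THEN polyt_weaken]
  show ?thesis unfolding best_def
    by (intro polyt_firsts polyt_filter polyt_Ball[where ea = enc_col] polyt_no_worse
        polyt_vars assms w1 w2)
qed

lemma polyt_reduce:
  assumes "polyt vs (\<lambda>x. enc_mat (G x))" "polyt vs (\<lambda>x. enc_cols (S x))"
  shows "polyt vs (\<lambda>x. enc_cols (reduce (G x) (S x)))"
proof -
  note w1 = assms[THEN polyt_weaken]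
  note w2 = w1[THEN polyt_weaken]
  note w3 = w2[THEN polyt_weaken]
  show ?thesis unfolding reduce_def
    by (intro polyt_concat polyt_map[where ea = enc_col] polyt_small polyt_best polyt_filter
        polyt_conj polyt_phi polyt_overlay polyt_in_ok polyt_vars assms w1 w2 w3)
qed

lemma polyt_cands:
  assumes "polyt vs (\<lambda>x. enc_mat (G x))" "polyt vs (\<lambda>x. enc_mat (T x))" "polyt vs (\<lambda>x. enc_col (L x))"
    "polyt vs (\<lambda>x. enc_tab (A x))" "polyt vs (\<lambda>x. enc_nat (U x))" "polyt vs (\<lambda>x. enc_nat (V x))"
  shows "polyt vs (\<lambda>x. enc_cols (cands (G x) (T x) (L x) (A x) (U x) (V x)))"
proof -
  note w1 = assms[THEN polyt_weaken]
  note w2 = w1[THEN polyt_weaken]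
  note w3 = w2[THEN polyt_weaken]
  show ?thesis unfolding cands_def
    by (intro polyt_append polyt_starts polyt_concat polyt_map[where ea = enc_nat] polyt_filter
        polyt_verts polyt_logic polyt_adj polyt_joins polyt_entry polyt_vars assms w1 w2 w3)
qed

lemma polyt_step:
  assumes "polyt vs (\<lambda>x. enc_mat (G x))" "polyt vs (\<lambda>x. enc_mat (T x))" "polyt vs (\<lambda>x. enc_col (L x))"
    "polyt vs (\<lambda>x. enc_tab (A x))"
  shows "polyt vs (\<lambda>x. enc_tab (step (G x) (T x) (L x) (A x)))"
proof -
  note w1 = assms[THEN polyt_weaken]
  note w2 = w1[THEN polyt_weaken]
  show ?thesis unfolding step_def
    by (intro polyt_map[where ea = enc_nat] polyt_reduce polyt_cands
        polyt_verts polyt_vars assms w1 w2)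
qed

lemma polyt_final:
  assumes "polyt vs (\<lambda>x. enc_mat (G x))" "polyt vs (\<lambda>x. enc_mat (T x))" "polyt vs (\<lambda>x. enc_col (L x))"
    "polyt vs (\<lambda>x. enc_tab (A x))"
  shows "polyt vs (\<lambda>x. enc_cols (final (G x) (T x) (L x) (A x)))"
proof -
  note w1 = assms[THEN polyt_weaken]
  note w2 = w1[THEN polyt_weaken]
  show ?thesis unfolding final_def
    by (intro polyt_append polyt_concat polyt_map[where ea = enc_nat] polyt_filter polyt_starts
        polyt_joins polyt_entry polyt_adj polyt_verts polyt_vars assms w1 w2)
qed

text \<open>Iteration in polynomial time needs a size bound for every input, including lists that
  describe no graph or tree. Hence these invariants are proved without any assumption on
  \<open>g\<close>, \<open>t\<close> and \<open>l\<close>.\<close>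

definition wf_col :: "bool list list \<Rightarrow> nat list \<Rightarrow> bool" where
  "wf_col g X \<longleftrightarrow> length X = length g \<and> (\<forall>i\<in>set X. i \<le> k)"

lemma nthd_le: "\<forall>i\<in>set X. i \<le> k \<Longrightarrow> nthd 0 X v \<le> k"
  by (auto simp: nthd_def)

lemma wf_starts: "X \<in> set (starts g l x) \<Longrightarrow> wf_col g X"
  by (auto simp: starts_of_def wf_col_def put_def nthd_def)

lemma wf_joins:
  "\<forall>X\<in>set S. wf_col g X \<Longrightarrow> \<forall>X\<in>set S'. wf_col g X \<Longrightarrow> X \<in> set (joins g S S') \<Longrightarrow> wf_col g X"
  by (auto simp: joins_def wf_col_def overlay_def intro!: nthd_le)

lemma set_firsts: "set (firsts l) \<subseteq> set l"
  by (auto simp: firsts_def)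

lemma set_best: "set (best g S) \<subseteq> set S"
  using set_firsts unfolding best_def by fastforce

lemma set_reduce: "set (reduce g S) \<subseteq> set S"
  using set_best unfolding reduce_def by fastforce

text \<open>At most one candidate is kept per pair of tests, whatever the length of
  \<open>S\<close>. This stops the growth caused by \<open>joins\<close> from accumulating over the
  rounds.\<close>

lemma length_reduce: "length (reduce g S) \<le> length (tests g) * length (tests g)"
proof -
  have concat: "length (concat (map f l)) \<le> length l * b" if "\<And>a. length (f a) \<le> b"
    for f :: "nat list \<Rightarrow> nat list list" and l b
    using that by (induction l) (auto intro: add_mono)
  have "length (best g S') \<le> 1" for S' by (simp add: best_def firsts_def)
  then show ?thesis unfolding reduce_def
    using concat[of _ 1] by (intro concat) fastforce
qed

definition wf_tab :: "bool list list \<Rightarrow> bool list list \<Rightarrow> nat list list list list \<Rightarrow> bool" where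
  "wf_tab g t T \<longleftrightarrow> length T \<le> length t \<and> (\<forall>row\<in>set T. length row \<le> length t \<and>
     (\<forall>S\<in>set row. length S \<le> length (tests g) * length (tests g) \<and> (\<forall>X\<in>set S. wf_col g X)))"

lemma wf_entry: "wf_tab g t T \<Longrightarrow> X \<in> set (entry T x y) \<Longrightarrow> wf_col g X"
  unfolding wf_tab_def entry_def nthd_def by (auto split: if_splits) (meson nth_mem)

lemma wf_step:
  assumes "wf_tab g t T"
  shows "wf_tab g t (step g t l T)"
proof -
  have "wf_col g X" if "X \<in> set (cands g t l T x y)" for X x y
    using that wf_starts wf_joins[of _ g] wf_entry[OF assms] unfolding cands_def by fastforce
  then show ?thesis
    using length_reduce set_reduce unfolding wf_tab_def step_def by fastforce
qed

lemma wf_iter: "wf_tab g t ((step g t l ^^ i) [])"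
  by (induction i) (simp_all add: wf_step, simp add: wf_tab_def)

lemma size_wf_tab:
  assumes "wf_tab g t T"
  shows "size (enc_tab T) \<le> length t * (length t * (length (tests g) * length (tests g) *
    (length g * (k + 1) + 1) + 1) + 1)"
proof -
  have col: "size (enc_col X) \<le> length g * (k + 1)" if "wf_col g X" for X
    using size_enc_list_le[of X enc_nat k] that by (simp add: wf_col_def)
  have S: "size (enc_cols S) \<le> length (tests g) * length (tests g) * (length g * (k + 1) + 1)"
    if "row \<in> set T" "S \<in> set row" for row S
  proof -
    have "size (enc_cols S) \<le> length S * (length g * (k + 1) + 1)"
      by (rule size_enc_list_le, rule col) (use assms that in \<open>auto simp: wf_tab_def\<close>)
    also have "\<dots> \<le> length (tests g) * length (tests g) * (length g * (k + 1) + 1)"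
      by (rule mult_right_mono) (use assms that in \<open>auto simp: wf_tab_def\<close>)
    finally show ?thesis .
  qed
  have row: "size (enc_list enc_cols row) \<le> length t * (length (tests g) * length (tests g) *
    (length g * (k + 1) + 1) + 1)" if "row \<in> set T" for row
  proof -
    have "size (enc_list enc_cols row) \<le> length row * (length (tests g) * length (tests g) *
        (length g * (k + 1) + 1) + 1)"
      by (rule size_enc_list_le, rule S[OF that])
    also have "\<dots> \<le> length t * (length (tests g) * length (tests g) * (length g * (k + 1) + 1) + 1)"
      by (rule mult_right_mono) (use assms that in \<open>auto simp: wf_tab_def\<close>)
    finally show ?thesis .
  qed
  have "size (enc_tab T) \<le> length T * (length t * (length (tests g) * length (tests g) *
      (length g * (k + 1) + 1) + 1) + 1)"
    by (rule size_enc_list_le, rule row)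
  also have "\<dots> \<le> length t * (length t * (length (tests g) * length (tests g) *
      (length g * (k + 1) + 1) + 1) + 1)"
    by (rule mult_right_mono) (use assms in \<open>auto simp: wf_tab_def\<close>)
  finally show ?thesis .
qed

lemma polyt_answer:
  assumes "polyt vs (\<lambda>x. enc_mat (G x))" "polyt vs (\<lambda>x. enc_mat (T x))" "polyt vs (\<lambda>x. enc_col (L x))"
  shows "polyt vs (\<lambda>x. enc_cols (answer (G x) (T x) (L x)))"
proof -
  note w1 = assms[THEN polyt_weaken]
  have len: "poly_bounded (env_size vs) (\<lambda>x. length (A x))"
    if "polyt vs (\<lambda>x. enc_list ea (A x))" for ea and A :: "'a \<Rightarrow> 'b list"
    using polyt_size[OF polyt_length[OF that]] by simp
  have "polyt vs (\<lambda>x. enc_tab ((step (G x) (T x) (L x) ^^ length (T x)) []))"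
  proof (rule polyt_funpow[where e = enc_tab and F = "\<lambda>x. step (G x) (T x) (L x)"])
    show "polyt vs (\<lambda>x. enc_nat (length (T x)))" by (rule polyt_length[OF assms(2)])
    show "polyt vs (\<lambda>x. enc_tab [])" by (rule polyt_const)
    show "polyt (add_var enc_tab vs) (\<lambda>y. enc_tab (step (G (fst y)) (T (fst y)) (L (fst y)) (snd y)))"
      by (intro polyt_step w1 polyt_var0[where e = enc_tab])
    show "poly_bounded (env_size vs) (\<lambda>x. length (T x) * (length (T x) *
        (length (tests (G x)) * length (tests (G x)) * (length (G x) * (k + 1) + 1) + 1) + 1))"
      by (intro poly_bounded_mult poly_bounded_add poly_bounded_const len[OF assms(2)]
          len[OF assms(1)] len[OF polyt_small[OF assms(1)]])
  qed (rule size_wf_tab[OF wf_iter])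
  then show ?thesis unfolding answer_def
    by (intro polyt_best polyt_filter polyt_feas polyt_final polyt_vars assms w1)
qed

lemma answer_poly_time:
  "\<exists>p q. \<forall>g t l. \<exists>u. runs p (Pair (enc_mat g) (Pair (enc_mat t) (enc_col l)))
     (enc_option enc_col (case answer g t l of [] \<Rightarrow> None | X # _ \<Rightarrow> Some X)) u \<and>
     u \<le> poly q (size (Pair (enc_mat g) (Pair (enc_mat t) (enc_col l))))"
proof -
  let ?in = "\<lambda>x. Pair (enc_mat (fst x)) (Pair (enc_mat (fst (snd x))) (enc_col (snd (snd x))))"
  let ?out = "\<lambda>x. enc_option enc_col
    (case answer (fst x) (fst (snd x)) (snd (snd x)) of [] \<Rightarrow> None | X # _ \<Rightarrow> Some X)"
  let ?a = "\<lambda>x. enc_cols (answer (fst x) (fst (snd x)) (snd (snd x)))"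
  have v: "polyt [?in] ?in" by (rule polyt_var) simp
  have "polyt [?in] (\<lambda>x. sfst (?in x))" "polyt [?in] (\<lambda>x. sfst (ssnd (?in x)))"
    "polyt [?in] (\<lambda>x. ssnd (ssnd (?in x)))"
    by (intro polyt_sfst polyt_ssnd v)+
  then have a: "polyt [?in] ?a" by (intro polyt_answer) auto
  have "?out x = (if ?a x = Atom then Atom else Pair Atom (sfst (?a x)))" for x
    by (cases "answer (fst x) (fst (snd x)) (snd (snd x))") auto
  with polyt_if_Atom[OF a polyt_const polyt_Pair[OF polyt_const polyt_sfst[OF a]]]
  have "polyt [?in] ?out" by simp
  from polyt_runs[OF this] obtain p q where
    "\<And>x. \<exists>u. runs p (?in x) (?out x) u \<and> u \<le> poly q (size (?in x))" by blast
  from this[of "(g, t, l)" for g t l] show ?thesis unfolding fst_conv snd_conv by blast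
qed

end

section \<open>Chain cuts\<close>

text \<open>Cuts without an induced matching of size two. The neighbourhoods of the vertices on one side
  are linearly ordered by inclusion.\<close>

definition chain_cut :: "('a \<Rightarrow> 'a \<Rightarrow> bool) \<Rightarrow> 'a set \<Rightarrow> bool" where
  "chain_cut r A \<longleftrightarrow> (\<forall>a\<in>A. \<forall>a'\<in>A. \<forall>b. \<forall>b'. b \<notin> A \<longrightarrow> b' \<notin> A \<longrightarrow>
     r a b \<longrightarrow> r a' b' \<longrightarrow> r a b' \<or> r a' b)"

lemma chain_cut_nested:
  "chain_cut r A \<Longrightarrow> b \<notin> A \<Longrightarrow> b' \<notin> A \<Longrightarrow>
    (\<forall>a\<in>A. r a b \<longrightarrow> r a b') \<or> (\<forall>a\<in>A. r a b' \<longrightarrow> r a b)"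
  unfolding chain_cut_def by blast

lemma chain_cut_Compl:
  "chain_cut r A \<Longrightarrow> (\<And>a b. r a b \<longleftrightarrow> r b a) \<Longrightarrow> chain_cut r (- A)"
  unfolding chain_cut_def by (metis ComplD ComplI)

text \<open>A finite nonempty set that is totally preordered has a greatest element. Applied to the
  negated relation, this also yields a vertex with smallest neighbourhood.\<close>

lemma nested_top:
  assumes "finite S" "S \<noteq> {}"
    and "\<And>y y'. y \<in> S \<Longrightarrow> y' \<in> S \<Longrightarrow> (\<forall>a\<in>A. r a y \<longrightarrow> r a y') \<or> (\<forall>a\<in>A. r a y' \<longrightarrow> r a y)"
  shows "\<exists>t\<in>S. \<forall>y\<in>S. \<forall>a\<in>A. r a y \<longrightarrow> r a t"
  using assms
proof (induction S rule: finite_ne_induct)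
  case (insert x S)
  then obtain t where t: "t \<in> S" "\<forall>y\<in>S. \<forall>a\<in>A. r a y \<longrightarrow> r a t" by auto
  from insert.prems[of x t] t show ?case by (metis insert_iff)
qed auto

lemma chain_cut_top:
  assumes "chain_cut r A" "finite S" "S \<noteq> {}" "S \<inter> A = {}"
  shows "\<exists>t\<in>S. \<forall>y\<in>S. \<forall>a\<in>A. r a y \<longrightarrow> r a t"
  using assms by (intro nested_top chain_cut_nested) auto

lemma chain_cut_bot:
  assumes "chain_cut r A" "finite S" "S \<noteq> {}" "S \<inter> A = {}"
  shows "\<exists>t\<in>S. \<forall>y\<in>S. \<forall>a\<in>A. r a t \<longrightarrow> r a y"
proof -
  have "\<exists>t\<in>S. \<forall>y\<in>S. \<forall>a\<in>A. \<not> r a y \<longrightarrow> \<not> r a t"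
  proof (rule nested_top)
    show "(\<forall>a\<in>A. \<not> r a y \<longrightarrow> \<not> r a y') \<or> (\<forall>a\<in>A. \<not> r a y' \<longrightarrow> \<not> r a y)"
      if "y \<in> S" "y' \<in> S" for y y'
      using chain_cut_nested[OF assms(1), of y y'] that assms(4) by blast
  qed (use assms in auto)
  then show ?thesis by blast
qed

lemma chain_cut_truncate:
  assumes "chain_cut r A" "finite S" "S \<inter> A = {}"
  shows "\<exists>z \<subseteq> S. card z \<le> d \<and>
    (\<forall>z'. z \<subseteq> z' \<and> z' \<subseteq> S \<longrightarrow> (\<forall>a\<in>A. min d (card {y \<in> z'. r a y}) = min d (card {y \<in> S. r a y})))"
  using assms(2,3)
proof (induction S rule: finite_psubset_induct)
  case (psubset S)
  show ?case
  proof (cases "card S \<le> d")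
    case True
    then show ?thesis by (intro exI[of _ S]) auto
  next
    case False
    then have "S \<noteq> {}" by auto
    then obtain t where t: "t \<in> S" "\<forall>y\<in>S. \<forall>a\<in>A. r a t \<longrightarrow> r a y"
      using chain_cut_bot[OF assms(1) psubset.hyps(1)] psubset.prems by blast
    have "S - {t} \<subset> S" using t by auto
    moreover have "(S - {t}) \<inter> A = {}" using psubset.prems by auto
    ultimately obtain z where
      z: "z \<subseteq> S - {t}" "card z \<le> d" and
      eq: "\<forall>z'. z \<subseteq> z' \<and> z' \<subseteq> S - {t} \<longrightarrow>
        (\<forall>a\<in>A. min d (card {y \<in> z'. r a y}) = min d (card {y \<in> S - {t}. r a y}))"
      using psubset.IH[of "S - {t}"] by metis
    have "min d (card {y \<in> z'. r a y}) = min d (card {y \<in> S. r a y})"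
      if "z \<subseteq> z'" "z' \<subseteq> S" "a \<in> A" for z' a
    proof -
      have fin: "finite S" by fact
      have z: "min d (card {y \<in> z. r a y}) = min d (card {y \<in> S - {t}. r a y})"
        using eq z that by blast
      have "min d (card {y \<in> S - {t}. r a y}) = min d (card {y \<in> S. r a y})"
      proof (cases "r a t")
        case True
        then have "{y \<in> S. r a y} = S" "{y \<in> S - {t}. r a y} = S - {t}" using t that by auto
        then show ?thesis using False t fin by simp
      next
        case False
        then have "{y \<in> S. r a y} = {y \<in> S - {t}. r a y}" by auto
        then show ?thesis by simp
      qed
      moreover have "card {y \<in> z. r a y} \<le> card {y \<in> z'. r a y}"
        using that fin by (intro card_mono) (auto intro: finite_subset)
      moreover have "card {y \<in> z'. r a y} \<le> card {y \<in> S. r a y}"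
        using that fin by (intro card_mono) auto
      ultimately show ?thesis using z by linarith
    qed
    with z(1,2) show ?thesis by (intro exI[of _ z] conjI allI impI ballI) auto
  qed
qed

section \<open>Exchanging one side of a cut\<close>

definition P3_free :: "('a \<Rightarrow> 'a \<Rightarrow> bool) \<Rightarrow> 'a set \<Rightarrow> bool" where
  "P3_free r S \<longleftrightarrow> (\<forall>u\<in>S. \<forall>v\<in>S. \<forall>w\<in>S. r u v \<and> r v w \<and> u \<noteq> w \<longrightarrow> r u w)"

lemma P3_freeD: "P3_free r S \<Longrightarrow> u \<in> S \<Longrightarrow> v \<in> S \<Longrightarrow> w \<in> S \<Longrightarrow> r u v \<Longrightarrow> r v w \<Longrightarrow> u \<noteq> w \<Longrightarrow> r u w"
  unfolding P3_free_def by blast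

lemma P3_free_subset: "P3_free r S \<Longrightarrow> S' \<subseteq> S \<Longrightarrow> P3_free r S'"
  unfolding P3_free_def by blast

text \<open>At most one clique of \<open>V\<close> has neighbours in \<open>U\<close>, the one of a vertex \<open>t\<close> with largest
  neighbourhood. Three vertices of \<open>V\<close> witness this: \<open>t\<close>, the vertex of its clique
  with the smallest neighbourhood, and the vertex outside the clique with the largest.\<close>

definition cluster_triple :: "('a \<Rightarrow> 'a \<Rightarrow> bool) \<Rightarrow> 'a set \<Rightarrow> 'a set \<Rightarrow> 'a \<Rightarrow> 'a \<Rightarrow> 'a \<Rightarrow> bool" where
  "cluster_triple r A V t b f \<longleftrightarrow> (\<forall>y\<in>V. \<forall>a\<in>A. r a y \<longrightarrow> r a t) \<and> (b = t \<or> r t b) \<and>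
     (\<forall>y\<in>V. y = t \<or> r t y \<longrightarrow> (\<forall>a\<in>A. r a b \<longrightarrow> r a y)) \<and>
     (\<forall>y\<in>V. y \<noteq> t \<and> \<not> r t y \<longrightarrow> f \<noteq> t \<and> \<not> r t f \<and> (\<forall>a\<in>A. r a y \<longrightarrow> r a f))"

definition cluster_witness :: "('a \<Rightarrow> 'a \<Rightarrow> bool) \<Rightarrow> 'a set \<Rightarrow> 'a set \<Rightarrow> 'a set \<Rightarrow> bool" where
  "cluster_witness r A V z \<longleftrightarrow>
     (V \<noteq> {} \<longrightarrow> (\<exists>t\<in>z. \<exists>b\<in>z. \<exists>f\<in>z. cluster_triple r A V t b f))"

lemma cluster_witness_mono:
  "cluster_witness r A V z \<Longrightarrow> z \<subseteq> z' \<Longrightarrow> cluster_witness r A V z'"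
  unfolding cluster_witness_def by (meson subsetD)

lemma cluster_witness_exists:
  assumes "chain_cut r A" "finite V" "V \<inter> A = {}"
  shows "\<exists>z \<subseteq> V. card z \<le> 3 \<and> cluster_witness r A V z"
proof (cases "V = {}")
  case False
  then obtain t where t: "t \<in> V" "\<forall>y\<in>V. \<forall>a\<in>A. r a y \<longrightarrow> r a t"
    using chain_cut_top[OF assms(1,2) _ assms(3)] by blast
  let ?K = "{y \<in> V. y = t \<or> r t y}"
  have "\<exists>b\<in>?K. \<forall>y\<in>?K. \<forall>a\<in>A. r a b \<longrightarrow> r a y"
    by (rule chain_cut_bot[OF assms(1)]) (use assms t(1) in auto)
  then obtain b where b: "b \<in> ?K" "\<forall>y\<in>?K. \<forall>a\<in>A. r a b \<longrightarrow> r a y" by (elim bexE)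
  \<comment> \<open>If the closed neighbourhood of \<open>t\<close> is all of \<open>V\<close>, the
    condition on \<open>f\<close> is vacuous and \<open>t\<close> itself fills the place.\<close>
  obtain f where f: "f \<in> V" "\<forall>y\<in>V. y \<noteq> t \<and> \<not> r t y \<longrightarrow> f \<noteq> t \<and> \<not> r t f \<and> (\<forall>a\<in>A. r a y \<longrightarrow> r a f)"
  proof (cases "?K = V")
    case True
    then have "\<forall>y\<in>V. y = t \<or> r t y" by blast
    then show ?thesis by (intro that[of t]) (use t in auto)
  next
    case False
    then have "V - ?K \<noteq> {}" by auto
    have "\<exists>f\<in>V - ?K. \<forall>y\<in>V - ?K. \<forall>a\<in>A. r a y \<longrightarrow> r a f"
      by (rule chain_cut_top[OF assms(1)]) (use assms \<open>V - ?K \<noteq> {}\<close> in auto)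
    then obtain f where "f \<in> V - ?K" "\<forall>y\<in>V - ?K. \<forall>a\<in>A. r a y \<longrightarrow> r a f" by (elim bexE)
    then show ?thesis by (intro that[of f]) auto
  qed
  have b': "b = t \<or> r t b" "\<forall>y\<in>V. y = t \<or> r t y \<longrightarrow> (\<forall>a\<in>A. r a b \<longrightarrow> r a y)"
    using b by blast+
  have "cluster_triple r A V t b f"
    unfolding cluster_triple_def using t(2) b' f(2) by (intro conjI)
  then have "cluster_witness r A V {t, b, f}" unfolding cluster_witness_def by blast
  moreover have "card {t, b, f} \<le> 3" by (simp add: card_insert_if)
  ultimately show ?thesis using t(1) b(1) f(1) by (intro exI[of _ "{t, b, f}"]) auto
qed (auto simp: cluster_witness_def intro!: exI[of _ "{}"])

text \<open>A vertex of \<open>V\<close> with a neighbour \<open>u\<close> in \<open>U\<close> lies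
  in the clique of \<open>t\<close>, since otherwise \<open>t\<close>, \<open>u\<close>,
  \<open>f\<close> would form an induced path in \<open>U \<union> z\<close>. A vertex of
  \<open>U\<close> adjacent to \<open>t\<close> is adjacent to \<open>b\<close>, hence to the entire
  clique. So the edges between \<open>U\<close> and \<open>V\<close> behave as if all of them went
  to \<open>t\<close>, and every triple reduces to one inside \<open>U \<union> z\<close> or inside
  \<open>V\<close>.\<close>

lemma P3_free_exchange:
  assumes sym: "\<And>a b. r a b \<Longrightarrow> r b a"
    and UA: "U \<subseteq> A" "V \<inter> A = {}" "z \<subseteq> V"
    and free: "P3_free r V" "P3_free r (U \<union> z)" and wit: "cluster_witness r A V z"
  shows "P3_free r (U \<union> V)"
proof (cases "V = {}")
  case True
  then show ?thesis using free by (auto simp: P3_free_def)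
next
  case False
  with wit obtain t b f where z: "t \<in> z" "b \<in> z" "f \<in> z" and w: "cluster_triple r A V t b f"
    unfolding cluster_witness_def by blast
  have t: "r a t" if "y \<in> V" "a \<in> U" "r a y" for y a
    using w that UA(1) unfolding cluster_triple_def by blast
  have b: "r a y" if "y \<in> V" "y = t \<or> r t y" "a \<in> U" "r a b" for y a
    using w that UA(1) unfolding cluster_triple_def by blast
  have tb: "b = t \<or> r t b" using w unfolding cluster_triple_def by blast
  have f: "f \<noteq> t \<and> \<not> r t f \<and> r a f" if "y \<in> V" "\<not> (y = t \<or> r t y)" "a \<in> U" "r a y" for y a
    using w that UA(1) unfolding cluster_triple_def by blast
  note D1 = P3_freeD[OF free(1)] and D2 = P3_freeD[OF free(2)]
  have ne: "u \<noteq> y" if "u \<in> U" "y \<in> V" for u y using that UA by auto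
  have tV: "t \<in> V" "b \<in> V" using z UA by auto
  have K1: "r u y" if "u \<in> U" "r u t" "y \<in> V" "y = t \<or> r t y" for u y
  proof -
    have "r u b" using D2[of u t b] that z tb ne tV by auto
    then show ?thesis using b that by blast
  qed
  have K2: "y = t \<or> r t y" if "u \<in> U" "r u y" "y \<in> V" for u y
  proof (rule ccontr)
    assume y: "\<not> (y = t \<or> r t y)"
    from f[OF that(3) y that(1,2)] have f: "f \<noteq> t" "\<not> r t f" "r u f" by auto
    have "r u t" using t that by blast
    then have "r t f" using D2[of t u f] f z sym that(1) by blast
    with f show False by blast
  qed
  have K3: "r u u'" if "u \<in> U" "u' \<in> U" "y \<in> V" "r u y" "r u' y" "u \<noteq> u'" for u u' y
    using D2[of u t u'] that t z sym by blast
  have K4: "r u w" if "u \<in> U" "v \<in> U" "w \<in> V" "r u v" "r v w" for u v w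
  proof -
    have "r u t" using D2[of u v t] that t z tV ne by blast
    then show ?thesis using K1 K2 that by blast
  qed
  have K5: "r u w" if "u \<in> U" "v \<in> V" "w \<in> V" "r u v" "r v w" for u v w
  proof -
    have "v = t \<or> r t v" using K2 that by blast
    then have "w = t \<or> r t w" using D1[of t v w] that tV by blast
    then show ?thesis using K1 t that by blast
  qed
  have K6: "r u w" if "u \<in> V" "v \<in> U" "w \<in> V" "r v u" "r v w" "u \<noteq> w" for u v w
    using K2[of v u] K2[of v w] D1[of u t w] that tV sym by blast
  show ?thesis unfolding P3_free_def
  proof (intro ballI impI, elim conjE)
    fix u v w assume h: "u \<in> U \<union> V" "v \<in> U \<union> V" "w \<in> U \<union> V" "r u v" "r v w" "u \<noteq> w"
    consider "u \<in> U" "v \<in> U" "w \<in> U" | "u \<in> U" "v \<in> U" "w \<in> V" | "u \<in> U" "v \<in> V" "w \<in> U"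
      | "u \<in> U" "v \<in> V" "w \<in> V" | "u \<in> V" "v \<in> U" "w \<in> U" | "u \<in> V" "v \<in> U" "w \<in> V"
      | "u \<in> V" "v \<in> V" "w \<in> U" | "u \<in> V" "v \<in> V" "w \<in> V" using h by blast
    then show "r u w"
    proof cases
      case 1 then show ?thesis using D2 h by blast
    next
      case 2 then show ?thesis using K4 h by blast
    next
      case 3 then show ?thesis using K3 h sym by blast
    next
      case 4 then show ?thesis using K5 h by blast
    next
      case 5 then show ?thesis using K4[of w v u] h sym by blast
    next
      case 6 then show ?thesis using K6 h sym by blast
    next
      case 7 then show ?thesis using K5[of w v u] h sym by blast
    next
      case 8 then show ?thesis using D1 h by blast
    qed
  qed
qed

section \<open>Exchange for connectivity\<close>

definition edges_in :: "('a \<Rightarrow> 'a \<Rightarrow> bool) \<Rightarrow> 'a set \<Rightarrow> ('a \<times> 'a) set" where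
  "edges_in r S = {(a, b). a \<in> S \<and> b \<in> S \<and> r a b}"

definition conn_on :: "('a \<Rightarrow> 'a \<Rightarrow> bool) \<Rightarrow> 'a set \<Rightarrow> bool" where
  "conn_on r S \<longleftrightarrow> (\<forall>a\<in>S. \<forall>b\<in>S. (a, b) \<in> (edges_in r S)\<^sup>*)"

lemma conn_on_hub:
  assumes sym: "\<And>a b. r a b \<Longrightarrow> r b a" and reach: "\<And>a. a \<in> S \<Longrightarrow> (a, y) \<in> (edges_in r S)\<^sup>*"
  shows "conn_on r S"
proof -
  have "sym (edges_in r S)" unfolding edges_in_def sym_def using sym by auto
  then have "sym ((edges_in r S)\<^sup>*)" by (rule sym_rtrancl)
  then show ?thesis unfolding conn_on_def by (meson reach rtrancl_trans symD)
qed

text \<open>Outside \<open>A\<close> all pairs are linked: the part on the other side is contracted to a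
  single vertex, whose neighbours are those of a vertex with largest neighbourhood.\<close>

definition contract :: "('a \<Rightarrow> 'a \<Rightarrow> bool) \<Rightarrow> 'a set \<Rightarrow> 'a \<Rightarrow> 'a \<Rightarrow> bool" where
  "contract r A a b \<longleftrightarrow> r a b \<or> a \<notin> A \<and> b \<notin> A"

definition top_witness :: "('a \<Rightarrow> 'a \<Rightarrow> bool) \<Rightarrow> 'a set \<Rightarrow> 'a set \<Rightarrow> 'a set \<Rightarrow> bool" where
  "top_witness r A V z \<longleftrightarrow> (V \<noteq> {} \<longrightarrow> (\<exists>t\<in>z. \<forall>y\<in>V. \<forall>a\<in>A. r a y \<longrightarrow> r a t))"

lemma top_witness_mono: "top_witness r A V z \<Longrightarrow> z \<subseteq> z' \<Longrightarrow> top_witness r A V z'"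
  unfolding top_witness_def by (meson subsetD)

text \<open>Take a walk to \<open>t\<close> starting in \<open>U\<close> and stop where it first
  leaves \<open>U\<close>. The next vertex lies in \<open>V\<close>, so by the choice of
  \<open>t\<close> the last vertex in \<open>U\<close> is adjacent to \<open>t\<close> itself.
  Within \<open>z\<close> all pairs are linked by contraction.\<close>

lemma conn_on_contract:
  assumes sym: "\<And>a b. r a b \<Longrightarrow> r b a"
    and UA: "U \<subseteq> A" "V \<inter> A = {}" "z \<subseteq> V" and wit: "top_witness r A V z"
    and conn: "conn_on r (U \<union> V)"
  shows "conn_on (contract r A) (U \<union> z)"
proof (cases "V = {}")
  case True
  then have "edges_in r (U \<union> V) \<subseteq> edges_in (contract r A) (U \<union> z)"
    using UA by (auto simp: edges_in_def contract_def)
  from rtrancl_mono[OF this] True UA conn show ?thesis unfolding conn_on_def by auto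
next
  case False
  then obtain t where t: "t \<in> z" "\<And>y a. y \<in> V \<Longrightarrow> a \<in> U \<Longrightarrow> r a y \<Longrightarrow> r a t"
    using wit UA(1) unfolding top_witness_def by (metis subsetD)
  let ?Q = "edges_in (contract r A) (U \<union> z)"
  have U: "x \<in> U \<longrightarrow> (x, t) \<in> ?Q\<^sup>*" if "(x, t) \<in> (edges_in r (U \<union> V))\<^sup>*" for x
    using that
  proof (induction rule: converse_rtrancl_induct)
    case (step x x')
    show ?case
    proof
      assume x: "x \<in> U"
      have r: "r x x'" "x' \<in> U \<union> V" using step.hyps by (auto simp: edges_in_def)
      show "(x, t) \<in> ?Q\<^sup>*"
      proof (cases "x' \<in> U")
        case True
        then have "(x, x') \<in> ?Q" using x r by (auto simp: edges_in_def contract_def)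
        with step.IH True show ?thesis by (meson converse_rtrancl_into_rtrancl)
      next
        case False
        then have "r x t" using t r x by blast
        then have "(x, t) \<in> ?Q" using x t by (auto simp: edges_in_def contract_def)
        then show ?thesis by blast
      qed
    qed
  qed simp
  show ?thesis
  proof (rule conn_on_hub)
    show "contract r A b a" if "contract r A a b" for a b
      using that sym by (auto simp: contract_def)
    fix a assume "a \<in> U \<union> z"
    then show "(a, t) \<in> ?Q\<^sup>*"
    proof
      assume "a \<in> z"
      then have "(a, t) \<in> ?Q" using t UA by (auto simp: edges_in_def contract_def)
      then show ?thesis by blast
    next
      assume a: "a \<in> U"
      then have "(a, t) \<in> (edges_in r (U \<union> V))\<^sup>*" using conn t UA unfolding conn_on_def by blast
      with U a show ?thesis by blast
    qed
  qed
qed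

text \<open>Vertices of \<open>U\<close> reach \<open>t\<close>: a contracted walk can be redirected
  to \<open>t\<close> at its first exit from \<open>U\<close>. A vertex of \<open>V\<close> follows
  its old walk towards \<open>t\<close>; if that walk enters \<open>U'\<close>, then
  \<open>attach\<close> supplies a neighbour in \<open>U\<close>, from which \<open>t\<close> is
  already known to be reachable.\<close>

lemma conn_on_exchange:
  assumes sym: "\<And>a b. r a b \<Longrightarrow> r b a"
    and UA: "U \<subseteq> A" "V \<inter> A = {}" "z \<subseteq> V" and wit: "top_witness r A V z"
    and conn: "conn_on r (U' \<union> V)" "conn_on (contract r A) (U \<union> z)"
    and attach: "\<And>v u. v \<in> V \<Longrightarrow> u \<in> U' \<Longrightarrow> r u v \<Longrightarrow> \<exists>u\<in>U. r u v"
  shows "conn_on r (U \<union> V)"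
proof (cases "V = {}")
  case True
  then have "edges_in (contract r A) (U \<union> z) \<subseteq> edges_in r (U \<union> V)"
    using UA by (auto simp: edges_in_def contract_def)
  from rtrancl_mono[OF this] True UA conn(2) show ?thesis unfolding conn_on_def by auto
next
  case False
  then obtain t where t: "t \<in> z" "\<And>y a. y \<in> V \<Longrightarrow> a \<in> U \<Longrightarrow> r a y \<Longrightarrow> r a t"
    using wit UA(1) unfolding top_witness_def by (metis subsetD)
  let ?E = "edges_in r (U \<union> V)"
  have U: "x \<in> U \<longrightarrow> (x, t) \<in> ?E\<^sup>*" if "(x, t) \<in> (edges_in (contract r A) (U \<union> z))\<^sup>*" for x
    using that
  proof (induction rule: converse_rtrancl_induct)
    case (step x x')
    show ?case
    proof
      assume x: "x \<in> U"
      have r: "r x x'" "x' \<in> U \<union> z"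
        using step.hyps x UA by (auto simp: edges_in_def contract_def)
      show "(x, t) \<in> ?E\<^sup>*"
      proof (cases "x' \<in> U")
        case True
        then have "(x, x') \<in> ?E" using x r by (auto simp: edges_in_def)
        with step.IH True show ?thesis by (meson converse_rtrancl_into_rtrancl)
      next
        case False
        then have "r x t" using t r x UA by blast
        then have "(x, t) \<in> ?E" using x t UA by (auto simp: edges_in_def)
        then show ?thesis by blast
      qed
    qed
  qed simp
  have U': "(x, t) \<in> ?E\<^sup>*" if "x \<in> U" for x
    using U that t conn(2) unfolding conn_on_def by blast
  have V: "x \<in> V \<longrightarrow> (x, t) \<in> ?E\<^sup>*" if "(x, t) \<in> (edges_in r (U' \<union> V))\<^sup>*" for x
    using that
  proof (induction rule: converse_rtrancl_induct)
    case (step x x')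
    show ?case
    proof
      assume x: "x \<in> V"
      have r: "r x x'" "x' \<in> U' \<union> V" using step.hyps by (auto simp: edges_in_def)
      show "(x, t) \<in> ?E\<^sup>*"
      proof (cases "x' \<in> V")
        case True
        then have "(x, x') \<in> ?E" using x r by (auto simp: edges_in_def)
        with step.IH True show ?thesis by (meson converse_rtrancl_into_rtrancl)
      next
        case False
        then obtain u where u: "u \<in> U" "r u x" using attach[of x x'] r x sym by blast
        then have "(x, u) \<in> ?E" using x sym by (auto simp: edges_in_def)
        with U'[OF u(1)] show ?thesis by (meson converse_rtrancl_into_rtrancl)
      qed
    qed
  qed simp
  show ?thesis
  proof (rule conn_on_hub[OF sym])
    fix a assume "a \<in> U \<union> V"
    then show "(a, t) \<in> ?E\<^sup>*"
      using U' V conn(1) t UA unfolding conn_on_def by blast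
  qed
qed

section \<open>From lists to sets and relations\<close>

abbreviation "col \<equiv> nthd (0::nat)"

definition sym_graph :: "bool list list \<Rightarrow> bool" where
  "sym_graph g \<longleftrightarrow>
     (\<forall>u v. adj g u v \<longrightarrow> adj g v u \<and> u \<noteq> v \<and> u < length g \<and> v < length g)"

lemma nthd_map: "nthd e (map f [0..<n]) v = (if v < n then f v else e)"
  by (simp add: nthd_def)

lemma set_cls: "set (cls g X i) = {v. v < length g \<and> col X v = i}"
  by (auto simp: cls_def)

lemma deg_card: "deg g Y v j = card {u \<in> set (cls g Y j). adj g v u}"
proof -
  have "distinct (filter (adj g v) (cls g Y j))" by (simp add: cls_def)
  from distinct_card[OF this] show ?thesis by (simp add: deg_def)
qed

lemma cluster_ok_iff: "cluster_ok b g Y i \<longleftrightarrow> P3_free (coadj b g) (set (cls g Y i))"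
  by (simp add: cluster_ok_def P3_free_def)

lemma set_grow:
  assumes "set S \<subseteq> set (cls g Y i)"
  shows "set (grow g X Y i S) = set S \<union> edges_in (link g X) (set (cls g Y i)) `` set S"
  using assms unfolding grow_def edges_in_def by auto

lemma set_grow_funpow:
  assumes "u \<in> set (cls g Y i)"
  shows "set ((grow g X Y i ^^ m) [u]) = {v. \<exists>l\<le>m. (u, v) \<in> edges_in (link g X) (set (cls g Y i)) ^^ l}
    \<and> set ((grow g X Y i ^^ m) [u]) \<subseteq> set (cls g Y i)"
proof (induction m)
  case (Suc m)
  let ?E = "edges_in (link g X) (set (cls g Y i))"
  have "set ((grow g X Y i ^^ Suc m) [u]) =
      set ((grow g X Y i ^^ m) [u]) \<union> ?E `` set ((grow g X Y i ^^ m) [u])"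
    using set_grow[OF conjunct2[OF Suc]] by simp
  also have "\<dots> = {v. \<exists>l\<le>Suc m. (u, v) \<in> ?E ^^ l}" (is "?L = ?R")
  proof
    show "?L \<subseteq> ?R"
    proof
      fix v assume "v \<in> ?L"
      then consider "v \<in> set ((grow g X Y i ^^ m) [u])"
        | w where "w \<in> set ((grow g X Y i ^^ m) [u])" "(w, v) \<in> ?E" by blast
      then show "v \<in> ?R"
      proof cases
        case 1
        then show ?thesis using Suc le_SucI by blast
      next
        case 2
        then obtain l where "l \<le> m" "(u, w) \<in> ?E ^^ l" using Suc by blast
        with 2 have "Suc l \<le> Suc m" "(u, v) \<in> ?E ^^ Suc l" by auto
        then show ?thesis by blast
      qed
    qed
    show "?R \<subseteq> ?L"
    proof (clarify del: UnCI)
      fix v l assume l: "l \<le> Suc m" "(u, v) \<in> ?E ^^ l"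
      show "v \<in> ?L"
      proof (cases "l \<le> m")
        case True
        then show ?thesis using Suc l by blast
      next
        case False
        then have "(u, v) \<in> ?E ^^ Suc m" using l le_SucE by blast
        then obtain w where "(u, w) \<in> ?E ^^ m" "(w, v) \<in> ?E" by auto
        then show ?thesis using Suc by blast
      qed
    qed
  qed
  finally have "set ((grow g X Y i ^^ Suc m) [u]) = {v. \<exists>l\<le>Suc m. (u, v) \<in> ?E ^^ l}" .
  moreover have "set (grow g X Y i S) \<subseteq> set (cls g Y i)" for S by (auto simp: grow_def)
  then have "set ((grow g X Y i ^^ Suc m) [u]) \<subseteq> set (cls g Y i)"
    unfolding funpow.simps o_apply .
  ultimately show ?case by (rule conjI)
qed (use assms in auto)

lemma conn_ok_iff: "conn_ok g X Y i \<longleftrightarrow> conn_on (link g X) (set (cls g Y i))"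
proof -
  let ?S = "set (cls g Y i)"
  let ?E = "edges_in (link g X) ?S"
  have sub: "?E \<subseteq> {..<length g} \<times> {..<length g}" by (auto simp: edges_in_def set_cls)
  then have fin: "finite ?E" by (rule finite_subset) simp
  have "card ?E \<le> length g * length g"
    using card_mono[OF _ sub] by (simp add: card_cartesian_product)
  have "(u, v) \<in> ?E\<^sup>* \<longleftrightarrow> (\<exists>l\<le>length g * length g. (u, v) \<in> ?E ^^ l)" for u v
  proof
    assume "(u, v) \<in> ?E\<^sup>*"
    then obtain l where "l \<le> card ?E" "(u, v) \<in> ?E ^^ l"
      using rtrancl_finite_eq_relpow[OF fin] by auto
    then show "\<exists>l\<le>length g * length g. (u, v) \<in> ?E ^^ l"
      using \<open>card ?E \<le> length g * length g\<close> order_trans by blast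
  qed (auto intro: relpow_imp_rtrancl)
  then show ?thesis unfolding conn_ok_def conn_on_def using set_grow_funpow[where g = g and X = X and Y = Y and i = i] by simp
qed

lemma conn_on_cong:
  "(\<And>a b. a \<in> S \<Longrightarrow> b \<in> S \<Longrightarrow> r a b \<longleftrightarrow> r' a b) \<Longrightarrow> conn_on r S \<longleftrightarrow> conn_on r' S"
proof -
  assume "\<And>a b. a \<in> S \<Longrightarrow> b \<in> S \<Longrightarrow> r a b \<longleftrightarrow> r' a b"
  then have "edges_in r S = edges_in r' S" by (auto simp: edges_in_def)
  then show ?thesis by (simp add: conn_on_def)
qed

lemma small_mem:
  assumes "finite S" "card S \<le> m" "S \<subseteq> {..<length g}" "\<And>v. v \<in> S \<Longrightarrow> f v \<in> {1..k}"
  shows "map (\<lambda>v. if v \<in> S then f v else 0) [0..<length g] \<in> set (small k g m)"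
  using assms
proof (induction m arbitrary: S)
  case (Suc m)
  show ?case
  proof (cases "card S \<le> m")
    case True
    with Suc.IH[of S] Suc.prems show ?thesis by simp
  next
    case False
    then obtain s where s: "s \<in> S" by fastforce
    let ?X = "map (\<lambda>v. if v \<in> S - {s} then f v else 0) [0..<length g]"
    have "?X \<in> set (small k g m)" using Suc.prems s by (intro Suc.IH) auto
    moreover have "map (\<lambda>v. if v \<in> S then f v else 0) [0..<length g] = put g ?X s (f s)"
      using s by (auto simp: put_def nthd_map)
    moreover have "s < length g" "f s \<in> {1..k}" using s Suc.prems by auto
    ultimately show ?thesis by (fastforce simp del: upt_Suc)
  qed
qed simp

lemma chain_cut_coadj:
  assumes "chain_cut (adj g) A" shows "chain_cut (coadj b g) A"
proof (cases b)
  case True then show ?thesis using assms by (simp add: chain_cut_def coadj_def)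
next
  case False
  show ?thesis unfolding chain_cut_def
  proof (intro ballI allI impI)
    fix a a' x x'
    assume h: "a \<in> A" "a' \<in> A" "x \<notin> A" "x' \<notin> A" "coadj b g a x" "coadj b g a' x'"
    have "\<not> adj g a x" "\<not> adj g a' x'" using h False by (auto simp: coadj_def)
    then have "\<not> adj g a x' \<or> \<not> adj g a' x" using h assms unfolding chain_cut_def by blast
    \<comment> \<open>Vertices on different sides of the cut are distinct, so across the cut
      \<open>coadj False\<close> is plain non-adjacency.\<close>
    moreover have "a \<noteq> x'" "a' \<noteq> x" using h by auto
    ultimately show "coadj b g a x' \<or> coadj b g a' x" using False by (simp add: coadj_def)
  qed
qed

lemma sym_coadj: "sym_graph g \<Longrightarrow> coadj b g u v \<Longrightarrow> coadj b g v u"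
  unfolding sym_graph_def coadj_def by (auto split: if_splits)

lemma cls_overlay:
  assumes "\<forall>v<length g. col X v \<noteq> 0 \<longleftrightarrow> v \<in> A" "j \<ge> 1"
  shows "set (cls g (overlay g X c) j) = set (cls g X j) \<union> {v. v < length g \<and> v \<notin> A \<and> col c v = j}"
  using assms by (auto simp: set_cls overlay_def nthd_map)

context partition_problem
begin

definition witnesses :: "bool list list \<Rightarrow> nat set \<Rightarrow> nat set \<Rightarrow> nat set \<Rightarrow> bool" where
  "witnesses g A V z \<longleftrightarrow>
     (\<forall>a\<in>A. min d (card {y \<in> z. adj g a y}) = min d (card {y \<in> V. adj g a y})) \<and>
     top_witness (adj g) A V z \<and> (\<forall>b. cluster_witness (coadj b g) A V z)"

text \<open>The bound is \<open>d + 1 + 3 + 3\<close>, for degrees, connectivity, cluster graphs and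
  complements of cluster graphs. Each kind of witness survives enlargement inside \<open>V\<close>,
  so the union serves all four purposes.\<close>

lemma witnesses_exist:
  assumes chain: "chain_cut (adj g) A" and V: "finite V" "V \<inter> A = {}"
  shows "\<exists>z\<subseteq>V. card z \<le> d + 7 \<and> witnesses g A V z"
proof -
  obtain z1 where z1: "z1 \<subseteq> V" "card z1 \<le> d" "\<forall>z'. z1 \<subseteq> z' \<and> z' \<subseteq> V \<longrightarrow>
      (\<forall>a\<in>A. min d (card {y \<in> z'. adj g a y}) = min d (card {y \<in> V. adj g a y}))"
    using chain_cut_truncate[OF chain V, of d] by (elim exE conjE)
  have "\<exists>z2\<subseteq>V. card z2 \<le> 1 \<and> top_witness (adj g) A V z2"
  proof (cases "V = {}")
    case False
    from chain_cut_top[OF chain V(1) False V(2)] obtain t where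
      "t \<in> V" "\<forall>y\<in>V. \<forall>a\<in>A. adj g a y \<longrightarrow> adj g a t" by (elim bexE)
    then show ?thesis by (intro exI[of _ "{t}"]) (simp add: top_witness_def)
  qed (auto simp: top_witness_def intro!: exI[of _ "{}"])
  then obtain z2 where z2: "z2 \<subseteq> V" "card z2 \<le> 1" "top_witness (adj g) A V z2" by (elim exE conjE)
  obtain z3 where z3: "z3 \<subseteq> V" "card z3 \<le> 3" "cluster_witness (coadj True g) A V z3"
    using cluster_witness_exists[OF chain_cut_coadj[OF chain, of True] V] by (elim exE conjE)
  obtain z4 where z4: "z4 \<subseteq> V" "card z4 \<le> 3" "cluster_witness (coadj False g) A V z4"
    using cluster_witness_exists[OF chain_cut_coadj[OF chain, of False] V] by (elim exE conjE)
  let ?z = "z1 \<union> z2 \<union> (z3 \<union> z4)"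
  have "card ?z \<le> card (z1 \<union> z2) + card (z3 \<union> z4)" by (rule card_Un_le)
  moreover have "card (z1 \<union> z2) \<le> card z1 + card z2" "card (z3 \<union> z4) \<le> card z3 + card z4"
    by (rule card_Un_le)+
  ultimately have card: "card ?z \<le> d + 7" using z1(2) z2(2) z3(2) z4(2) by linarith
  have sub: "?z \<subseteq> V" using z1(1) z2(1) z3(1) z4(1) by blast
  have "cluster_witness (coadj b g) A V ?z" for b
    using cluster_witness_mono[OF z3(3), of ?z] cluster_witness_mono[OF z4(3), of ?z]
    by (cases b) auto
  moreover have "top_witness (adj g) A V ?z" by (rule top_witness_mono[OF z2(3)]) auto
  moreover have "\<forall>a\<in>A. min d (card {y \<in> ?z. adj g a y}) = min d (card {y \<in> V. adj g a y})"
    by (rule z1(3)[THEN spec, THEN mp]) (use sub in auto)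
  ultimately show ?thesis using card sub unfolding witnesses_def by (intro exI[of _ ?z] conjI) auto
qed

text \<open>Witness sets chosen separately for the parts are merged into one colouring. The
  \<open>V j\<close> are fibres of \<open>f\<close>, so colouring the union by \<open>f\<close>
  returns exactly the chosen set in each class. The predicate \<open>Q\<close> is kept general
  because both \<open>Z\<close> and \<open>W\<close> are obtained this way.\<close>

lemma tests_extend:
  assumes "\<And>j. j \<in> {1..k} \<Longrightarrow> \<exists>z\<subseteq>V j. card z \<le> d + 7 \<and> Q j z"
    and "\<And>j. V j = {v. v < length g \<and> v \<in> B \<and> f v = j}"
  shows "\<exists>Z\<in>set (tests g). \<forall>j\<in>{1..k}. set (cls g Z j) \<subseteq> V j \<and> Q j (set (cls g Z j))"
proof -
  obtain z where z: "\<And>j. j \<in> {1..k} \<Longrightarrow> z j \<subseteq> V j \<and> card (z j) \<le> d + 7 \<and> Q j (z j)"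
    using assms(1) by metis
  let ?S = "\<Union>j\<in>{1..k}. z j"
  let ?Z = "map (\<lambda>v. if v \<in> ?S then f v else 0) [0..<length g]"
  have V: "z j \<subseteq> {v. v < length g \<and> f v = j}" if "j \<in> {1..k}" for j
    using z[OF that] assms(2) by auto
  have "card ?S \<le> (\<Sum>j\<in>{1..k}. card (z j))" by (rule card_UN_le) simp
  also have "\<dots> \<le> (\<Sum>j\<in>{1..k}. d + 7)" by (rule sum_mono) (use z in auto)
  finally have "card ?S \<le> k * (d + 7)" by simp
  moreover have S: "?S \<subseteq> {..<length g}" using V by fastforce
  moreover have "f v \<in> {1..k}" if v: "v \<in> ?S" for v
  proof -
    from v obtain j where "j \<in> {1..k}" "v \<in> z j" by blast
    with V[of j] show ?thesis by auto
  qed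
  ultimately have "?Z \<in> set (tests g)" by (intro small_mem) (auto intro: finite_subset)
  moreover have "set (cls g ?Z j) = z j" if j: "j \<in> {1..k}" for j
  proof -
    have "v \<in> z j" if v: "v \<in> ?S" "f v = j" for v
    proof -
      from v obtain i where i: "i \<in> {1..k}" "v \<in> z i" by blast
      with V[of i] v have "i = j" by auto
      with i show ?thesis by simp
    qed
    moreover have "v \<in> ?S \<and> f v = j \<and> v < length g" if "v \<in> z j" for v using V[OF j] that j by auto
    ultimately show ?thesis using j by (auto simp: set_cls nthd_map split: if_splits)
  qed
  ultimately show ?thesis using z by (intro bexI[of _ ?Z]) auto
qed

text \<open>\<open>Z\<close> depends only on \<open>c\<close> outside \<open>A\<close>, and
  \<open>W\<close> only on \<open>X'\<close>; neither depends on the replacement \<open>X\<close>.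
  On \<open>A\<close>, the truncated degrees into the far side are those into \<open>Z\<close>; on
  the far side, the truncated degrees into \<open>X\<close> and \<open>X'\<close> agree through
  \<open>W\<close>. Cluster and connectivity constraints follow from the two exchange
  lemmas.\<close>

lemma exchange:
  assumes g: "sym_graph g" and chain: "chain_cut (adj g) A"
    and X': "\<forall>v<length g. col X' v \<noteq> 0 \<longleftrightarrow> v \<in> A" and c: "feas g (overlay g X' c)"
  shows "\<exists>Z\<in>set (tests g). \<exists>W\<in>set (tests g). phi g X' (overlay g X' Z) \<and> in_ok g X' W \<and>
    (\<forall>X. (\<forall>v<length g. col X v \<noteq> 0 \<longleftrightarrow> v \<in> A) \<longrightarrow> (\<forall>v. col X v \<le> k) \<longrightarrow>
       phi g X (overlay g X Z) \<longrightarrow> in_ok g X W \<longrightarrow> feas g (overlay g X c))"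
proof -
  let ?n = "length g"
  define V where "V j = {v. v < ?n \<and> v \<in> - A \<and> col c v = j}" for j
  have sym: "adj g a b \<Longrightarrow> adj g b a" for a b using g by (auto simp: sym_graph_def)
  have finV: "finite (V j)" "V j \<inter> A = {}" for j by (auto simp: V_def)
  obtain Z where Z: "Z \<in> set (tests g)"
    "\<And>j. j \<in> {1..k} \<Longrightarrow> set (cls g Z j) \<subseteq> V j" "\<And>j. j \<in> {1..k} \<Longrightarrow> witnesses g A (V j) (set (cls g Z j))"
    using tests_extend[OF witnesses_exist[OF chain finV] V_def] by blast
  have chain': "chain_cut (adj g) (- A)" using chain_cut_Compl[OF chain] sym by blast
  define U' where "U' j = {v. v < ?n \<and> v \<in> A \<and> col X' v = j}" for j
  \<comment> \<open>Here \<open>d\<close> vertices suffice; the bound is relaxed to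
    \<open>d + 7\<close> so that \<open>W\<close> ranges over the same list of tests as
    \<open>Z\<close>.\<close>
  have "\<exists>w\<subseteq>U' j. card w \<le> d + 7 \<and> (\<forall>a\<in>- A. min d (card {y \<in> w. adj g a y}) = min d (card {y \<in> U' j. adj g a y}))" for j
  proof -
    have "finite (U' j)" "U' j \<inter> - A = {}" by (auto simp: U'_def)
    from chain_cut_truncate[OF chain' this, of d] obtain w where w: "w \<subseteq> U' j" "card w \<le> d"
      "\<forall>z'. w \<subseteq> z' \<and> z' \<subseteq> U' j \<longrightarrow>
        (\<forall>a\<in>- A. min d (card {y \<in> z'. adj g a y}) = min d (card {y \<in> U' j. adj g a y}))"
      by (elim exE conjE)
    from w(3)[THEN spec, THEN mp, of w] w(1,2) show ?thesis by (intro exI[of _ w]) auto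
  qed
  from tests_extend[OF this U'_def] obtain W where W: "W \<in> set (tests g)"
    "\<And>j. j \<in> {1..k} \<Longrightarrow> \<forall>a\<in>- A. min d (card {y \<in> set (cls g W j). adj g a y}) = min d (card {y \<in> U' j. adj g a y})"
    by blast
  have cls_V: "set (cls g (overlay g X c) j) = set (cls g X j) \<union> V j"
    if "\<forall>v<?n. col X v \<noteq> 0 \<longleftrightarrow> v \<in> A" "j \<in> {1..k}" for X j
    using cls_overlay[OF that(1), of j c] that(2) unfolding V_def by auto
  have cls_Z: "set (cls g (overlay g X Z) j) = set (cls g X j) \<union> set (cls g Z j)"
    if "\<forall>v<?n. col X v \<noteq> 0 \<longleftrightarrow> v \<in> A" "j \<in> {1..k}" for X j
    using cls_overlay[OF that(1), of j Z] that(2) Z(2)[OF that(2)] unfolding V_def by (auto simp: set_cls)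
  have cls_A: "set (cls g X j) \<subseteq> A" if "\<forall>v<?n. col X v \<noteq> 0 \<longleftrightarrow> v \<in> A" "j \<in> {1..k}" for X j
    using that by (auto simp: set_cls)
  have deg_Un: "card {u \<in> set (cls g X j) \<union> z. adj g v u} =
      card {u \<in> set (cls g X j). adj g v u} + card {u \<in> z. adj g v u}"
    if "\<forall>v<?n. col X v \<noteq> 0 \<longleftrightarrow> v \<in> A" "j \<in> {1..k}" "z \<subseteq> V j" for X j z v
  proof -
    have "{u \<in> set (cls g X j) \<union> z. adj g v u} = {u \<in> set (cls g X j). adj g v u} \<union> {u \<in> z. adj g v u}"
      by auto
    moreover have "finite z" using that finV finite_subset by blast
    ultimately show ?thesis
      using cls_A[OF that(1,2)] that(3) finV(2)[of j] by (subst card_Un_disjoint[symmetric]) auto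
  qed
  have deg_V: "deg g (overlay g X c) v j = deg g X v j + card {u \<in> V j. adj g v u}"
    if "\<forall>v<?n. col X v \<noteq> 0 \<longleftrightarrow> v \<in> A" "j \<in> {1..k}" for X j v
    unfolding deg_card cls_V[OF that] by (rule deg_Un[OF that]) simp
  have deg_Z: "deg g (overlay g X Z) v j = deg g X v j + card {u \<in> set (cls g Z j). adj g v u}"
    if "\<forall>v<?n. col X v \<noteq> 0 \<longleftrightarrow> v \<in> A" "j \<in> {1..k}" for X j v
    unfolding deg_card cls_Z[OF that] by (rule deg_Un[OF that Z(2)[OF that(2)]])
  have min_add: "min d (a + b) = min d (a + b')" if "min d b = min d b'" for a b b' :: nat
    using that by linarith
  have deg_VZ: "min d (deg g (overlay g X c) v j) = min d (deg g (overlay g X Z) v j)"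
    if "\<forall>v<?n. col X v \<noteq> 0 \<longleftrightarrow> v \<in> A" "j \<in> {1..k}" "v \<in> A" for X j v
    unfolding deg_V[OF that(1,2)] deg_Z[OF that(1,2)]
    by (rule min_add) (use Z(3)[OF that(2)] that(3) in \<open>simp add: witnesses_def\<close>)
  have U'_cls: "U' j = set (cls g X' j)" if "j \<in> {1..k}" for j
    using X' that by (auto simp: U'_def set_cls)
  have full_X': "col (overlay g X' c) v \<in> {1..k}" if "v < ?n" for v
    using c that by (auto simp: feas_def)
  have phiF: "phi g (overlay g X' c) (overlay g X' c)" using c by (auto simp: feas_def)
  \<comment> \<open>With no vertex uncoloured, nothing is contracted and \<open>link\<close> is
    adjacency. For a colouring of exactly the vertices in \<open>A\<close>, uncoloured means outside
    \<open>A\<close>, and \<open>link\<close> is the contracted relation.\<close>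
  have link_full: "conn_on (link g (overlay g X c)) S \<longleftrightarrow> conn_on (adj g) S"
    if "S \<subseteq> {..<?n}" "\<forall>v<?n. col (overlay g X c) v \<in> {1..k}" for X S
    by (rule conn_on_cong) (use that in \<open>fastforce simp: link_def\<close>)
  have link_part: "conn_on (link g X) S \<longleftrightarrow> conn_on (contract (adj g) A) S"
    if "S \<subseteq> {..<?n}" "\<forall>v<?n. col X v \<noteq> 0 \<longleftrightarrow> v \<in> A" for X S
    by (rule conn_on_cong) (use that in \<open>fastforce simp: link_def contract_def\<close>)
  have cls_n: "set (cls g Y j) \<subseteq> {..<?n}" for Y j by (auto simp: set_cls)
  have "phi g X' (overlay g X' Z)"
    unfolding phi_def
  proof (intro conjI ballI)
    show "deg_ok g X' (overlay g X' Z)"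
      unfolding deg_ok_def
    proof (intro ballI impI)
      fix v i j assume v: "v \<in> set [0..<?n]" "i \<in> {1..k}" "col X' v = i" "j \<in> {1..k}"
      then have A: "v \<in> A" using X' by auto
      have "col (overlay g X' c) v = i" using v by (auto simp: overlay_def nthd_map)
      then have "deg g (overlay g X' c) v j \<in> D i j"
        using phiF v unfolding phi_def deg_ok_def by blast
      then show "deg g (overlay g X' Z) v j \<in> D i j"
        using D_min[OF v(2,4) deg_VZ[OF X' v(4) A]] by simp
    qed
    have cl: "cluster_ok b g (overlay g X' Z) i"
      if "i \<in> {1..k}" "cluster_ok b g (overlay g X' c) i" for b i
      using that(2) unfolding cluster_ok_iff cls_V[OF X' that(1)] cls_Z[OF X' that(1)]
      by (rule P3_free_subset) (use Z(2)[OF that(1)] in auto)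
    show "cluster_ok True g (overlay g X' Z) i" if "i \<in> CL" for i
      using cl[of i True] that fin phiF unfolding phi_def by blast
    show "cluster_ok False g (overlay g X' Z) i" if "i \<in> CO" for i
      using cl[of i False] that fin phiF unfolding phi_def by blast
    fix i assume i: "i \<in> C"
    then have i1: "i \<in> {1..k}" using fin by auto
    have "conn_on (adj g) (set (cls g X' i) \<union> V i)"
      using phiF i full_X' link_full[OF cls_n, of X' "overlay g X' c" i] cls_V[OF X' i1]
      unfolding phi_def conn_ok_iff by auto
    then have "conn_on (contract (adj g) A) (set (cls g X' i) \<union> set (cls g Z i))"
      using Z(2,3)[OF i1] by (intro conn_on_contract[OF sym cls_A[OF X' i1] finV(2)]) (auto simp: witnesses_def)
    then show "conn_ok g X' (overlay g X' Z) i"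
      unfolding conn_ok_iff link_part[OF cls_n X'] unfolding cls_Z[OF X' i1] .
  qed
  moreover have "in_ok g X' W"
    unfolding in_ok_def
  proof (intro ballI impI)
    fix v j assume v: "v \<in> set [0..<?n]" "col X' v = 0" "j \<in> {1..k}"
    then have "v \<in> - A" using X' by auto
    then show "min d (deg g X' v j) = min d (deg g W v j)"
      using W(2)[OF v(3)] unfolding deg_card U'_cls[OF v(3)] by simp
  qed
  moreover have "feas g (overlay g X c)"
    if X: "\<forall>v<?n. col X v \<noteq> 0 \<longleftrightarrow> v \<in> A" and le: "\<forall>v. col X v \<le> k"
      and p: "phi g X (overlay g X Z)" and q: "in_ok g X W" for X
  proof -
    have full: "col (overlay g X c) v \<in> {1..k}" if "v < ?n" for v
    proof (cases "v \<in> A")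
      case True
      then have "col X v \<noteq> 0" using X that by blast
      then show ?thesis using le that by (simp add: overlay_def nthd_map Suc_le_eq)
    next
      case False
      then have "col X v = 0" "col X' v = 0" using X X' that by auto
      then show ?thesis using full_X'[OF that] that by (simp add: overlay_def nthd_map)
    qed
    have in_eq: "min d (deg g X v j) = min d (deg g X' v j)"
      if "v < ?n" "v \<notin> A" "j \<in> {1..k}" for v j
    proof -
      have "min d (deg g X v j) = min d (deg g W v j)"
        using q that X unfolding in_ok_def by auto
      also have "\<dots> = min d (deg g X' v j)"
        using W(2)[OF that(3)] that(2) unfolding deg_card U'_cls[OF that(3)] by simp
      finally show ?thesis .
    qed
    have "phi g (overlay g X c) (overlay g X c)"
      unfolding phi_def
    proof (intro conjI ballI)
      show "deg_ok g (overlay g X c) (overlay g X c)"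
        unfolding deg_ok_def
      proof (intro ballI impI)
        fix v i j assume v: "v \<in> set [0..<?n]" "i \<in> {1..k}" "col (overlay g X c) v = i" "j \<in> {1..k}"
        show "deg g (overlay g X c) v j \<in> D i j"
        proof (cases "v \<in> A")
          case True
          then have "col X v \<noteq> 0" using v X by auto
          then have "col X v = i" using v by (simp add: overlay_def nthd_map)
          then have "deg g (overlay g X Z) v j \<in> D i j"
            using p v unfolding phi_def deg_ok_def by blast
          then show ?thesis using D_min[OF v(2,4) deg_VZ[OF X v(4) True]] by simp
        next
          case False
          then have "col X v = 0" "col X' v = 0" using v X X' by auto
          then have "col (overlay g X' c) v = i" using v by (simp add: overlay_def nthd_map)
          then have "deg g (overlay g X' c) v j \<in> D i j"
            using phiF v unfolding phi_def deg_ok_def by blast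
          \<comment> \<open>Both degrees contain the same number of neighbours from
            \<open>V j\<close>; only the summands for \<open>X\<close> and \<open>X'\<close> differ,
            and their truncations agree. The sums are commuted to fit
            \<open>min_add\<close>.\<close>
          moreover have "min d (deg g (overlay g X c) v j) = min d (deg g (overlay g X' c) v j)"
            unfolding deg_V[OF X v(4)] deg_V[OF X' v(4)] add.commute[of "deg _ _ _ _"]
            by (rule min_add) (use in_eq False v in auto)
          ultimately show ?thesis using D_min[OF v(2,4)] by blast
        qed
      qed
      have cl: "cluster_ok b g (overlay g X c) i"
        if "i \<in> {1..k}" "cluster_ok b g (overlay g X' c) i" "cluster_ok b g (overlay g X Z) i" for b i
        using that(2,3) unfolding cluster_ok_iff cls_V[OF X' that(1)] cls_Z[OF X that(1)] cls_V[OF X that(1)]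
        using Z(2,3)[OF that(1)]
        by (intro P3_free_exchange[OF sym_coadj[OF g] cls_A[OF X that(1)] finV(2) Z(2)[OF that(1)]])
          (auto simp: witnesses_def intro: P3_free_subset)
      show "cluster_ok True g (overlay g X c) i" if "i \<in> CL" for i
        using cl[of i True] that fin phiF p unfolding phi_def by blast
      show "cluster_ok False g (overlay g X c) i" if "i \<in> CO" for i
        using cl[of i False] that fin phiF p unfolding phi_def by blast
      fix i assume i: "i \<in> C"
      then have i1: "i \<in> {1..k}" using fin by auto
      have "conn_on (adj g) (set (cls g X' i) \<union> V i)"
        using phiF i full_X' link_full[OF cls_n, of X' "overlay g X' c" i] cls_V[OF X' i1]
        unfolding phi_def conn_ok_iff by auto
      moreover have "conn_on (contract (adj g) A) (set (cls g X i) \<union> set (cls g Z i))"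
        using p i link_part[OF cls_n X] cls_Z[OF X i1] unfolding phi_def conn_ok_iff by auto
      moreover have "\<exists>u\<in>set (cls g X i). adj g u v"
        if "v \<in> V i" "u \<in> set (cls g X' i)" "adj g u v" for u v
      proof -
        have "min d (deg g X v i) = min d (deg g X' v i)"
          using that(1) i1 by (intro in_eq) (auto simp: V_def)
        moreover have "u \<in> {u \<in> set (cls g X' i). adj g v u}" using that sym by blast
        then have "deg g X' v i \<noteq> 0" unfolding deg_card by (auto simp: card_eq_0_iff)
        \<comment> \<open>Positivity of \<open>d\<close> is essential here: degree 0 and positive
          degree have different truncations.\<close>
        ultimately have "deg g X v i \<noteq> 0" using d by auto
        then have "{u \<in> set (cls g X i). adj g v u} \<noteq> {}" unfolding deg_card by force
        then show ?thesis using sym by blast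
      qed
      ultimately have "conn_on (adj g) (set (cls g X i) \<union> V i)"
        using Z(2,3)[OF i1] by (intro conn_on_exchange[where U' = "set (cls g X' i)",
          OF sym cls_A[OF X i1] finV(2)]) (auto simp: witnesses_def)
      then show "conn_ok g (overlay g X c) (overlay g X c) i"
        using link_full[OF cls_n, of X "overlay g X c" i] full cls_V[OF X i1]
        unfolding conn_ok_iff by auto
    qed
    with full show ?thesis by (auto simp: feas_def)
  qed
  ultimately show ?thesis using Z(1) W(1) by blast
qed

end

section \<open>Completeness of the tables\<close>

lemma col_overlay:
  "col (overlay g X c) v = (if v < length g then if col X v = 0 then col c v else col X v else 0)"
  by (simp add: overlay_def nthd_map)

lemma length_overlay [simp]: "length (overlay g X c) = length g"
  by (simp add: overlay_def)

lemma col_ext: "length X = length Y \<Longrightarrow> (\<And>v. v < length Y \<Longrightarrow> col X v = col Y v) \<Longrightarrow> X = Y"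
  by (rule nth_equalityI) (auto simp: nthd_def)

lemma length_cls: "length (cls g X i) = card (set (cls g X i))"
  by (rule distinct_card[symmetric]) (simp add: cls_def)

context partition_problem
begin

definition part :: "bool list list \<Rightarrow> nat set \<Rightarrow> nat list \<Rightarrow> bool" where
  "part g A X \<longleftrightarrow> length X = length g \<and> (\<forall>v. col X v \<le> k) \<and> (\<forall>v<length g. col X v \<noteq> 0 \<longleftrightarrow> v \<in> A)"

text \<open>The invariant of the dynamic programming, phrased through complete solutions: any
  feasible colouring can be changed on \<open>A\<close> to some member of \<open>S\<close> without
  losing feasibility or quality. This avoids defining subproblems and their optimal values.\<close>

definition covers :: "bool list list \<Rightarrow> nat set \<Rightarrow> nat list list \<Rightarrow> bool" where
  "covers g A S \<longleftrightarrow> (\<forall>X\<in>set S. part g A X) \<and> (\<forall>c. length c = length g \<longrightarrow> feas g c \<longrightarrow>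
     (\<exists>X\<in>set S. feas g (overlay g X c) \<and> no_worse g (overlay g X c) c))"

lemma no_worse_refl: "no_worse g X X"
  by (simp add: no_worse_def)

lemma no_worse_trans: "no_worse g X Y \<Longrightarrow> no_worse g Y Z \<Longrightarrow> no_worse g X Z"
  by (auto simp: no_worse_def)

lemma no_worse_total: "no_worse g X Y \<or> no_worse g Y X"
  unfolding no_worse_def by (cases R) auto

text \<open>The objective is additive over the cut, and the vertices of class 1 outside
  \<open>A\<close> contribute the same number to both colourings.\<close>

lemma no_worse_overlay:
  assumes "part g A X" "part g A X'" "no_worse g X X'"
  shows "no_worse g (overlay g X c) (overlay g X' c)"
proof -
  have "length (cls g (overlay g Y c) 1) = length (cls g Y 1) +
      card {v. v < length g \<and> v \<notin> A \<and> col c v = 1}" if "part g A Y" for Y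
  proof -
    have Y: "\<forall>v<length g. col Y v \<noteq> 0 \<longleftrightarrow> v \<in> A" using that by (simp add: part_def)
    have "set (cls g Y 1) \<inter> {v. v < length g \<and> v \<notin> A \<and> col c v = 1} = {}"
      using Y by (auto simp: set_cls)
    then show ?thesis unfolding length_cls cls_overlay[OF Y order_refl]
      by (intro card_Un_disjoint) auto
  qed
  with assms show ?thesis by (simp add: no_worse_def)
qed

lemma best_exists:
  assumes "S \<noteq> []" shows "\<exists>X\<in>set (best g S). X \<in> set S \<and> (\<forall>X'\<in>set S. no_worse g X X')"
proof -
  have "\<exists>X\<in>set S. \<forall>X'\<in>set S. no_worse g X X'"
    using assms
  proof (induction S)
    case (Cons Y S)
    show ?case
    proof (cases "S = []")
      case True
      then show ?thesis by (simp add: no_worse_refl)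
    next
      case False
      then obtain X where X: "X \<in> set S" "\<forall>X'\<in>set S. no_worse g X X'" using Cons by auto
      from no_worse_total[of g X Y] show ?thesis
      proof
        assume "no_worse g X Y"
        with X show ?thesis by (intro bexI[of _ X]) auto
      next
        assume Y: "no_worse g Y X"
        with X have "\<forall>X'\<in>set S. no_worse g Y X'" using no_worse_trans by blast
        then show ?thesis by (intro bexI[of _ Y]) (auto simp: no_worse_refl)
      qed
    qed
  qed simp
  then have ne: "filter (\<lambda>X. \<forall>X'\<in>set S. no_worse g X X') S \<noteq> []" by (simp add: filter_empty_conv)
  then have "hd (filter (\<lambda>X. \<forall>X'\<in>set S. no_worse g X X') S) \<in> set (filter (\<lambda>X. \<forall>X'\<in>set S. no_worse g X X') S)"
    by (rule hd_in_set)
  with ne show ?thesis unfolding best_def firsts_def by auto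
qed

lemma best_mem: "X \<in> set (best g S) \<Longrightarrow> X \<in> set S \<and> (\<forall>X'\<in>set S. no_worse g X X')"
  using set_firsts unfolding best_def by fastforce

text \<open>A solution covered by \<open>X'\<close> determines a pair \<open>(Z, W)\<close> that
  \<open>X'\<close> passes. The candidate kept for this pair may replace \<open>X'\<close>, and it
  is no worse because \<open>X'\<close> was among its competitors.\<close>

lemma covers_reduce:
  assumes g: "sym_graph g" and chain: "chain_cut (adj g) A" and S: "covers g A S"
  shows "covers g A (reduce g S)"
  unfolding covers_def
proof (intro conjI ballI allI impI)
  show "part g A X" if "X \<in> set (reduce g S)" for X
    using that set_reduce S unfolding covers_def by blast
  fix c assume c: "length c = length g" "feas g c"
  then obtain X' where X': "X' \<in> set S" "feas g (overlay g X' c)" "no_worse g (overlay g X' c) c"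
    using S unfolding covers_def by blast
  have partX': "part g A X'" using S X' unfolding covers_def by blast
  then have "\<forall>v<length g. col X' v \<noteq> 0 \<longleftrightarrow> v \<in> A" by (simp add: part_def)
  from exchange[OF g chain this X'(2)] obtain Z W where
    ZW: "Z \<in> set (tests g)" "W \<in> set (tests g)" "phi g X' (overlay g X' Z)" "in_ok g X' W"
    and ex: "\<And>X. part g A X \<Longrightarrow> phi g X (overlay g X Z) \<Longrightarrow> in_ok g X W \<Longrightarrow> feas g (overlay g X c)"
    unfolding part_def by blast
  let ?F = "filter (\<lambda>X. phi g X (overlay g X Z) \<and> in_ok g X W) S"
  have "X' \<in> set ?F" using X' ZW by simp
  then have "?F \<noteq> []" by (metis empty_iff empty_set)
  then obtain X where X: "X \<in> set (best g ?F)" "X \<in> set ?F" "\<forall>X'\<in>set ?F. no_worse g X X'"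
    using best_exists by blast
  have "X \<in> set (reduce g S)" using X ZW unfolding reduce_def by auto
  moreover have partX: "part g A X" using X(2) S unfolding covers_def by auto
  then have "feas g (overlay g X c)" using X(2) by (intro ex) auto
  moreover have "no_worse g (overlay g X c) c"
    using no_worse_overlay[OF partX partX'] X(3) \<open>X' \<in> set ?F\<close> X'(3) no_worse_trans by blast
  ultimately show "\<exists>X\<in>set (reduce g S). feas g (overlay g X c) \<and> no_worse g (overlay g X c) c" by blast
qed

lemma set_joins: "set (joins g S S') = (\<lambda>(X, X'). overlay g X X') ` (set S \<times> set S')"
  unfolding joins_def by auto

text \<open>The solution is first changed on \<open>A\<close>, and the resulting solution is then
  changed on \<open>B\<close>. Since the sides are disjoint, the outcome equals one overlay by the
  joined colouring.\<close>

lemma covers_joins: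
  assumes "covers g A S" "covers g B S'" "A \<inter> B = {}"
  shows "covers g (A \<union> B) (joins g S S')"
  unfolding covers_def
proof (intro conjI ballI allI impI)
  fix Y assume "Y \<in> set (joins g S S')"
  then obtain X X' where Y: "Y = overlay g X X'" "X \<in> set S" "X' \<in> set S'"
    unfolding set_joins by auto
  then have "part g A X" "part g B X'" using assms(1,2) unfolding covers_def by blast+
  with Y(1)
  show "part g (A \<union> B) Y" by (auto simp: part_def col_overlay)
next
  fix c assume c: "length c = length g" "feas g c"
  then obtain X where X: "X \<in> set S" "part g A X" "feas g (overlay g X c)" "no_worse g (overlay g X c) c"
    using assms(1) unfolding covers_def by blast
  then obtain X' where X': "X' \<in> set S'" "part g B X'" "feas g (overlay g X' (overlay g X c))"
    "no_worse g (overlay g X' (overlay g X c)) (overlay g X c)"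
    using assms(2) length_overlay unfolding covers_def by blast
  have dis: "col X v = 0 \<or> col X' v = 0" if "v < length g" for v
    using X(2) X'(2) assms(3) that unfolding part_def by blast
  have eq: "overlay g (overlay g X X') c = overlay g X' (overlay g X c)"
  proof (rule col_ext)
    fix v assume "v < length (overlay g X' (overlay g X c))"
    then show "col (overlay g (overlay g X X') c) v = col (overlay g X' (overlay g X c)) v"
      using dis[of v] by (auto simp: col_overlay)
  qed simp
  show "\<exists>Y\<in>set (joins g S S'). feas g (overlay g Y c) \<and> no_worse g (overlay g Y c) c"
  proof (intro bexI conjI)
    show "feas g (overlay g (overlay g X X') c)" using X' eq by simp
    show "no_worse g (overlay g (overlay g X X') c) c"
      using no_worse_trans[OF X'(4) X(4)] eq by simp
    show "overlay g X X' \<in> set (joins g S S')" using X X' by (auto simp: set_joins)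
  qed
qed

lemma covers_cong: "covers g A S \<Longrightarrow> set S = set S' \<Longrightarrow> covers g A S'"
  by (simp add: covers_def)

lemma covers_starts:
  assumes "{v. v < length g \<and> col l v = x} = {v}"
  shows "covers g {v} (starts g l x)"
proof -
  have v: "v < length g" using assms by auto
  have nil: "col [] u = 0" for u by (simp add: nthd_def)
  have set: "set (starts g l x) = put g [] v ` {1..k}"
    using assms unfolding starts_of_def by (auto simp del: upt_Suc)
  have col: "col (put g [] v i) u = (if u = v then i else 0)" if "u < length g" for u i
    using that by (simp add: put_def nthd_map nthd_def)
  show ?thesis unfolding covers_def set
  proof (intro conjI ballI allI impI)
    show "part g {v} X" if "X \<in> put g [] v ` {1..k}" for X
      using that nil by (auto simp: part_def put_def nthd_map split: if_splits)
    fix c assume c: "length c = length g" "feas g c"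
    then have "col c v \<in> {1..k}" using v by (auto simp: feas_def)
    moreover have "overlay g (put g [] v (col c v)) c = c"
      by (rule col_ext) (use c in \<open>auto simp: col_overlay col\<close>)
    ultimately show "\<exists>X\<in>put g [] v ` {1..k}. feas g (overlay g X c) \<and> no_worse g (overlay g X c) c"
      using c no_worse_refl by (intro bexI[of _ "put g [] v (col c v)"]) auto
  qed
qed

end

section \<open>Trees\<close>

definition branch :: "('a \<times> 'a) set \<Rightarrow> 'a \<Rightarrow> 'a \<Rightarrow> 'a set" where
  "branch E x y = {z. (x, z) \<in> (E - {(x, y), (y, x)})\<^sup>*}"

text \<open>Acyclicity enters in the form that every edge is a bridge: deleting an edge separates
  its ends. The set \<open>branch E x y\<close> is the component of \<open>x\<close> after deleting
  the edge to \<open>y\<close>.\<close>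

locale tree_edges =
  fixes E :: "('a \<times> 'a) set"
  assumes finE: "finite E" and symE: "(x, y) \<in> E \<Longrightarrow> (y, x) \<in> E" and irreflE: "(x, x) \<notin> E"
    and bridge: "(x, y) \<in> E \<Longrightarrow> y \<notin> branch E x y"
begin

definition away :: "'a \<Rightarrow> ('a \<times> 'a) set" where
  "away x = {(a, b) \<in> E. a \<noteq> x \<and> b \<noteq> x}"

lemma sym_away: "(a, b) \<in> (away x)\<^sup>* \<Longrightarrow> (b, a) \<in> (away x)\<^sup>*"
proof -
  have "sym (away x)" using symE by (auto simp: sym_def away_def)
  then show "(a, b) \<in> (away x)\<^sup>* \<Longrightarrow> (b, a) \<in> (away x)\<^sup>*" by (meson sym_rtrancl symD)
qed

text \<open>A walk from \<open>z\<close> that avoids the edge to \<open>x\<close> can never reach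
  \<open>x\<close>, because that edge is a bridge. Thus the branches at all neighbours of
  \<open>x\<close> become components of one and the same forest, the tree without
  \<open>x\<close>.\<close>

lemma branch_away:
  assumes "(z, x) \<in> E" shows "branch E z x = {t. (z, t) \<in> (away x)\<^sup>*}"
proof (intro equalityI subsetI)
  fix t assume "t \<in> branch E z x"
  then have "(z, t) \<in> (E - {(z, x), (x, z)})\<^sup>*" by (simp add: branch_def)
  then have "(z, t) \<in> (away x)\<^sup>*"
  proof (induction rule: rtrancl_induct)
    case (step s t)
    have "s \<in> branch E z x" "t \<in> branch E z x"
      using step.hyps(1) rtrancl_into_rtrancl[OF step.hyps] by (simp_all add: branch_def)
    then have "s \<noteq> x" "t \<noteq> x" using bridge[OF assms] by auto
    then have "(s, t) \<in> away x" using step.hyps by (auto simp: away_def)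
    with step.IH show ?case by (rule rtrancl_into_rtrancl)
  qed simp
  then show "t \<in> {t. (z, t) \<in> (away x)\<^sup>*}" by simp
next
  fix t assume "t \<in> {t. (z, t) \<in> (away x)\<^sup>*}"
  moreover have "away x \<subseteq> E - {(z, x), (x, z)}" by (auto simp: away_def)
  ultimately show "t \<in> branch E z x" unfolding branch_def using rtrancl_mono by blast
qed

lemma branch_unfold:
  assumes "(x, y) \<in> E"
  shows "branch E x y = insert x (\<Union>z\<in>{z. (x, z) \<in> E \<and> z \<noteq> y}. branch E z x)"
proof (intro equalityI subsetI)
  fix t assume "t \<in> branch E x y"
  then have "(x, t) \<in> (E - {(x, y), (y, x)})\<^sup>*" by (simp add: branch_def)
  then show "t \<in> insert x (\<Union>z\<in>{z. (x, z) \<in> E \<and> z \<noteq> y}. branch E z x)"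
  proof (induction rule: rtrancl_induct)
    case (step s t)
    show ?case
    proof (cases "t = x")
      case False
      show ?thesis
      proof (cases "s = x")
        case True
        then have "(x, t) \<in> E \<and> t \<noteq> y" "t \<in> branch E t x"
          using step.hyps by (auto simp: branch_def)
        then show ?thesis by blast
      next
        case s: False
        with step.IH obtain z where z: "(x, z) \<in> E" "z \<noteq> y" "s \<in> branch E z x" by blast
        have "(s, t) \<in> away x" using step.hyps s False by (auto simp: away_def)
        then have "t \<in> branch E z x"
          using z(3) unfolding branch_away[OF symE[OF z(1)]] by auto
        with z show ?thesis by blast
      qed
    qed simp
  qed simp
next
  fix t assume "t \<in> insert x (\<Union>z\<in>{z. (x, z) \<in> E \<and> z \<noteq> y}. branch E z x)"
  then consider "t = x" | z where "(x, z) \<in> E" "z \<noteq> y" "t \<in> branch E z x" by blast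
  then show "t \<in> branch E x y"
  proof cases
    case 2
    have "(x, z) \<in> E - {(x, y), (y, x)}" using 2 assms irreflE by auto
    moreover have "away x \<subseteq> E - {(x, y), (y, x)}" by (auto simp: away_def)
    then have "(z, t) \<in> (E - {(x, y), (y, x)})\<^sup>*"
      using 2 unfolding branch_away[OF symE[OF 2(1)]] using rtrancl_mono by blast
    ultimately show ?thesis unfolding branch_def by (simp add: converse_rtrancl_into_rtrancl)
  qed (simp add: branch_def)
qed

text \<open>A common vertex gives a walk from \<open>z\<close> to \<open>z'\<close> that avoids
  \<open>x\<close>; continued by the edge from \<open>z'\<close> to \<open>x\<close>, it bypasses
  the bridge between \<open>z\<close> and \<open>x\<close>.\<close>

lemma branch_disjoint:
  assumes "(x, z) \<in> E" "(x, z') \<in> E" "z \<noteq> z'"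
  shows "branch E z x \<inter> branch E z' x = {}"
proof (rule ccontr)
  assume "branch E z x \<inter> branch E z' x \<noteq> {}"
  then obtain t where "(z, t) \<in> (away x)\<^sup>*" "(z', t) \<in> (away x)\<^sup>*"
    using branch_away[OF symE[OF assms(1)]] branch_away[OF symE[OF assms(2)]] by blast
  then have "z' \<in> branch E z x"
    unfolding branch_away[OF symE[OF assms(1)]] using sym_away by (auto intro: rtrancl_trans)
  moreover have "(z', x) \<in> E - {(z, x), (x, z)}" using assms symE irreflE by auto
  ultimately have "x \<in> branch E z x" unfolding branch_def by (auto intro: rtrancl_into_rtrancl)
  with bridge symE assms show False by blast
qed

lemma branch_opposite:
  assumes "(x, y) \<in> E" shows "branch E x y \<inter> branch E y x = {}"
proof (rule ccontr)
  assume "branch E x y \<inter> branch E y x \<noteq> {}"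
  then obtain t where t: "(x, t) \<in> (E - {(x, y), (y, x)})\<^sup>*" "(y, t) \<in> (E - {(x, y), (y, x)})\<^sup>*"
    by (auto simp: branch_def insert_commute)
  have "sym (E - {(x, y), (y, x)})" using symE by (auto simp: sym_def)
  then have "(t, y) \<in> (E - {(x, y), (y, x)})\<^sup>*" using t(2) by (meson sym_rtrancl symD)
  with t(1) have "y \<in> branch E x y" unfolding branch_def by (auto intro: rtrancl_trans)
  with bridge assms show False by blast
qed

lemma branch_cover:
  assumes "(x, y) \<in> E" "(x, v) \<in> E\<^sup>*" shows "v \<in> branch E x y \<union> branch E y x"
  using assms(2)
proof (induction rule: rtrancl_induct)
  case (step v w)
  show ?case
  proof (cases "(v, w) \<in> {(x, y), (y, x)}")
    case True
    then show ?thesis by (auto simp: branch_def)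
  next
    case False
    then have "(v, w) \<in> E - {(x, y), (y, x)}" "(v, w) \<in> E - {(y, x), (x, y)}" using step.hyps by auto
    then show ?thesis using step.IH unfolding branch_def by (auto intro: rtrancl_into_rtrancl)
  qed
qed (simp add: branch_def)

lemma finite_branch: "finite (branch E x y)"
proof -
  have "branch E x y \<subseteq> insert x (snd ` E)"
  proof
    fix t assume "t \<in> branch E x y"
    then have "(x, t) \<in> (E - {(x, y), (y, x)})\<^sup>*" by (simp add: branch_def)
    then show "t \<in> insert x (snd ` E)" by (cases rule: rtranclE) force+
  qed
  then show ?thesis using finE finite_subset by blast
qed

lemma card_branch:
  assumes "(x, y) \<in> E" "(x, z) \<in> E" "z \<noteq> y"
  shows "card (branch E z x) < card (branch E x y)"
proof (rule psubset_card_mono[OF finite_branch])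
  have "x \<notin> branch E z x" using bridge symE assms by blast
  moreover have "branch E z x \<subseteq> branch E x y" "x \<in> branch E x y"
    using branch_unfold[OF assms(1)] assms by auto
  ultimately show "branch E z x \<subset> branch E x y" by auto
qed

end

section \<open>Correctness of the algorithm\<close>

text \<open>What correctness needs to know about the decoded lists, independent of the graph
  library. Degree at most 1 marks a leaf, which carries exactly one graph vertex; this includes the
  single vertex of a trivial tree.\<close>

locale decomposed_instance = partition_problem + tree_edges "{(x, y). adj t x y}"
  for g t :: "bool list list" and l :: "nat list" +
  assumes g: "sym_graph g"
    and t: "adj t x y \<Longrightarrow> x < length t \<and> y < length t"
    and conn: "x < length t \<Longrightarrow> y < length t \<Longrightarrow> (x, y) \<in> {(x, y). adj t x y}\<^sup>*"
    and ne: "length t > 0"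
    and l: "v < length g \<Longrightarrow> col l v < length t"
    and degree: "x < length t \<Longrightarrow>
      card {y. adj t x y} \<le> 1 \<and> (\<exists>v. {v. v < length g \<and> col l v = x} = {v}) \<or>
      card {y. adj t x y} = 3 \<and> {v. v < length g \<and> col l v = x} = {}"
    and chain: "adj t x y \<Longrightarrow>
      chain_cut (adj g) {v. v < length g \<and> col l v \<in> branch {(x, y). adj t x y} x y}"
begin

abbreviation "E \<equiv> {(x, y). adj t x y}"
abbreviation "tside x y \<equiv> {v. v < length g \<and> col l v \<in> branch E x y}"
abbreviation "table r \<equiv> (step g t l ^^ r) []"

lemma finite_nbrs: "finite {y. adj t x y}"
  by (rule finite_subset[of _ "{..<length t}"]) (use t in auto)

lemma set_cands:
  "set (cands g t l T x y) = set (starts g l x) \<union>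
    (\<Union>(a, b) \<in> {(a, b). adj t x a \<and> adj t x b \<and> a \<noteq> y \<and> b \<noteq> y \<and> a < b}.
       set (joins g (entry T a x) (entry T b x)))"
  using t unfolding cands_def by fastforce

text \<open>Induction on the number of rounds: the entry for a branch draws on the entries for the
  strictly smaller branches behind the other neighbours of \<open>x\<close>, which one round less
  has already completed.\<close>

lemma covers_table:
  "adj t x y \<Longrightarrow> card (branch E x y) \<le> r \<Longrightarrow> covers g (tside x y) (entry (table r) x y)"
proof (induction r arbitrary: x y)
  case 0
  have "x \<in> branch E x y" by (simp add: branch_def)
  then have "card (branch E x y) \<noteq> 0" using finite_branch by auto
  with 0 show ?case by simp
next
  case (Suc r)
  let ?T = "table r"
  have xy: "x < length t" "y < length t" using t Suc.prems by auto
  have un: "branch E x y = insert x (\<Union>z\<in>{z. adj t x z \<and> z \<noteq> y}. branch E z x)"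
    using branch_unfold[of x y] Suc.prems by simp
  have "covers g (tside x y) (cands g t l ?T x y)"
  proof (cases "card {z. adj t x z} \<le> 1")
    case True
    then have only: "{z. adj t x z} = {y}"
      using Suc.prems finite_nbrs[of x] card_le_Suc0_iff_eq[of "{z. adj t x z}"] by auto
    from degree[OF xy(1)] True obtain v where v: "{v. v < length g \<and> col l v = x} = {v}" by auto
    have "{z. adj t x z \<and> z \<noteq> y} = {}" using only by auto
    then have "tside x y = {v}" using un v by auto
    moreover have "set (cands g t l ?T x y) = set (starts g l x)"
      using only unfolding set_cands by auto
    ultimately show ?thesis using covers_starts[OF v] covers_cong by metis
  next
    case False
    with degree[OF xy(1)] have d3: "card {z. adj t x z} = 3"
      and none: "{v. v < length g \<and> col l v = x} = {}" by auto
    have "card ({z. adj t x z} - {y}) = 2" using d3 Suc.prems finite_nbrs by simp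
    then obtain a' b' where "{z. adj t x z} - {y} = {a', b'}" "a' \<noteq> b'" by (auto simp: card_2_iff)
    \<comment> \<open>The two remaining neighbours are named in increasing order, since only such
      pairs occur in \<open>cands\<close>.\<close>
    then obtain a b where ab: "{z. adj t x z} - {y} = {a, b}" "a < b"
      by (metis insert_commute linorder_neqE_nat)
    have adj: "adj t x a" "adj t x b" "a \<noteq> y" "b \<noteq> y" using ab by blast+
    have "card (branch E a x) \<le> r" "card (branch E b x) \<le> r"
      using card_branch[of x y a] card_branch[of x y b] adj Suc.prems by auto
    moreover have "adj t a x" "adj t b x" using symE[of x a] symE[of x b] adj by auto
    ultimately have "covers g (tside a x) (entry ?T a x)" "covers g (tside b x) (entry ?T b x)"
      using Suc.IH by auto
    moreover have "tside a x \<inter> tside b x = {}"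
      using branch_disjoint[of x a b] adj ab by auto
    ultimately have "covers g (tside a x \<union> tside b x) (joins g (entry ?T a x) (entry ?T b x))"
      by (rule covers_joins)
    moreover have N: "adj t x z \<and> z \<noteq> y \<longleftrightarrow> z = a \<or> z = b" for z
      using eqset_imp_iff[OF ab(1), of z] by auto
    then have "{z. adj t x z \<and> z \<noteq> y} = {a, b}" by auto
    then have "tside a x \<union> tside b x = tside x y" using un none by auto
    moreover have "adj t x a' \<and> adj t x b' \<and> a' \<noteq> y \<and> b' \<noteq> y \<and> a' < b' \<longleftrightarrow> a' = a \<and> b' = b" for a' b'
      using N[of a'] N[of b'] ab(2) by auto
    then have "{(a', b'). adj t x a' \<and> adj t x b' \<and> a' \<noteq> y \<and> b' \<noteq> y \<and> a' < b'} = {(a, b)}"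
      by auto
    moreover have "set (starts g l x) = {}" using none by (auto simp: starts_of_def)
    ultimately have c: "covers g (tside x y) (joins g (entry ?T a x) (entry ?T b x))"
      and s: "set (joins g (entry ?T a x) (entry ?T b x)) = set (cands g t l ?T x y)"
      unfolding set_cands by simp_all
    from c s show ?thesis by (rule covers_cong)
  qed
  from covers_reduce[OF g chain[OF Suc.prems(1)] this]
  have "covers g (tside x y) (reduce g (cands g t l ?T x y))" .
  moreover have "entry (step g t l T) x y = reduce g (cands g t l T x y)" for T
    using xy by (simp add: entry_def step_def nthd_map)
  ultimately show ?case by simp
qed

lemma final_complete:
  assumes c: "length c = length g" "feas g c"
  shows "\<exists>X\<in>set (final g t l (table (length t))). feas g X \<and> no_worse g X c"
proof -
  \<comment> \<open>A candidate that covers all vertices is total, so overlaying it on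
    \<open>c\<close> gives the candidate itself.\<close>
  have fin: ?thesis
    if S: "covers g {..<length g} S" "set S \<subseteq> set (final g t l (table (length t)))" for S
  proof -
    obtain X where X: "X \<in> set S" "part g {..<length g} X" "feas g (overlay g X c)"
      "no_worse g (overlay g X c) c"
      using S(1) c unfolding covers_def by blast
    have "overlay g X c = X"
      by (rule col_ext) (use X(2) in \<open>auto simp: col_overlay part_def\<close>)
    with X S(2) show ?thesis by auto
  qed
  show ?thesis
  proof (cases "E = {}")
    case True
    \<comment> \<open>Connectedness without edges leaves only the tree vertex 0, so the graph has a
      single vertex and the start colourings already cover it.\<close>
    have "(0, x) \<in> E\<^sup>*" if "x < length t" for x using conn[OF ne that] .
    then have one: "x = 0" if "x < length t" for x using that unfolding True by auto
    have "{y. adj t 0 y} = {}" using True by auto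
    then obtain v where v: "{v. v < length g \<and> col l v = 0} = {v}" using degree[OF ne] by auto
    have "{v. v < length g \<and> col l v = 0} = {..<length g}" using l one by auto
    then have "covers g {..<length g} (starts g l 0)" using covers_starts[OF v] v by simp
    then show ?thesis by (rule fin) (use ne in \<open>auto simp: final_def\<close>)
  next
    case False
    then obtain x y where xy: "adj t x y" by auto
    then have yx: "adj t y x" using symE[of x y] by simp
    have card: "card (branch E a b) \<le> length t" if "adj t a b" for a b
    proof -
      have "z < length t" if "z \<in> branch E a b" for z
        using that t \<open>adj t a b\<close> by (auto simp: branch_def elim: rtranclE)
      then have "branch E a b \<subseteq> {..<length t}" by auto
      from card_mono[OF _ this] show ?thesis by simp
    qed
    let ?T = "table (length t)"
    have "tside x y \<inter> tside y x = {}" using branch_opposite[of x y] xy by auto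
    then have "covers g (tside x y \<union> tside y x) (joins g (entry ?T x y) (entry ?T y x))"
      using covers_table[OF xy card[OF xy]] covers_table[OF yx card[OF yx]] by (intro covers_joins)
    moreover have "col l v \<in> branch E x y \<union> branch E y x" if "v < length g" for v
      using branch_cover[of x y "col l v"] conn[of x "col l v"] l[OF that] t[OF xy] xy by auto
    then have "tside x y \<union> tside y x = {..<length g}" by auto
    ultimately have "covers g {..<length g} (joins g (entry ?T x y) (entry ?T y x))" by simp
    then show ?thesis by (rule fin) (use xy t[OF xy] in \<open>auto simp: final_def\<close>)
  qed
qed

lemma wf_final: "X \<in> set (final g t l (table (length t))) \<Longrightarrow> length X = length g"
proof -
  assume X: "X \<in> set (final g t l (table (length t)))"
  have "wf_col g X" if "X \<in> set (joins g (entry (table (length t)) x y) (entry (table (length t)) y x))" for x y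
    using wf_joins[OF _ _ that] wf_entry[OF wf_iter] by blast
  with X have "wf_col g X" unfolding final_def using wf_starts by fastforce
  then show ?thesis by (simp add: wf_col_def)
qed

lemma answer_correct:
  shows "answer g t l = [] \<Longrightarrow> length c = length g \<Longrightarrow> \<not> feas g c"
    and "answer g t l = X # Xs \<Longrightarrow> length X = length g \<and> feas g X"
    and "answer g t l = X # Xs \<Longrightarrow> length c = length g \<Longrightarrow> feas g c \<Longrightarrow> no_worse g X c"
proof -
  let ?F = "filter (feas g) (final g t l (table (length t)))"
  have a: "answer g t l = best g ?F" by (simp add: answer_def)
  show "\<not> feas g c" if "answer g t l = []" "length c = length g"
  proof
    assume "feas g c"
    from final_complete[OF that(2) this] have "?F \<noteq> []" by (auto simp: filter_empty_conv)
    from best_exists[OF this, of g] that(1) a show False by auto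
  qed
  assume "answer g t l = X # Xs"
  then have "X \<in> set (best g ?F)" using a by (metis list.set_intros(1))
  then have X: "X \<in> set ?F" "\<forall>X'\<in>set ?F. no_worse g X X'" using best_mem by blast+
  then show "length X = length g \<and> feas g X" using wf_final by auto
  assume "length c = length g" "feas g c"
  from final_complete[OF this] X(2) show "no_worse g X c" using no_worse_trans by auto
qed

end

section \<open>Translation to the graph library\<close>

lemma reachable_iff:
  assumes "parcs H \<subseteq> pverts H \<times> pverts H"
  shows "u \<rightarrow>\<^sup>*\<^bsub>with_proj H\<^esub> v \<longleftrightarrow> u \<in> pverts H \<and> (u, v) \<in> (parcs H)\<^sup>*"
proof
  assume "u \<rightarrow>\<^sup>*\<^bsub>with_proj H\<^esub> v"
  then show "u \<in> pverts H \<and> (u, v) \<in> (parcs H)\<^sup>*"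
    using rtrancl_on_rtranclI in_rtrancl_on_in_F unfolding reachable_def by fastforce
next
  assume uv: "u \<in> pverts H \<and> (u, v) \<in> (parcs H)\<^sup>*"
  then have "v \<in> pverts H" using assms by (auto elim: rtranclE)
  then show "u \<rightarrow>\<^sup>*\<^bsub>with_proj H\<^esub> v"
    using uv assms unfolding reachable_def by (auto intro!: rtrancl_consistent_rtrancl_on)
qed

lemma pair_graph_parcs: "pair_graph H \<Longrightarrow> parcs H \<subseteq> pverts H \<times> pverts H"
proof
  fix e assume "pair_graph H" "e \<in> parcs H"
  then interpret pair_graph H by simp
  show "e \<in> pverts H \<times> pverts H"
    using arc_fst_in_verts[OF \<open>e \<in> parcs H\<close>] arc_snd_in_verts[OF \<open>e \<in> parcs H\<close>] by (cases e) auto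
qed

lemma pair_graph_sym: "pair_graph H \<Longrightarrow> (u, v) \<in> parcs H \<Longrightarrow> (v, u) \<in> parcs H"
proof -
  assume "pair_graph H" and uv: "(u, v) \<in> parcs H"
  then interpret pair_graph H by simp
  show ?thesis using pair_sym_arcs uv unfolding symmetric_def by (auto dest: symD)
qed

lemma pair_graph_irrefl: "pair_graph H \<Longrightarrow> (u, u) \<notin> parcs H"
proof
  assume "pair_graph H" and uu: "(u, u) \<in> parcs H"
  then interpret pair_graph H by simp
  show False using pair_no_loops[OF uu] by simp
qed

lemma pair_graphI:
  assumes "finite (pverts H)" "parcs H \<subseteq> pverts H \<times> pverts H"
    "\<And>u v. (u, v) \<in> parcs H \<Longrightarrow> (v, u) \<in> parcs H" "\<And>u. (u, u) \<notin> parcs H"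
  shows "pair_graph H"
proof
  show "finite (pverts H)" by fact
  show "finite (parcs H)" using assms(1,2) finite_subset by blast
  show "fst e \<in> pverts H" if "e \<in> parcs H" for e using that assms(2) by auto
  show "snd e \<in> pverts H" if "e \<in> parcs H" for e using that assms(2) by auto
  show "fst e \<noteq> snd e" if "e \<in> parcs H" for e using that assms(4) by (cases e) auto
  show "symmetric (with_proj H)" unfolding symmetric_def using assms(3) by (auto intro: symI)
qed

lemma pair_graph_finite: "pair_graph H \<Longrightarrow> finite (pverts H) \<and> finite (parcs H)"
proof -
  assume "pair_graph H"
  then interpret pair_graph H .
  show ?thesis using pair_finite_verts pair_finite_arcs by simp
qed

text \<open>The library reduces connectedness to strong connectedness of the symmetric closure,
  which changes nothing for a symmetric digraph.\<close>

lemma connected_iff: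
  assumes "pair_graph H"
  shows "Digraph_Component.connected (with_proj H) \<longleftrightarrow>
    pverts H \<noteq> {} \<and> (\<forall>u\<in>pverts H. \<forall>v\<in>pverts H. (u, v) \<in> (parcs H)\<^sup>*)"
proof -
  have "(\<Union>e\<in>parcs H. {(fst e, snd e), (snd e, fst e)}) = parcs H"
    using pair_graph_sym[OF assms] by force
  then have "mk_symmetric (with_proj H) = H" by (simp add: mk_symmetric_def)
  then show ?thesis
    using reachable_iff[OF pair_graph_parcs[OF assms]]
    by (simp add: Digraph_Component.connected_def strongly_connected_def)
qed

lemma pair_graph_induced:
  assumes "pair_graph G" "S \<subseteq> pverts G" shows "pair_graph (induced G S)"
proof (rule pair_graphI)
  show "finite (pverts (induced G S))"
    using pair_graph_finite[OF assms(1)] assms(2) finite_subset by (auto simp: induced_def)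
qed (use pair_graph_sym[OF assms(1)] pair_graph_irrefl[OF assms(1)] in \<open>auto simp: induced_def\<close>)

lemma induces_connected_iff:
  assumes "pair_graph G" "S \<subseteq> pverts G"
  shows "induces_connected G S \<longleftrightarrow> conn_on (\<lambda>u v. (u, v) \<in> parcs G) S"
proof -
  have "parcs (induced G S) = edges_in (\<lambda>u v. (u, v) \<in> parcs G) S"
    by (auto simp: induced_def edges_in_def)
  moreover have "pverts (induced G S) = S" by (simp add: induced_def)
  ultimately show ?thesis
    unfolding induces_connected_def connected_iff[OF pair_graph_induced[OF assms]] conn_on_def by auto
qed

text \<open>The vertices reachable from \<open>u\<close> form a component, and completeness of it
  supplies the third edge of a path. Conversely, without induced paths on three vertices, induction
  along a walk shows that its ends are equal or adjacent.\<close>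

lemma cluster_graphs_iff:
  assumes H: "pair_graph H"
  shows "H \<in> cluster_graphs \<longleftrightarrow> P3_free (\<lambda>u v. (u, v) \<in> parcs H) (pverts H)"
proof
  assume c: "H \<in> cluster_graphs"
  have sub: "parcs H \<subseteq> pverts H \<times> pverts H" by (rule pair_graph_parcs[OF H])
  show "P3_free (\<lambda>u v. (u, v) \<in> parcs H) (pverts H)"
    unfolding P3_free_def
  proof (intro ballI impI, elim conjE)
    fix u v w assume uvw: "u \<in> pverts H" "(u, v) \<in> parcs H" "(v, w) \<in> parcs H" "u \<noteq> w"
    let ?C = "{x. (u, x) \<in> (parcs H)\<^sup>*}"
    have "sym ((parcs H)\<^sup>*)" using pair_graph_sym[OF H] by (intro sym_rtrancl) (auto intro: symI)
    then have s: "(a, b) \<in> (parcs H)\<^sup>* \<Longrightarrow> (b, a) \<in> (parcs H)\<^sup>*" for a b by (rule symD)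
    have "x \<in> pverts H" if "x \<in> ?C" for x using that uvw(1) sub by (auto elim: rtranclE)
    then have C: "?C \<in> pre_digraph.sccs_verts (with_proj H)"
      unfolding pre_digraph.sccs_verts_def reachable_iff[OF sub]
      using s by (auto intro: rtrancl_trans)
    have uw: "u \<in> ?C" "w \<in> ?C" using uvw by (auto intro: rtrancl_trans)
    have "\<forall>C\<in>pre_digraph.sccs_verts (with_proj H). \<forall>u\<in>C. \<forall>v\<in>C. u \<noteq> v \<longrightarrow> (u, v) \<in> parcs H"
      using c by (simp add: cluster_graphs_def)
    from this[rule_format, OF C uw uvw(4)] show "(u, w) \<in> parcs H" .
  qed
next
  assume f: "P3_free (\<lambda>u v. (u, v) \<in> parcs H) (pverts H)"
  have sub: "parcs H \<subseteq> pverts H \<times> pverts H" by (rule pair_graph_parcs[OF H])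
  have adj: "u = v \<or> (u, v) \<in> parcs H" if "(u, v) \<in> (parcs H)\<^sup>*" for u v
    using that
  proof (induction rule: rtrancl_induct)
    case (step v w)
    then show ?case using P3_freeD[OF f, of u v w] sub by auto
  qed simp
  then show "H \<in> cluster_graphs"
    unfolding cluster_graphs_def
  proof (intro CollectI conjI H ballI impI)
    fix C u v assume "C \<in> pre_digraph.sccs_verts (with_proj H)" "u \<in> C" "v \<in> C" "u \<noteq> v"
    then have "u \<rightarrow>\<^sup>*\<^bsub>with_proj H\<^esub> v" unfolding pre_digraph.sccs_verts_def by blast
    then show "(u, v) \<in> parcs H" using adj[of u v] \<open>u \<noteq> v\<close> reachable_iff[OF sub] by simp
  qed
qed

lemma pair_graph_complement: "pair_graph H \<Longrightarrow> pair_graph (complement H)"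
  by (rule pair_graphI)
    (use pair_graph_finite[of H] pair_graph_sym[of H] in \<open>auto simp: complement_def\<close>)

lemma complement_complement: "pair_graph H \<Longrightarrow> complement (complement H) = H"
  using pair_graph_parcs[of H] pair_graph_irrefl[of H]
  by (cases H) (auto simp: complement_def)

text \<open>Complementation is an involution on graphs and hence injective, so the image
  \<open>co_class P\<close> contains a complement only if \<open>P\<close> contains the
  graph.\<close>

lemma mem_co_class:
  assumes "graph_property P" "pair_graph H"
  shows "H \<in> P \<longleftrightarrow> complement H \<in> co_class P"
proof
  assume "complement H \<in> co_class P"
  then obtain H' where H': "complement H = complement H'" "H' \<in> P" by (auto simp: co_class_def)
  then have "pair_graph H'" using assms(1) by (auto simp: graph_property_def all_graphs_def)
  then have "H = H'" using complement_complement assms(2) H'(1) by metis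
  then show "H \<in> P" using H' by simp
qed (simp add: co_class_def)

lemma P3_free_cong:
  "(\<And>u v. u \<in> S \<Longrightarrow> v \<in> S \<Longrightarrow> r u v \<longleftrightarrow> r' u v) \<Longrightarrow> P3_free r S \<longleftrightarrow> P3_free r' S"
  unfolding P3_free_def by (smt (verit))

lemma length_adj_matrix [simp]: "length (adj_matrix G) = card (pverts G)"
  by (simp add: adj_matrix_def Let_def)

lemma adj_adj_matrix:
  assumes "pair_graph G" "pverts G = {..<n}"
  shows "adj (adj_matrix G) u v \<longleftrightarrow> (u, v) \<in> parcs G"
proof -
  have "(u, v) \<in> parcs G \<Longrightarrow> u < n \<and> v < n" using pair_graph_parcs[OF assms(1)] assms(2) by auto
  then show ?thesis unfolding adj_def adj_matrix_def by (auto simp: assms(2) nthd_map) (auto simp: nthd_def)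
qed

lemma sym_graph_adj_matrix:
  assumes "pair_graph G" "pverts G = {..<n}" shows "sym_graph (adj_matrix G)"
  unfolding sym_graph_def adj_adj_matrix[OF assms]
  using pair_graph_sym[OF assms(1)] pair_graph_irrefl[OF assms(1)] pair_graph_parcs[OF assms(1)] assms(2)
  by auto

text \<open>A violation of the chain condition consists of two cut edges that form an induced
  matching of size two.\<close>

lemma mim_chain_cut:
  assumes G: "pair_graph G" and "mim G A \<le> 1"
  shows "chain_cut (\<lambda>u v. (u, v) \<in> parcs G) A"
  unfolding chain_cut_def
proof (intro ballI allI impI, rule ccontr)
  fix a a' b b'
  assume h: "a \<in> A" "a' \<in> A" "b \<notin> A" "b' \<notin> A" "(a, b) \<in> parcs G" "(a', b') \<in> parcs G"
    "\<not> ((a, b') \<in> parcs G \<or> (a', b) \<in> parcs G)"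
  let ?M = "{(a, b), (a', b')}"
  have "induced_cut_matching G A ?M"
    using h pair_graph_parcs[OF G] unfolding induced_cut_matching_def by auto
  moreover have "{M. induced_cut_matching G A M} \<subseteq> Pow (parcs G)"
    unfolding induced_cut_matching_def by auto
  then have "finite {M. induced_cut_matching G A M}"
    using pair_graph_finite[OF G] finite_subset by auto
  ultimately have "card ?M \<le> mim G A" unfolding mim_def by (intro Max_ge) auto
  moreover have "a \<noteq> a'" using h by auto
  then have "card ?M = 2" by simp
  ultimately show False using assms(2) by simp
qed

lemma side_eq:
  assumes "pair_graph T" "x \<in> pverts T"
  shows "side G T L (x, y) = {v \<in> pverts G. L v \<in> branch (parcs T) x y}"
proof -
  have "parcs (remove_edge T (x, y)) \<subseteq> pverts (remove_edge T (x, y)) \<times> pverts (remove_edge T (x, y))"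
    using pair_graph_parcs[OF assms(1)] by (auto simp: remove_edge_def)
  from reachable_iff[OF this] show ?thesis
    using assms(2) by (simp add: side_def branch_def remove_edge_def)
qed

lemma pawalk_snoc:
  "pcas x p y \<Longrightarrow> pcas x (p @ [(y, z)]) z \<and> pawalk_verts x (p @ [(y, z)]) = pawalk_verts x p @ [z]"
  by (induction p arbitrary: x) auto

text \<open>A simple path from \<open>x\<close> to \<open>y\<close> that avoids the edge closes up
  with it to a cycle. The path is neither empty nor the deleted arc alone, so the cycle has at least
  three arcs and is not mere backtracking.\<close>

lemma undirected_tree_bridge:
  assumes T: "undirected_tree T" and xy: "(x, y) \<in> parcs T"
  shows "y \<notin> branch (parcs T) x y"
proof
  assume "y \<in> branch (parcs T) x y"
  have G: "pair_graph T" using T by (simp add: undirected_tree_def)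
  let ?T' = "remove_edge T (x, y)"
  have sub: "parcs ?T' \<subseteq> pverts ?T' \<times> pverts ?T'"
    using pair_graph_parcs[OF G] by (auto simp: remove_edge_def)
  have "x \<in> pverts ?T'" using pair_graph_parcs[OF G] xy by (auto simp: remove_edge_def)
  then have "x \<rightarrow>\<^sup>*\<^bsub>with_proj ?T'\<^esub> y"
    using reachable_iff[OF sub] \<open>y \<in> branch (parcs T) x y\<close> by (simp add: branch_def remove_edge_def)
  then have reach: "x \<rightarrow>\<^sup>*\<^bsub>with_proj ?T'\<^esub> y" .
  interpret T': pair_wf_digraph ?T'
    using sub by unfold_locales auto
  obtain p where "T'.apath x p y" using reach T'.reachable_apath by blast
  then have p: "set p \<subseteq> parcs ?T'" "pcas x p y" "distinct (pawalk_verts x p)"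
    unfolding T'.apath_def T'.awalk_def by auto
  interpret T: pair_graph T by (rule G)
  let ?p = "p @ [(y, x)]"
  have snoc: "pcas x ?p x" "pawalk_verts x ?p = pawalk_verts x p @ [x]"
    using pawalk_snoc[OF p(2)] by auto
  have yx: "(y, x) \<in> parcs T" using pair_graph_sym[OF G xy] .
  have "x \<in> pverts T" using pair_graph_parcs[OF G] xy by blast
  moreover have "set ?p \<subseteq> parcs T" using p(1) yx by (simp add: remove_edge_def subset_iff)
  ultimately have "T.awalk x ?p x" unfolding T.awalk_def using snoc(1) by (intro conjI)
  moreover obtain vs where vs: "pawalk_verts x p = x # vs" using p(2) by (cases p) auto
  then have "distinct (tl (pawalk_verts x ?p))" using snoc(2) p(3) by auto
  ultimately have "T.cycle ?p" unfolding T.cycle_def by auto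
  moreover have "length ?p \<ge> 3"
  proof -
    have "x \<noteq> y" using pair_graph_irrefl[OF G] xy by auto
    then have "p \<noteq> []" using p(2) by auto
    moreover have "p \<noteq> [e]" for e using p(1,2) by (cases e) (auto simp: remove_edge_def)
    ultimately have "length p \<ge> 2" by (cases p; cases "tl p") auto
    then show ?thesis by simp
  qed
  ultimately show False using T unfolding undirected_tree_def by blast
qed

lemma finite_cofinite_eventually:
  assumes "finite S \<or> finite (- S)"
  shows "\<exists>N. \<forall>a\<ge>N. \<forall>b\<ge>N. (a :: nat) \<in> S \<longleftrightarrow> b \<in> S"
  using assms
proof
  assume "finite S"
  then obtain N where "\<forall>a\<in>S. a < N" using finite_nat_set_iff_bounded by blast
  then show ?thesis by (intro exI[of _ N]) (auto simp: not_less[symmetric])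
next
  assume "finite (- S)"
  then obtain N where "\<forall>a\<in>- S. a < N" using finite_nat_set_iff_bounded by blast
  then show ?thesis by (intro exI[of _ N]) (auto simp: not_less[symmetric])
qed

lemma truncation_bound:
  fixes k :: nat
  assumes "\<And>i j. i \<in> {1..k} \<Longrightarrow> j \<in> {1..k} \<Longrightarrow> finite (D i j) \<or> finite (- D i j)"
  shows "\<exists>d\<ge>1. \<forall>i\<in>{1..k}. \<forall>j\<in>{1..k}. \<forall>a b :: nat. min d a = min d b \<longrightarrow> (a \<in> D i j \<longleftrightarrow> b \<in> D i j)"
proof -
  have "\<forall>ij\<in>{1..k} \<times> {1..k}. \<exists>N. \<forall>a\<ge>N. \<forall>b\<ge>N. a \<in> D (fst ij) (snd ij) \<longleftrightarrow> b \<in> D (fst ij) (snd ij)"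
    using assms finite_cofinite_eventually by auto
  then obtain N where N: "\<And>ij a b. ij \<in> {1..k} \<times> {1..k} \<Longrightarrow> a \<ge> N ij \<Longrightarrow> b \<ge> N ij \<Longrightarrow>
      a \<in> D (fst ij) (snd ij) \<longleftrightarrow> b \<in> D (fst ij) (snd ij)"
    by metis
  \<comment> \<open>The sum of the thresholds dominates each of them; the successor ensures
    \<open>d \<ge> 1\<close>, which the treatment of connectivity requires.\<close>
  define d where "d = Suc (\<Sum>ij\<in>{1..k} \<times> {1..k}. N ij)"
  have "a \<in> D i j \<longleftrightarrow> b \<in> D i j" if ij: "i \<in> {1..k}" "j \<in> {1..k}" and eq: "min d a = min d b" for i j a b
  proof (cases "a = b")
    case False
    with eq have "a \<ge> d" "b \<ge> d" by (auto simp: min_def split: if_splits)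
    moreover have "N (i, j) \<le> (\<Sum>ij\<in>{1..k} \<times> {1..k}. N ij)"
      using ij by (intro member_le_sum) auto
    ultimately show ?thesis using N[of "(i, j)" a b] ij unfolding d_def by auto
  qed simp
  moreover have "d \<ge> 1" by (simp add: d_def)
  ultimately show ?thesis by (intro exI[of _ d] conjI ballI allI impI) assumption+
qed

lemma connected_feasible_cong:
  assumes "\<And>i. i \<in> {1..k} \<Longrightarrow> V i = W i" "C \<subseteq> {1..k}"
  shows "connected_feasible k P D C G V \<longleftrightarrow> connected_feasible k P D C G W"
proof -
  have "is_partition k G V \<longleftrightarrow> is_partition k G W"
    unfolding is_partition_def disjoint_family_on_def using assms(1) by simp
  then show ?thesis unfolding connected_feasible_def feasible_def
    using assms by (simp add: subset_iff)
qed

lemma parts_of_partition: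
  assumes "is_partition k G V" "pverts G = {..<n}"
  shows "\<exists>c. length c = n \<and> (\<forall>i\<in>{1..k}. parts_of c i = V i)"
proof -
  have "\<forall>v. \<exists>i. v < n \<longrightarrow> i \<in> {1..k} \<and> v \<in> V i"
    using assms unfolding is_partition_def by blast
  then obtain f where f: "\<And>v. v < n \<Longrightarrow> f v \<in> {1..k} \<and> v \<in> V (f v)" by metis
  have sub: "v < n" if "v \<in> V i" "i \<in> {1..k}" for v i
    using that assms by (auto simp: is_partition_def)
  have uniq: "i = f v" if "i \<in> {1..k}" "v \<in> V i" for i v
    using that f[OF sub[OF that(2,1)]] assms(1) unfolding is_partition_def disjoint_family_on_def by blast
  have "parts_of (map f [0..<n]) i = V i" if i: "i \<in> {1..k}" for i
  proof (intro set_eqI iffI)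
    fix v
    show "v \<in> V i" if "v \<in> parts_of (map f [0..<n]) i"
    proof -
      have "v < n" "f v = i" using that by (auto simp: parts_of_def)
      then show ?thesis using f by blast
    qed
    show "v \<in> parts_of (map f [0..<n]) i" if "v \<in> V i"
    proof -
      have "v < n" "f v = i" using sub[OF that i] uniq[OF i that] by auto
      then show ?thesis by (simp add: parts_of_def)
    qed
  qed
  then show ?thesis by (intro exI[of _ "map f [0..<n]"]) auto
qed

lemma parts_of_cls: "length c = length g \<Longrightarrow> parts_of c i = set (cls g c i)"
  by (auto simp: parts_of_def set_cls nthd_def)

lemma (in partition_problem) feas_iff:
  assumes G: "pair_graph G" "pverts G = {..<n}" and c: "length c = n"
    and props: "\<And>i. i \<in> {1..k} \<Longrightarrow> graph_property (P i)"
    and cases: "\<And>i. i \<in> {1..k} \<Longrightarrow>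
      P i \<in> {all_graphs, cluster_graphs} \<or> co_class (P i) \<in> {all_graphs, cluster_graphs}"
    and CL: "CL = {i \<in> {1..k}. P i = cluster_graphs}"
    and CO: "CO = {i \<in> {1..k}. co_class (P i) = cluster_graphs}"
  shows "feas (adj_matrix G) c \<longleftrightarrow> connected_feasible k P D C G (parts_of c)"
proof -
  let ?g = "adj_matrix G"
  have n: "length ?g = n" by (simp add: G(2))
  have col: "col c v = c ! v" if "v < n" for v using that c by (simp add: nthd_def)
  have parts: "parts_of c i = set (cls ?g c i)" for i using c n by (intro parts_of_cls) simp
  have adj: "adj ?g u v \<longleftrightarrow> (u, v) \<in> parcs G" for u v by (rule adj_adj_matrix[OF G])
  have sub: "parts_of c i \<subseteq> pverts G" for i using c G(2) by (auto simp: parts_of_def)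
  have part: "is_partition k G (parts_of c) \<longleftrightarrow> (\<forall>v\<in>set [0..<length ?g]. col c v \<in> {1..k})"
  proof -
    have "disjoint_family_on (parts_of c) {1..k}" by (auto simp: disjoint_family_on_def parts_of_def)
    moreover have "(\<Union>i\<in>{1..k}. parts_of c i) = {v. v < n \<and> col c v \<in> {1..k}}"
      using col c by (auto simp: parts_of_def)
    ultimately have "is_partition k G (parts_of c) \<longleftrightarrow> {v. v < n \<and> col c v \<in> {1..k}} = {..<n}"
      unfolding is_partition_def G(2) by (simp only: simp_thms)
    also have "\<dots> \<longleftrightarrow> (\<forall>v<n. col c v \<in> {1..k})" by blast
    finally show ?thesis unfolding n by auto
  qed
  have cluster: "induced G S \<in> cluster_graphs \<longleftrightarrow> P3_free (coadj True ?g) S" if "S \<subseteq> pverts G" for S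
    unfolding cluster_graphs_iff[OF pair_graph_induced[OF G(1) that]]
    by (simp add: induced_def) (rule P3_free_cong, simp add: coadj_def adj)
  have cocluster: "complement (induced G S) \<in> cluster_graphs \<longleftrightarrow> P3_free (coadj False ?g) S"
    if "S \<subseteq> pverts G" for S
    unfolding cluster_graphs_iff[OF pair_graph_complement[OF pair_graph_induced[OF G(1) that]]]
    by (simp add: induced_def complement_def) (rule P3_free_cong, auto simp add: coadj_def adj)
  have prop_iff: "induced G S \<in> P i \<longleftrightarrow>
      (i \<in> CL \<longrightarrow> P3_free (coadj True ?g) S) \<and> (i \<in> CO \<longrightarrow> P3_free (coadj False ?g) S)"
    if i: "i \<in> {1..k}" and S: "S \<subseteq> pverts G" for i S
  proof -
    let ?H = "induced G S"
    have H: "pair_graph ?H" by (rule pair_graph_induced[OF G(1) S])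
    have co: "?H \<in> P i \<longleftrightarrow> complement ?H \<in> co_class (P i)" by (rule mem_co_class[OF props[OF i] H])
    have all: "?H \<in> all_graphs" "complement ?H \<in> all_graphs"
      using H pair_graph_complement[OF H] by (simp_all add: all_graphs_def)
    have 1: "i \<in> CL \<Longrightarrow> ?H \<in> P i \<longleftrightarrow> P3_free (coadj True ?g) S"
      using cluster[OF S] by (simp add: CL)
    have 2: "i \<in> CO \<Longrightarrow> ?H \<in> P i \<longleftrightarrow> P3_free (coadj False ?g) S"
      using cocluster[OF S] co by (simp add: CO)
    \<comment> \<open>In this case \<open>P i\<close> or its co-class consists of all graphs, and so
      contains \<open>?H\<close> or its complement, respectively.\<close>
    have 3: "i \<notin> CL \<Longrightarrow> i \<notin> CO \<Longrightarrow> ?H \<in> P i"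
      using cases[OF i] i all co by (auto simp: CL CO)
    show ?thesis using 1 2 3 by blast
  qed
  have deg: "card (nbhd G v \<inter> parts_of c j) = deg ?g c v j" for v j
    unfolding deg_card parts adj nbhd_def by (rule arg_cong[where f = card]) auto
  have conn: "induces_connected G (parts_of c i) \<longleftrightarrow> conn_ok ?g c c i"
    if "\<forall>v\<in>set [0..<length ?g]. col c v \<in> {1..k}" for i
    unfolding induces_connected_iff[OF G(1) sub] conn_ok_iff unfolding parts
  proof (rule conn_on_cong)
    fix a b assume "a \<in> set (cls ?g c i)"
    then have "a \<in> set [0..<length ?g]" by (simp add: set_cls)
    with that have "col c a \<noteq> 0" by fastforce
    then show "(a, b) \<in> parcs G \<longleftrightarrow> link ?g c a b" by (simp add: link_def adj)
  qed
  show ?thesis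
  proof (cases "\<forall>v\<in>set [0..<length ?g]. col c v \<in> {1..k}")
    case False
    then show ?thesis unfolding feas_def connected_feasible_def feasible_def part by blast
  next
    case True
    have d: "deg_ok ?g c c \<longleftrightarrow> (\<forall>i\<in>{1..k}. \<forall>j\<in>{1..k}. \<forall>v\<in>parts_of c i. card (nbhd G v \<inter> parts_of c j) \<in> D i j)"
      unfolding deg_ok_def deg unfolding parts set_cls by auto
    have p: "(\<forall>i\<in>CL. cluster_ok True ?g c i) \<and> (\<forall>i\<in>CO. cluster_ok False ?g c i) \<longleftrightarrow>
        (\<forall>i\<in>{1..k}. induced G (parts_of c i) \<in> P i)"
      using prop_iff[OF _ sub] fin unfolding cluster_ok_iff parts[symmetric] by blast
    have "feas ?g c \<longleftrightarrow> phi ?g c c" using True by (simp add: feas_def)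
    also have "\<dots> \<longleftrightarrow> connected_feasible k P D C G (parts_of c)"
      unfolding phi_def connected_feasible_def feasible_def part
      using True p d conn[OF True] by blast
    finally show ?thesis .
  qed
qed

lemma decomposed_instance_instances:
  assumes "partition_problem k D CL CO C d" and inst: "(G, T, L) \<in> instances 1"
  shows "decomposed_instance k D CL CO C d (adj_matrix G) (adj_matrix T) (map L [0..<card (pverts G)])"
proof -
  interpret partition_problem k D CL CO C d by fact
  obtain n m where G: "pair_graph G" "pverts G = {..<n}" and m: "pverts T = {..<m}"
    and b: "branch_decomposition G T L" and w: "mim_width G T L \<le> 1"
    using inst by (auto simp: instances_def)
  have tree: "undirected_tree T" and int: "\<And>x. x \<in> pverts T - leaves T \<Longrightarrow> card (nbhd T x) = 3"
    and bij: "bij_betw L (pverts G) (leaves T)" using b by (auto simp: branch_decomposition_def)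
  have T: "pair_graph T" using tree by (simp add: undirected_tree_def)
  have adjT: "adj (adj_matrix T) x y \<longleftrightarrow> (x, y) \<in> parcs T" for x y by (rule adj_adj_matrix[OF T m])
  have adjG: "adj (adj_matrix G) = (\<lambda>x y. (x, y) \<in> parcs G)"
    using adj_adj_matrix[OF G] by (intro ext)
  have E: "{(x, y). (x, y) \<in> parcs T} = parcs T" by auto
  have len: "length (adj_matrix G) = n" "length (adj_matrix T) = m" by (simp_all add: G m)
  have col: "col (map L [0..<card (pverts G)]) v = L v" if "v < n" for v
    using that by (simp add: nthd_map G)
  have conn: "pverts T \<noteq> {}" "\<And>x y. x \<in> pverts T \<Longrightarrow> y \<in> pverts T \<Longrightarrow> (x, y) \<in> (parcs T)\<^sup>*"
    using tree connected_iff[OF T] by (auto simp: undirected_tree_def)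
  have parcsT: "x < m \<and> y < m" if "(x, y) \<in> parcs T" for x y
    using pair_graph_parcs[OF T] m that by auto
  have fin: "finite (parcs T)" using pair_graph_finite[OF T] by simp
  have fibre: "{v. v < n \<and> col (map L [0..<card (pverts G)]) v = x} = {v \<in> pverts G. L v = x}" for x
    using col G(2) by auto
  show ?thesis
  proof (unfold_locales, unfold adjT E len fibre)
    fix x y
    show "finite (parcs T)" by (rule fin)
    show "(x, y) \<in> parcs T \<Longrightarrow> (y, x) \<in> parcs T" by (rule pair_graph_sym[OF T])
    show "(x, x) \<notin> parcs T" by (rule pair_graph_irrefl[OF T])
    show "(x, y) \<in> parcs T \<Longrightarrow> y \<notin> branch (parcs T) x y" by (rule undirected_tree_bridge[OF tree])
    show "sym_graph (adj_matrix G)" by (rule sym_graph_adj_matrix[OF G])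
    show "(x, y) \<in> parcs T \<Longrightarrow> x < m \<and> y < m" by (rule parcsT)
    show "x < m \<Longrightarrow> y < m \<Longrightarrow> (x, y) \<in> (parcs T)\<^sup>*" using conn(2) m by simp
    show "0 < m" using conn(1) m by auto
    show "x < n \<Longrightarrow> col (map L [0..<card (pverts G)]) x < m"
    proof -
      assume x: "x < n"
      then have "L x \<in> leaves T" using bij G(2) by (auto simp: bij_betw_def)
      then show ?thesis using col[OF x] m by (simp add: leaves_def)
    qed
    assume "x < m"
    then have x: "x \<in> pverts T" using m by simp
    have nb: "{y. (x, y) \<in> parcs T} = nbhd T x" by (simp add: nbhd_def)
    show "card {y. (x, y) \<in> parcs T} \<le> 1 \<and> (\<exists>v. {v \<in> pverts G. L v = x} = {v}) \<or>
      card {y. (x, y) \<in> parcs T} = 3 \<and> {v \<in> pverts G. L v = x} = {}"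
    proof (cases "x \<in> leaves T")
      case True
      then have "x \<in> L ` pverts G" using bij by (simp add: bij_betw_def)
      then obtain v where v: "v \<in> pverts G" "L v = x" by blast
      moreover have "inj_on L (pverts G)" using bij by (simp add: bij_betw_def)
      ultimately have "{v \<in> pverts G. L v = x} = {v}" by (auto dest: inj_onD)
      then show ?thesis using True unfolding nb leaves_def by blast
    next
      case False
      then have "x \<notin> L ` pverts G" using bij by (simp add: bij_betw_def)
      then have "{v \<in> pverts G. L v = x} = {}" by blast
      then show ?thesis using int[of x] x False unfolding nb by simp
    qed
  next
    fix x y assume xy: "(x, y) \<in> parcs T"
    then have x: "x \<in> pverts T" using parcsT m by auto
    have "mim G (side G T L (x, y)) \<le> mim_width G T L"
      unfolding mim_width_def using xy fin by (intro Max_ge) auto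
    with w have "chain_cut (\<lambda>u v. (u, v) \<in> parcs G) (side G T L (x, y))"
      by (intro mim_chain_cut[OF G(1)]) simp
    moreover have "side G T L (x, y) =
        {v. v < n \<and> col (map L [0..<card (pverts G)]) v \<in> branch (parcs T) x y}"
      unfolding side_eq[OF T x] using col G(2) by auto
    ultimately show "chain_cut (adj (adj_matrix G))
        {v. v < n \<and> col (map L [0..<card (pverts G)]) v \<in> branch (parcs T) x y}"
      unfolding adjG by simp
  qed
qed

lemma connected_feasible_poly_time:
  fixes k :: nat and P :: "nat \<Rightarrow> graph_class" and D :: "nat \<Rightarrow> nat \<Rightarrow> nat set" and R :: objective
  assumes k: "k \<ge> 1"
    and props: "\<And>i. i \<in> {1..k} \<Longrightarrow> graph_property (P i)"
    and D: "\<And>i j. i \<in> {1..k} \<Longrightarrow> j \<in> {1..k} \<Longrightarrow> finite (D i j) \<or> finite (- D i j)"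
    and cases: "\<And>i. i \<in> {1..k} \<Longrightarrow>
           P i \<in> {all_graphs, cluster_graphs} \<or> co_class (P i) \<in> {all_graphs, cluster_graphs}"
    and C: "C \<subseteq> {1..k}"
  shows "poly_time_solvable (instances 1) enc_instance (correct_answer R (connected_feasible k P D C))"
proof -
  obtain d where d: "d \<ge> 1" "\<forall>i\<in>{1..k}. \<forall>j\<in>{1..k}. \<forall>a b. min d a = min d b \<longrightarrow> (a \<in> D i j \<longleftrightarrow> b \<in> D i j)"
    using truncation_bound[of k D, OF D] by blast
  define CL where "CL = {i \<in> {1..k}. P i = cluster_graphs}"
  define CO where "CO = {i \<in> {1..k}. co_class (P i) = cluster_graphs}"
  have prob: "partition_problem k D CL CO C d"
  proof
    show "a \<in> D i j \<longleftrightarrow> b \<in> D i j" if "i \<in> {1..k}" "j \<in> {1..k}" "min d a = min d b" for i j a b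
      using d(2) that by blast
  qed (use k d(1) C D in \<open>auto simp: CL_def CO_def\<close>)
  interpret partition_problem k D CL CO C d R by (rule prob)
  let ?ans = "\<lambda>G T L. answer (adj_matrix G) (adj_matrix T) (map L [0..<card (pverts G)])"
  let ?out = "\<lambda>G T L. enc_option enc_col (case ?ans G T L of [] \<Rightarrow> None | X # _ \<Rightarrow> Some X)"
  have correct: "correct_answer R (connected_feasible k P D C) (G, T, L) (?out G T L)"
    if inst: "(G, T, L) \<in> instances 1" for G T L
  proof -
    let ?g = "adj_matrix G" and ?F = "connected_feasible k P D C G"
    obtain n where G: "pair_graph G" "pverts G = {..<n}" using inst by (auto simp: instances_def)
    have len: "length ?g = n" by (simp add: G(2))
    interpret decomposed_instance k D CL CO C d R ?g "adj_matrix T" "map L [0..<card (pverts G)]"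
      by (rule decomposed_instance_instances[OF prob inst])
    have iff: "feas ?g c \<longleftrightarrow> ?F (parts_of c)" if "length c = n" for c
      by (rule feas_iff[OF G that props cases CL_def CO_def])
    have ex: "\<exists>c. length c = n \<and> feas ?g c \<and> parts_of c 1 = V 1" if V: "?F V" for V
    proof -
      obtain c where c: "length c = n" "\<forall>i\<in>{1..k}. parts_of c i = V i"
        using parts_of_partition[OF _ G(2)] V unfolding connected_feasible_def feasible_def by blast
      then have "?F (parts_of c)" using connected_feasible_cong[of k "parts_of c" V C] V C by blast
      then show ?thesis using iff[OF c(1)] c k by auto
    qed
    have ones: "length (cls ?g c 1) = card (parts_of c 1)" if "length c = n" for c
      unfolding length_cls using parts_of_cls[of c ?g 1] that len by simp
    show ?thesis
    proof (cases "?ans G T L")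
      case Nil
      have "\<nexists>V. ?F V" using ex answer_correct(1)[OF Nil] len by metis
      then show ?thesis unfolding Nil by simp
    next
      case (Cons X Xs)
      have X: "length X = n" "feas ?g X" using answer_correct(2)[OF Cons] len by auto
      have "optimal R ?F (parts_of X)"
      proof -
        have F: "?F (parts_of X)" using iff X by blast
        have "no_worse ?g X c" if "length c = n" "feas ?g c" for c
          using answer_correct(3)[OF Cons] that len by simp
        then have le: "(R = ObjMin \<longrightarrow> card (parts_of X 1) \<le> card (W 1)) \<and>
            (R = ObjMax \<longrightarrow> card (W 1) \<le> card (parts_of X 1))" if "?F W" for W
          using ex[OF that] ones X(1) unfolding no_worse_def by metis
        show ?thesis using F le by (cases R) auto
      qed
      then show ?thesis unfolding Cons using X(1) G(2) by auto
    qed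
  qed
  obtain p q where pq: "\<And>g t l. \<exists>u. runs p (Pair (enc_mat g) (Pair (enc_mat t) (enc_col l)))
      (enc_option enc_col (case answer g t l of [] \<Rightarrow> None | X # _ \<Rightarrow> Some X)) u \<and>
      u \<le> poly q (size (Pair (enc_mat g) (Pair (enc_mat t) (enc_col l))))"
    using answer_poly_time by blast
  show ?thesis unfolding poly_time_solvable_def
  proof (rule exI[of _ p], rule exI[of _ q], rule ballI)
    fix x assume "x \<in> instances 1"
    obtain G T L where x: "x = (G, T, L)" by (cases x)
    have enc: "enc_instance x =
        Pair (enc_mat (adj_matrix G)) (Pair (enc_mat (adj_matrix T)) (enc_col (map L [0..<card (pverts G)])))"
      by (simp add: x enc_graph_def)
    from pq[of "adj_matrix G" "adj_matrix T" "map L [0..<card (pverts G)]"]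
    obtain u where u: "runs p (enc_instance x) (?out G T L) u" "u \<le> poly q (size (enc_instance x))"
      unfolding enc by blast
    with correct \<open>x \<in> instances 1\<close>
    show "\<exists>y u. runs p (enc_instance x) y u \<and> u \<le> poly q (size (enc_instance x)) \<and>
        correct_answer R (connected_feasible k P D C) x y"
      unfolding x by blast
  qed
qed

theorem theorem9:
  fixes k :: nat
    and P :: "nat \<Rightarrow> graph_class"
    and D :: "nat \<Rightarrow> nat \<Rightarrow> nat set"
    and R :: objective
  assumes "k \<ge> 1"
    and "\<And>i. i \<in> {1..k} \<Longrightarrow> graph_property (P i)"
    and "\<And>i j. i \<in> {1..k} \<Longrightarrow> j \<in> {1..k} \<Longrightarrow> finite (D i j) \<or> finite (- D i j)"
    and "\<And>i. i \<in> {1..k} \<Longrightarrow>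
           P i \<in> {all_graphs, cluster_graphs} \<or> co_class (P i) \<in> {all_graphs, cluster_graphs}"
  shows "poly_time_solvable (instances 1) enc_instance
            (correct_answer R (feasible k P D)) \<and>
         (\<forall>C \<subseteq> {1..k}. poly_time_solvable (instances 1) enc_instance
            (correct_answer R (connected_feasible k P D C)))"
proof (intro conjI allI impI)
  \<comment> \<open>The problem without connectivity requirements is the case where no part is
    prescribed to be connected.\<close>
  have "feasible k P D = connected_feasible k P D {}"
    by (intro ext) (simp add: connected_feasible_def)
  then show "poly_time_solvable (instances 1) enc_instance (correct_answer R (feasible k P D))"
    using connected_feasible_poly_time[where C = "{}" and D = D and P = P and R = R, OF assms] by simp
  show "poly_time_solvable (instances 1) enc_instance (correct_answer R (connected_feasible k P D C))"
    if "C \<subseteq> {1..k}" for C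
    by (rule connected_feasible_poly_time[where D = D and P = P and R = R, OF assms that])
qed

end
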